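(* Assume hypothesis (P) of the context, and let $\tilde\nu=1-g_\kappa^{\{1\}}(R)>0$. Let $L^{(1)}\ge L^{(2)}\ge\cdots$ be the cycle lengths of $\sigma\in S_N$ arranged in decreasing order ($L^{(1)}$ the length of the longest cycle, $L^{(2)}$ of the second longest, etc.). Then, in the sense of convergence of finite-dimensional distributions under the measures $\mathbb P_N$, $$\frac{1}{N\tilde\nu}\big(L^{(1)},L^{(2)},\dots\big)\longrightarrow \mathrm{PD}(\theta^* )\quad\text{as }N\to\infty,$$ where $\mathrm{PD}(\theta^* )$ is the Poisson–Dirichlet distribution with parameter $\theta^*$.
   Context: Model: for $N\in\mathbb N$, $S_N$ is the symmetric group on $\{1,\dots,N\}$; for $\sigma\in S_N$, $C_j(\sigma)$ is the number of cycles of length $j$. Given nonnegative sequences $(\theta_j)_{j\ge1},(\kappa_j)_{j\ge1}$, $\mathbb P_N(\sigma)=\frac{1}{N!H_N}\prod_{j=1}^N(\theta_j+N\kappa_j)^{C_j}$, $H_N=\frac1{N!}\sum_{\sigma\in S_N}\prod_{j=1}^N(\theta_j+N\kappa_j)^{C_j}$. $g_\theta(z)=\sum_{j\ge1}\theta_jz^j/j$, $g_\kappa(z)=\sum_{j\ge1}\kappa_jz^j/j$; $g^{\{n\}}(z):=z^ng^{(n)}(z)$; $R$ is the radius of convergence of $g_\kappa$ and $g_\kappa^{\{n\}}(R)=\lim_{r\uparrow R}g_\kappa^{\{n\}}(r)\in[0,\infty]$. Standing assumption: $(\kappa_j)$ is non-arithmetic (no integer $j_0>1$ such that $\kappa_j\ne0$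 implies $j_0\mid j$) and $\kappa_j>0$ for some $j\ge2$. $\Delta_0=\{z:|z|<R|1+\eta e^{i\varphi}|,\ z\neq R,\ |\arg(z-R)|>\varphi\}$ for some $\eta>0$, $\varphi\in(0,\pi/2)$. Principal branches are used for logs and powers. Hypothesis (P): $g_\theta,g_\kappa$ both have radius of convergence $R>0$ and are holomorphic in some $\Delta_0$; $g_\kappa^{\{1\}}(R)<1$; as $z\to R$, $z\in\Delta_0$, $g_\theta(z)=-\theta^*\log(1-z/R)+O((1-z/R)^\delta)$ and $g_\kappa(z)=g_\kappa(R)-g_\kappa^{\{1\}}(R)(1-z/R)+O((1-z/R)^{1+\delta})$ with $\theta^*>0$, $\delta>0$; there is a non-integer $s>1$ with $g_\kappa^{\{n\}}(R)<\infty$ for integers $n<s$ and $g_\kappa^{\{n\}}(R)=\infty$ for $n>s$, and there exist $a_s>0$ and $\delta_n>0$ such that, as $z\to R$, $z\in\Delta_0$: $g_\kappa^{\{n\}}(z)=g_\kappa^{\{n\}}(R)\{1+O((1-z/R)^{\delta_n})\}$ for $n<s$; $g_\kappa^{\{n\}}(z)=\frac{\Gamma(n-s)a_s}{\Gamma(-s)}(1-z/R)^{s-n}\{1+O((1-z/R)^{\delta_n})\}$ for $n>s$; and $g_\theta^{\{n\}}(z)=\frac{\theta^*(n-1)!}{(1-z/R)^n}\{1+O((1-z/R)^{\delta_n})\}$ for all $n\in\mathbb N$. Poisson–Dirichlet distribution $\mathrm{PD}(\theta)$, $\theta>0$: if $(B'_n)$ are i.i.d. Beta$(1,\theta)$ and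 $Y_1=B'_1$, $Y_n=B'_n\prod_{j=1}^{n-1}(1-B'_j)$ ($n\ge2$), then $\mathrm{PD}(\theta)$ is the law of the decreasing rearrangement $Y^{(1)}\ge Y^{(2)}\ge\cdots$ of $(Y_n)$. *)

theory Defs
  imports "HOL-Probability.Probability" "HOL-Combinatorics.Orbits" "HOL-Library.Landau_Symbols"
    "HOL-Library.Multiset"
begin

definition cycles_of :: "nat \<Rightarrow> (nat \<Rightarrow> nat) \<Rightarrow> nat set set" where
  "cycles_of N \<sigma> = (\<lambda>x. orbit \<sigma> x) ` {1..N}"

definition cycle_count :: "nat \<Rightarrow> (nat \<Rightarrow> nat) \<Rightarrow> nat \<Rightarrow> nat" where
  "cycle_count N \<sigma> j = card {c \<in> cycles_of N \<sigma>. card c = j}"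

definition ens_weight :: "(nat \<Rightarrow> real) \<Rightarrow> (nat \<Rightarrow> real) \<Rightarrow> nat \<Rightarrow> (nat \<Rightarrow> nat) \<Rightarrow> real" where
  "ens_weight \<theta> \<kappa> N \<sigma> = (\<Prod>j\<in>{1..N}. (\<theta> j + real N * \<kappa> j) ^ cycle_count N \<sigma> j)"

definition ens_prob :: "(nat \<Rightarrow> real) \<Rightarrow> (nat \<Rightarrow> real) \<Rightarrow> nat \<Rightarrow> (nat \<Rightarrow> nat) \<Rightarrow> real" where
  "ens_prob \<theta> \<kappa> N \<sigma> =
     ens_weight \<theta> \<kappa> N \<sigma> / (\<Sum>\<tau>\<in>{\<tau>. \<tau> permutes {1..N}}. ens_weight \<theta> \<kappa> N \<tau>)"

definition ord_cycle_lengths :: "nat \<Rightarrow> (nat \<Rightarrow> nat) \<Rightarrow> nat \<Rightarrow> nat" where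
  "ord_cycle_lengths N \<sigma> i =
     (let xs = rev (sorted_list_of_multiset (image_mset card (mset_set (cycles_of N \<sigma>))))
      in if i < length xs then xs ! i else 0)"

text \<open>Decreasing rearrangement (0-indexed) of a nonnegative sequence tending to 0:
  the i-th largest value, counted with multiplicity.\<close>
definition dec_rearr :: "(nat \<Rightarrow> real) \<Rightarrow> nat \<Rightarrow> real" where
  "dec_rearr Y i = Inf {t. 0 \<le> t \<and> finite {n. t < Y n} \<and> card {n. t < Y n} \<le> i}"

definition stick :: "(nat \<Rightarrow> real) \<Rightarrow> nat \<Rightarrow> real" where
  "stick B n = B n * (\<Prod>j<n. 1 - B j)"

definition beta1 :: "real \<Rightarrow> real measure" where
  "beta1 \<theta> = density lborel (\<lambda>x. ennreal (indicator {0<..<1} x * \<theta> * (1 - x) powr (\<theta> - 1)))"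

definition PD :: "real \<Rightarrow> (nat \<Rightarrow> real) measure" where
  "PD \<theta> = distr (Pi\<^sub>M UNIV (\<lambda>_. beta1 \<theta>)) (Pi\<^sub>M UNIV (\<lambda>_. borel)) (\<lambda>B. dec_rearr (stick B))"

definition fdd_trunc :: "nat \<Rightarrow> (nat \<Rightarrow> real) \<Rightarrow> nat \<Rightarrow> real" where
  "fdd_trunc k y = (\<lambda>i. if i < k then y i else 0)"

definition gcoeff :: "(nat \<Rightarrow> real) \<Rightarrow> nat \<Rightarrow> complex" where
  "gcoeff a n = (if n = 0 then 0 else complex_of_real (a n / real n))"

definition gser :: "(nat \<Rightarrow> real) \<Rightarrow> complex \<Rightarrow> complex" where
  "gser a z = (\<Sum>n. gcoeff a n * z ^ n)"

definition gbr :: "nat \<Rightarrow> (complex \<Rightarrow> complex) \<Rightarrow> complex \<Rightarrow> complex" where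
  "gbr n G z = z ^ n * (deriv ^^ n) G z"

definition Delta0 :: "real \<Rightarrow> real \<Rightarrow> real \<Rightarrow> complex set" where
  "Delta0 R \<eta> \<phi> = {z. cmod z < R * cmod (1 + complex_of_real \<eta> * exp (\<i> * complex_of_real \<phi>))
                      \<and> z \<noteq> complex_of_real R \<and> \<bar>Arg (z - complex_of_real R)\<bar> > \<phi>}"

definition at_Delta0 :: "real \<Rightarrow> real \<Rightarrow> real \<Rightarrow> complex filter" where
  "at_Delta0 R \<eta> \<phi> = at (complex_of_real R) within Delta0 R \<eta> \<phi>"

end

theory Submission
  imports Defs "HOL-Complex_Analysis.Complex_Analysis" "HOL-Real_Asymp.Real_Asymp"
begin

text \<open>
  Give each cycle of length \<open>j\<close> one of two colours, with weights \<open>\<theta>\<^sub>j\<close> and \<open>N \<kappa>\<^sub>j\<close>, all multiplied by \<open>R\<^sup>j\<close>.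
  Singularity analysis gives \<open>\<theta>\<^sub>j R\<^sup>j = \<theta>\<^sup>* + O(j powr (- \<epsilon>))\<close> and \<open>\<kappa>\<^sub>j R\<^sup>j = O(j powr (- s))\<close>.
  The total length \<open>K\<close> of the \<open>\<kappa>\<close>-cycles has generating function \<open>exp (N (g\<^sub>\<kappa> (R z) - g\<^sub>\<kappa> R))\<close>, so without the
  conditioning it satisfies a law of large numbers \<open>K / N \<rightarrow> 1 - \<nu>\<close> with \<open>\<nu> > 0\<close>; the local bound
  \<open>P (K = k) = O(1 / N)\<close> above the mean shows that conditioning on total length \<open>N\<close> preserves this, and all
  \<open>\<kappa>\<close>-cycles are of length \<open>o(N)\<close>. Hence the long cycles are those of a random permutation of about \<open>N \<nu>\<close> points with
  weights \<open>\<theta>\<^sub>j\<close>. Listing its cycles in size-biased order and exposing the first one leaves a permutation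
  of the same kind on the remaining points, which is the stick-breaking recursion of the limit; on Lipschitz functions this
  recursion contracts by the factor \<open>\<theta>\<^sup>* / (\<theta>\<^sup>* + 1)\<close>. Ordering by size is Lipschitz.
\<close>

text \<open>The weights change with N, so there is no single generating function whose coefficients
  are the normalising constants. Splitting off the \<kappa>-cycles puts the dependence on N into a
  probability law, while the \<theta>-part is one fixed sequence of order n^(\<theta>* - 1). Complex
  analysis serves only to bound coefficients, from inside the disc of convergence; everything else
  is driven by the real recursion \<open>cyc_total_rec\<close>. Two features of (P) shape the
  estimates. For s < 2 the variance of K is infinite, which leaves only first moments. For \<theta>*
  < 1 the factor (N - K)^(\<theta>* - 1) brought in by the conditioning blows up as K approaches N,
  so a law of large numbers alone cannot control it; the local bound limits the mass that K puts
  there. On the combinatorial side one stick-breaking step changes the test function and the number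
  of points together, hence errors are measured uniformly over all Lipschitz functions, in
  proportion to their constants.\<close>

section \<open>Sums over size-biased cycle lengths\<close>

text \<open>The sum of \<open>F xs\<close>, weighted by the product of all \<open>w x\<close> and divided by \<open>n!\<close>, over the permutations of \<open>n\<close> points,
  where \<open>xs\<close> lists the cycle lengths in size-biased order: the cycle of the first point, then the cycle of the first
  point outside it, and so on. The recursion chooses the length of the first cycle.\<close>
fun cyc_sum :: "(nat \<Rightarrow> real) \<Rightarrow> nat \<Rightarrow> (nat list \<Rightarrow> real) \<Rightarrow> real" where
  "cyc_sum w 0 F = F []"
| "cyc_sum w (Suc n) F =
     (\<Sum>j\<in>{1..Suc n}. w j * cyc_sum w (Suc n - j) (\<lambda>xs. F (j # xs))) / real (Suc n)"

text \<open>Without the denominator the recursion also covers n = 0, where both sides vanish; later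
  proofs use it in this form.\<close>

lemma cyc_sum_rec:
  "real n * cyc_sum w n F = (\<Sum>j\<in>{1..n}. w j * cyc_sum w (n - j) (\<lambda>xs. F (j # xs)))"
  by (cases n) (simp_all add: field_simps)

text \<open>\<open>F\<close> is only ever evaluated at lists of positive parts with sum n, so
  agreement there suffices. Positivity is what later makes a list with sum 0 empty.\<close>

lemma cyc_sum_cong:
  assumes "\<And>xs. sum_list xs = n \<Longrightarrow> (\<forall>x\<in>set xs. 0 < x) \<Longrightarrow> F xs = G xs" and "\<And>j. j \<in> {1..n} \<Longrightarrow> w j = w' j"
  shows "cyc_sum w n F = cyc_sum w' n G"
  using assms
proof (induction n arbitrary: F G rule: less_induct)
  case (less n)
  show ?case
  proof (cases n)
    case 0 then show ?thesis using less.prems(1)[of "[]"] by simp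
  next
    case (Suc m)
    have "cyc_sum w (n - j) (\<lambda>xs. F (j # xs)) = cyc_sum w' (n - j) (\<lambda>xs. G (j # xs))"
      if "j \<in> {1..n}" for j
      using that by (intro less.IH less.prems) auto
    then show ?thesis using less.prems(2) Suc by (auto intro!: sum.cong)
  qed
qed

lemma cyc_sum_add: "cyc_sum w n (\<lambda>xs. F xs + G xs) = cyc_sum w n F + cyc_sum w n G"
proof (induction n arbitrary: F G rule: less_induct)
  case (less n)
  show ?case
  proof (cases n)
    case (Suc m)
    then show ?thesis
      using less by (simp add: sum.distrib add_divide_distrib distrib_left del: sum.cl_ivl_Suc)
  qed simp
qed

lemma cyc_sum_cmult: "cyc_sum w n (\<lambda>xs. c * F xs) = c * cyc_sum w n F"
proof (induction n arbitrary: F rule: less_induct)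
  case (less n)
  show ?case
  proof (cases n)
    case (Suc m)
    have "w j * cyc_sum w (Suc m - j) (\<lambda>xs. c * F (j # xs)) = c * (w j * cyc_sum w (Suc m - j) (\<lambda>xs. F (j # xs)))"
      if "j \<in> {1..Suc m}" for j
      using that less[of "Suc m - j" "\<lambda>xs. F (j # xs)"] Suc by simp
    then have "(\<Sum>j\<in>{1..Suc m}. w j * cyc_sum w (Suc m - j) (\<lambda>xs. c * F (j # xs))) =
        c * (\<Sum>j\<in>{1..Suc m}. w j * cyc_sum w (Suc m - j) (\<lambda>xs. F (j # xs)))"
      unfolding sum_distrib_left by (intro sum.cong) auto
    then show ?thesis
      using Suc by (simp del: sum.cl_ivl_Suc)
  qed simp
qed

lemma cyc_sum_diff: "cyc_sum w n (\<lambda>xs. F xs - G xs) = cyc_sum w n F - cyc_sum w n G"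
  using cyc_sum_add[of w n F "\<lambda>xs. (-1) * G xs"] cyc_sum_cmult[of w n "-1" G] by simp

lemma cyc_sum_sum: "finite A \<Longrightarrow> cyc_sum w n (\<lambda>xs. \<Sum>a\<in>A. F a xs) = (\<Sum>a\<in>A. cyc_sum w n (F a))"
proof (induction A rule: finite_induct)
  case empty
  show ?case using cyc_sum_cmult[of w n 0 "\<lambda>_. 0"] by simp
qed (simp add: cyc_sum_add)

text \<open>The second weight function dominates the absolute values of the first, which admits
  signed weights such as \<theta>_j R^j - \<theta>*.\<close>

lemma cyc_sum_abs_le:
  assumes "\<And>xs. sum_list xs = n \<Longrightarrow> (\<forall>x\<in>set xs. 0 < x) \<Longrightarrow> \<bar>F xs\<bar> \<le> G xs" and "\<And>j. j \<in> {1..n} \<Longrightarrow> \<bar>w j\<bar> \<le> w' j"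
  shows "\<bar>cyc_sum w n F\<bar> \<le> cyc_sum w' n G"
  using assms
proof (induction n arbitrary: F G rule: less_induct)
  case (less n)
  show ?case
  proof (cases n)
    case 0 then show ?thesis using less.prems(1)[of "[]"] by simp
  next
    case (Suc m)
    have *: "\<bar>cyc_sum w (n - j) (\<lambda>xs. F (j # xs))\<bar> \<le> cyc_sum w' (n - j) (\<lambda>xs. G (j # xs))"
      if "j \<in> {1..n}" for j
      using that by (intro less.IH less.prems) auto
    have "\<bar>\<Sum>j\<in>{1..n}. w j * cyc_sum w (n - j) (\<lambda>xs. F (j # xs))\<bar>
       \<le> (\<Sum>j\<in>{1..n}. w' j * cyc_sum w' (n - j) (\<lambda>xs. G (j # xs)))"
      by (rule order_trans[OF sum_abs])
         (auto simp: abs_mult intro!: sum_mono mult_mono less.prems(2) * order_trans[OF abs_ge_zero less.prems(2)])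
    then show ?thesis using Suc by (simp add: divide_right_mono del: sum.cl_ivl_Suc)
  qed
qed

lemma cyc_sum_mono:
  assumes "\<And>xs. sum_list xs = n \<Longrightarrow> (\<forall>x\<in>set xs. 0 < x) \<Longrightarrow> F xs \<le> G xs" and "\<And>j. j \<in> {1..n} \<Longrightarrow> 0 \<le> w j"
  shows "cyc_sum w n F \<le> cyc_sum w n G"
proof -
  have "0 \<le> cyc_sum w n (\<lambda>xs. G xs - F xs)"
    using assms by (intro order_trans[OF abs_ge_zero cyc_sum_abs_le[where F = "\<lambda>xs. G xs - F xs" and w = w]]) auto
  then show ?thesis by (simp add: cyc_sum_diff)
qed

text \<open>All lists have sum n, so the powers r^j collect to r^n. In a normalised average this
  factor cancels, which moves the radius of convergence to 1.\<close>

lemma cyc_sum_scale: "cyc_sum (\<lambda>j. w j * r ^ j) n F = r ^ n * cyc_sum w n F"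
proof (induction n arbitrary: F rule: less_induct)
  case (less n)
  show ?case
  proof (cases n)
    case (Suc m)
    have "w j * r ^ j * cyc_sum (\<lambda>j. w j * r ^ j) (Suc m - j) (\<lambda>xs. F (j # xs)) =
          r ^ Suc m * (w j * cyc_sum w (Suc m - j) (\<lambda>xs. F (j # xs)))"
      if "j \<in> {1..Suc m}" for j
    proof -
      have "r ^ j * r ^ (Suc m - j) = r ^ Suc m" using that by (simp flip: power_add)
      moreover have "cyc_sum (\<lambda>j. w j * r ^ j) (Suc m - j) (\<lambda>xs. F (j # xs)) =
          r ^ (Suc m - j) * cyc_sum w (Suc m - j) (\<lambda>xs. F (j # xs))"
        using that Suc by (intro less) auto
      ultimately show ?thesis by (simp only: mult.assoc[symmetric]) (simp only: mult_ac)
    qed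
    then have "(\<Sum>j\<in>{1..Suc m}. w j * r ^ j * cyc_sum (\<lambda>j. w j * r ^ j) (Suc m - j) (\<lambda>xs. F (j # xs)))
      = r ^ Suc m * (\<Sum>j\<in>{1..Suc m}. w j * cyc_sum w (Suc m - j) (\<lambda>xs. F (j # xs)))"
      unfolding sum_distrib_left by (intro sum.cong) auto
    then show ?thesis
      using Suc by (simp del: sum.cl_ivl_Suc)
  qed simp
qed

lemma cyc_sum_absorb: "cyc_sum w n F = cyc_sum (\<lambda>_. 1) n (\<lambda>xs. prod_list (map w xs) * F xs)"
proof (induction n arbitrary: F rule: less_induct)
  case (less n)
  show ?case
  proof (cases n)
    case (Suc m)
    have "w j * cyc_sum w (Suc m - j) (\<lambda>xs. F (j # xs)) =
          cyc_sum (\<lambda>_. 1) (Suc m - j) (\<lambda>xs. prod_list (map w (j # xs)) * F (j # xs))"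
      if "j \<in> {1..Suc m}" for j
      using that less[of "Suc m - j" "\<lambda>xs. F (j # xs)"] Suc
      by (simp add: mult.assoc flip: cyc_sum_cmult)
    then show ?thesis
      using Suc by (simp del: sum.cl_ivl_Suc)
  qed simp
qed

text \<open>Both sides run over the triples (j, a, b) with j \<ge> 1 and j + a + b = n.\<close>

lemma sum_triangle_reindex:
  fixes T :: "nat \<Rightarrow> nat \<Rightarrow> nat \<Rightarrow> real"
  shows "(\<Sum>k\<le>n. \<Sum>j\<in>{1..k}. T j (k - j) (n - k)) = (\<Sum>j\<in>{1..n}. \<Sum>k\<le>n - j. T j k (n - j - k))"
proof -
  have "(\<Sum>k\<le>n. \<Sum>j\<in>{1..k}. T j (k - j) (n - k)) =
        (\<Sum>(k,j)\<in>(SIGMA k:{..n}. {1..k}). T j (k - j) (n - k))"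
    by (rule sum.Sigma) auto
  also have "\<dots> = (\<Sum>(j,k)\<in>(SIGMA j:{1..n}. {..n - j}). T j k (n - j - k))"
    by (rule sum.reindex_bij_witness[where i = "\<lambda>(j,k). (k + j, j)" and j = "\<lambda>(k,j). (j, k - j)"]) auto
  also have "\<dots> = (\<Sum>j\<in>{1..n}. \<Sum>k\<le>n - j. T j k (n - j - k))"
    by (rule sum.Sigma[symmetric]) auto
  finally show ?thesis .
qed

text \<open>Colouring each cycle by one of the two summands of its weight.\<close>
lemma cyc_sum_plus:
  "cyc_sum (\<lambda>j. u j + v j) n (\<lambda>xs. \<Psi> (mset xs)) =
   (\<Sum>k\<le>n. cyc_sum u k (\<lambda>xs. cyc_sum v (n - k) (\<lambda>ys. \<Psi> (mset xs + mset ys))))"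
proof (induction n arbitrary: \<Psi> rule: less_induct)
  case (less n)
  show ?case
  proof (cases "n = 0")
    case True then show ?thesis by simp
  next
    case False
    let ?T = "\<lambda>k. cyc_sum u k (\<lambda>xs. cyc_sum v (n - k) (\<lambda>ys. \<Psi> (mset xs + mset ys)))"
    let ?S = "\<lambda>j k. cyc_sum u k (\<lambda>xs. cyc_sum v (n - j - k) (\<lambda>ys. \<Psi> (add_mset j (mset xs + mset ys))))"
    \<comment> \<open>The factor n is split as k + (n - k). The part k exposes the first cycle of
      the first list, the part n - k that of the second; both leave the same sums \<open>?S\<close>
      on n - j points, with weights \<open>u j\<close> and \<open>v j\<close> that add up.\<close>
    have 1: "(\<Sum>k\<le>n. real k * ?T k) = (\<Sum>j\<in>{1..n}. u j * (\<Sum>k\<le>n - j. ?S j k))"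
    proof -
      have "(\<Sum>k\<le>n. real k * ?T k) = (\<Sum>k\<le>n. \<Sum>j\<in>{1..k}. u j * cyc_sum u (k - j) (\<lambda>xs. cyc_sum v (n - k) (\<lambda>ys. \<Psi> (add_mset j (mset xs + mset ys)))))"
        by (simp add: cyc_sum_rec)
      also have "\<dots> = (\<Sum>j\<in>{1..n}. \<Sum>k\<le>n - j. u j * ?S j k)"
        by (rule sum_triangle_reindex[where T = "\<lambda>j k l. u j * cyc_sum u k (\<lambda>xs. cyc_sum v l (\<lambda>ys. \<Psi> (add_mset j (mset xs + mset ys))))"])
      finally show ?thesis by (simp add: sum_distrib_left)
    qed
    have 2: "(\<Sum>k\<le>n. real (n - k) * ?T k) = (\<Sum>j\<in>{1..n}. v j * (\<Sum>k\<le>n - j. ?S j k))"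
    proof -
      let ?U = "\<lambda>k l j. cyc_sum u k (\<lambda>xs. v j * cyc_sum v l (\<lambda>ys. \<Psi> (add_mset j (mset xs + mset ys))))"
      have *: "real (n - k) * ?T k = (\<Sum>j\<in>{1..n-k}. ?U k (n - k - j) j)" for k
      proof -
        have "real (n - k) * ?T k = cyc_sum u k (\<lambda>xs. real (n - k) * cyc_sum v (n - k) (\<lambda>ys. \<Psi> (mset xs + mset ys)))"
          by (simp add: cyc_sum_cmult)
        also have "\<dots> = cyc_sum u k (\<lambda>xs. \<Sum>j\<in>{1..n-k}. v j * cyc_sum v (n - k - j) (\<lambda>ys. \<Psi> (add_mset j (mset xs + mset ys))))"
          by (simp add: cyc_sum_rec)
        finally show ?thesis by (simp add: cyc_sum_sum)
      qed
      have "(\<Sum>k\<le>n. real (n - k) * ?T k) = (\<Sum>k\<le>n. \<Sum>j\<in>{1..n-k}. ?U k (n - k - j) j)"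
        by (simp only: *)
      also have "\<dots> = (\<Sum>k\<le>n. \<Sum>j\<in>{1..k}. ?U (n - k) (k - j) j)"
        by (rule sum.reindex_bij_witness[of _ "\<lambda>k. n - k" "\<lambda>k. n - k"]) auto
      also have "\<dots> = (\<Sum>j\<in>{1..n}. \<Sum>k\<le>n - j. ?U (n - j - k) k j)"
        by (rule sum_triangle_reindex[where T = "\<lambda>j k l. ?U l k j"])
      also have "\<dots> = (\<Sum>j\<in>{1..n}. \<Sum>k\<le>n - j. ?U k (n - j - k) j)"
      proof (rule sum.cong[OF refl])
        fix j
        show "(\<Sum>k\<le>n - j. ?U (n - j - k) k j) = (\<Sum>k\<le>n - j. ?U k (n - j - k) j)"
          by (rule sum.reindex_bij_witness[of _ "\<lambda>k. n - j - k" "\<lambda>k. n - j - k"])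
            (auto simp del: diff_diff_left)
      qed
      finally show ?thesis by (simp add: cyc_sum_cmult sum_distrib_left)
    qed
    have "real n * (\<Sum>k\<le>n. ?T k) = (\<Sum>k\<le>n. real k * ?T k) + (\<Sum>k\<le>n. real (n - k) * ?T k)"
      by (simp add: sum_distrib_left sum.distrib[symmetric] of_nat_diff algebra_simps)
    also have "\<dots> = (\<Sum>j\<in>{1..n}. (u j + v j) * (\<Sum>k\<le>n - j. ?S j k))"
      unfolding 1 2 by (simp add: sum.distrib distrib_right)
    also have "\<dots> = (\<Sum>j\<in>{1..n}. (u j + v j) * cyc_sum (\<lambda>j. u j + v j) (n - j) (\<lambda>xs. \<Psi> (add_mset j (mset xs))))"
    proof (intro sum.cong refl arg_cong2[where f = "(*)"])
      fix j assume "j \<in> {1..n}"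
      then show "(\<Sum>k\<le>n - j. ?S j k) = cyc_sum (\<lambda>j. u j + v j) (n - j) (\<lambda>xs. \<Psi> (add_mset j (mset xs)))"
        using less[of "n - j" "\<lambda>X. \<Psi> (add_mset j X)"] by simp
    qed
    also have "\<dots> = real n * cyc_sum (\<lambda>j. u j + v j) n (\<lambda>xs. \<Psi> (mset xs))"
      by (simp add: cyc_sum_rec)
    finally show ?thesis using False by simp
  qed
qed

abbreviation cyc_total :: "(nat \<Rightarrow> real) \<Rightarrow> nat \<Rightarrow> real" where
  "cyc_total w n \<equiv> cyc_sum w n (\<lambda>_. 1)"

lemma cyc_sum_const: "cyc_sum w n (\<lambda>_. c) = c * cyc_total w n"
  using cyc_sum_cmult[of w n c "\<lambda>_. 1"] by simp

lemma cyc_total_rec: "real n * cyc_total w n = (\<Sum>j\<in>{1..n}. w j * cyc_total w (n - j))"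
  by (rule cyc_sum_rec)

lemma cyc_total_nonneg: "(\<And>j. j \<in> {1..n} \<Longrightarrow> 0 \<le> w j) \<Longrightarrow> 0 \<le> cyc_total w n"
  using cyc_sum_mono[of n "\<lambda>_. 0" "\<lambda>_. 1" w] by (simp add: cyc_sum_const[of _ _ 0])

lemma cyc_total_plus:
  "cyc_total (\<lambda>j. u j + v j) n = (\<Sum>k\<le>n. cyc_total u k * cyc_total v (n - k))"
  using cyc_sum_plus[of u v n "\<lambda>_. 1"] by (simp add: cyc_sum_const[of _ _ "cyc_total _ _"] mult.commute)

text \<open>A cycle of length j enters with weight w_j / j and its removal leaves n - j points, so
  additive statistics have an explicit mean. In the induction the exposed cycle accounts for j and
  the remaining ones for n - j of the factor n.\<close>

lemma cyc_sum_sum_list: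
  "cyc_sum w n (\<lambda>xs. sum_list (map f xs)) = (\<Sum>j\<in>{1..n}. f j * w j / real j * cyc_total w (n - j))"
proof (induction n rule: less_induct)
  case (less n)
  show ?case
  proof (cases "n = 0")
    case False
    let ?a = "cyc_total w"
    have "real n * cyc_sum w n (\<lambda>xs. sum_list (map f xs)) =
      (\<Sum>j\<in>{1..n}. w j * f j * ?a (n - j)) + (\<Sum>j\<in>{1..n}. w j * (\<Sum>i\<in>{1..n-j}. f i * w i / real i * ?a (n - j - i)))"
      unfolding cyc_sum_rec sum.distrib[symmetric]
    proof (intro sum.cong refl)
      fix j assume "j \<in> {1..n}"
      then show "w j * cyc_sum w (n - j) (\<lambda>xs. sum_list (map f (j # xs))) =
         w j * f j * ?a (n - j) + w j * (\<Sum>i\<in>{1..n-j}. f i * w i / real i * ?a (n - j - i))"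
        using less[of "n - j"] by (simp add: cyc_sum_add cyc_sum_const[of _ _ "f j"] algebra_simps)
    qed
    also have "(\<Sum>j\<in>{1..n}. w j * (\<Sum>i\<in>{1..n-j}. f i * w i / real i * ?a (n - j - i)))
       = (\<Sum>i\<in>{1..n}. \<Sum>j\<in>{1..n-i}. f i * w i / real i * (w j * ?a (n - i - j)))"
    proof -
      have "(\<Sum>j\<in>{1..n}. w j * (\<Sum>i\<in>{1..n-j}. f i * w i / real i * ?a (n - j - i)))
        = (\<Sum>j\<in>{1..n}. \<Sum>i\<in>{i\<in>{1..n}. i + j \<le> n}. f i * w i / real i * (w j * ?a (n - i - j)))"
        unfolding sum_distrib_left by (intro sum.cong refl) (auto simp: mult_ac add.commute)
      also have "\<dots> = (\<Sum>i\<in>{1..n}. \<Sum>j\<in>{j\<in>{1..n}. i + j \<le> n}. f i * w i / real i * (w j * ?a (n - i - j)))"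
        by (rule sum.swap_restrict) auto
      also have "\<dots> = (\<Sum>i\<in>{1..n}. \<Sum>j\<in>{1..n-i}. f i * w i / real i * (w j * ?a (n - i - j)))"
        by (intro sum.cong) auto
      finally show ?thesis .
    qed
    also have "\<dots> = (\<Sum>i\<in>{1..n}. f i * w i / real i * (real (n - i) * ?a (n - i)))"
      by (rule sum.cong[OF refl]) (simp only: cyc_total_rec, simp only: sum_distrib_left)
    also have "(\<Sum>j\<in>{1..n}. w j * f j * ?a (n - j)) + \<dots> = real n * (\<Sum>j\<in>{1..n}. f j * w j / real j * ?a (n - j))"
      unfolding sum_distrib_left sum.distrib[symmetric]
    proof (rule sum.cong[OF refl])
      fix j assume j: "j \<in> {1..n}"
      then have "f j * w j / real j * (real (n - j) * ?a (n - j)) = real n * (f j * w j / real j * ?a (n - j)) - f j * w j * ?a (n - j)"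
        by (simp add: of_nat_diff divide_simps) (simp add: algebra_simps)
      then show "w j * f j * ?a (n - j) + f j * w j / real j * (real (n - j) * ?a (n - j)) = real n * (f j * w j / real j * ?a (n - j))"
        by simp
    qed
    finally show ?thesis using False by simp
  qed simp
qed

declare cyc_sum.simps(2) [simp del]

section \<open>Cycle types of permutations\<close>

text \<open>Stated for arbitrary sets because the counting identity below is proved by inserting
  points one at a time.\<close>

definition cyc_type :: "'a set \<Rightarrow> ('a \<Rightarrow> 'a) \<Rightarrow> nat multiset" where
  "cyc_type A \<sigma> = image_mset card (mset_set (orbit \<sigma> ` A))"

text \<open>Summing over all ways to insert a new point into a permutation of cycle type \<open>X\<close>:
  as a fixed point, or behind some point of an existing cycle.\<close>
definition insert_point :: "(nat multiset \<Rightarrow> real) \<Rightarrow> nat multiset \<Rightarrow> real" where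
  "insert_point \<Psi> X = \<Psi> (add_mset 1 X) + (\<Sum>x\<in>#X. real x * \<Psi> (add_mset (Suc x) (X - {#x#})))"

lemma insert_point_add_mset:
  "insert_point \<Psi> (add_mset j X) =
   insert_point (\<lambda>X. \<Psi> (add_mset j X)) X + real j * \<Psi> (add_mset (Suc j) X)"
proof -
  have "(\<Sum>x\<in>#X. real x * \<Psi> (add_mset (Suc x) (add_mset j X - {#x#})))
      = (\<Sum>x\<in>#X. real x * \<Psi> (add_mset j (add_mset (Suc x) (X - {#x#}))))"
    by (intro arg_cong[where f = sum_mset] image_mset_cong)
       (simp add: add_mset_commute diff_union_single_conv)
  then show ?thesis
    by (simp add: insert_point_def add_mset_commute algebra_simps)
qed

text \<open>Reconciles two recursions: exposing the cycle of a point, as in \<open>cyc_sum\<close>,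
  and adding a further point, as for permutations. When the exposed cycle has length j, the new
  point lies outside it, with factor n + 1 - j, or has enlarged it from length j - 1, with factor j
  - 1; these add up to n for every j.\<close>

lemma cyc_sum_insert_point:
  "real (Suc n) * cyc_sum (\<lambda>_. 1) (Suc n) (\<lambda>xs. \<Psi> (mset xs)) =
   cyc_sum (\<lambda>_. 1) n (\<lambda>xs. insert_point \<Psi> (mset xs))"
proof (induction n arbitrary: \<Psi> rule: less_induct)
  case (less n)
  let ?A = "\<lambda>n \<Psi>. cyc_sum (\<lambda>_. 1) n (\<lambda>xs. \<Psi> (mset xs) :: real)"
  let ?B = "\<lambda>j. ?A (Suc n - j) (\<lambda>X. \<Psi> (add_mset j X))"
  show ?case
  proof (cases n)
    case 0
    then show ?thesis by (simp add: insert_point_def cyc_sum.simps(2))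
  next
    case (Suc m)
    have "real n * ?A n (insert_point \<Psi>) = (\<Sum>j\<in>{1..n}. ?A (n - j) (\<lambda>X. insert_point \<Psi> (add_mset j X)))"
      by (simp add: cyc_sum_rec)
    also have "\<dots> = (\<Sum>j\<in>{1..n}. real (Suc n - j) * ?B j + real j * ?B (Suc j))"
    proof (intro sum.cong refl)
      fix j assume j: "j \<in> {1..n}"
      then have "Suc (n - j) = Suc n - j" "n - j < n" by auto
      then show "?A (n - j) (\<lambda>X. insert_point \<Psi> (add_mset j X)) = real (Suc n - j) * ?B j + real j * ?B (Suc j)"
        using less[of "n - j" "\<lambda>X. \<Psi> (add_mset j X)"]
        by (simp add: insert_point_add_mset cyc_sum_add cyc_sum_cmult)
    qed
    also have "\<dots> = (\<Sum>j\<in>{1..n}. real (Suc n - j) * ?B j) + (\<Sum>j\<in>{1..n}. real j * ?B (Suc j))"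
      by (rule sum.distrib)
    also have "(\<Sum>j\<in>{1..n}. real (Suc n - j) * ?B j) = (\<Sum>j\<in>{1..Suc n}. real (Suc n - j) * ?B j)"
      by (rule sum.mono_neutral_left) (auto simp: le_Suc_eq)
    also have "(\<Sum>j\<in>{1..n}. real j * ?B (Suc j)) = (\<Sum>j\<in>{1..Suc n}. real (j - 1) * ?B j)"
    proof -
      have "(\<Sum>j\<in>{1..n}. real j * ?B (Suc j)) = (\<Sum>j\<in>{2..Suc n}. real (j - 1) * ?B j)"
        by (rule sum.reindex_bij_witness[of _ "\<lambda>j. j - 1" Suc]) auto
      also have "\<dots> = (\<Sum>j\<in>{1..Suc n}. real (j - 1) * ?B j)"
        by (rule sum.mono_neutral_left) (auto simp: Suc_le_eq not_less)
      finally show ?thesis .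
    qed
    also have "(\<Sum>j\<in>{1..Suc n}. real (Suc n - j) * ?B j) + \<dots> = (\<Sum>j\<in>{1..Suc n}. real n * ?B j)"
      unfolding sum.distrib[symmetric]
    proof (intro sum.cong refl)
      fix j assume "j \<in> {1..Suc n}"
      then have "real (Suc n - j) + real (j - 1) = real n" by (simp add: of_nat_diff)
      then show "real (Suc n - j) * ?B j + real (j - 1) * ?B j = real n * ?B j"
        by (metis distrib_right)
    qed
    also have "\<dots> = real n * (real (Suc n) * ?A (Suc n) \<Psi>)"
      by (simp only: cyc_sum_rec sum_distrib_left[symmetric]) simp
    finally show ?thesis using Suc by simp
  qed
qed

lemma orbit_permutes_eq:
  assumes "finite A" "\<sigma> permutes A" "y \<in> orbit \<sigma> x"
  shows "orbit \<sigma> y = orbit \<sigma> x"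
proof -
  have "permutation \<sigma>" using assms permutation_permutes by blast
  then have "x \<in> orbit \<sigma> x" by (rule permutation_self_in_orbit)
  then show ?thesis
    using assms(3) orbit_swap orbit_trans by (metis subsetI subset_antisym)
qed

lemma orbit_permutes_subset:
  assumes "\<sigma> permutes A" "x \<in> A"
  shows "orbit \<sigma> x \<subseteq> A"
proof
  fix y assume "y \<in> orbit \<sigma> x"
  then show "y \<in> A" using assms by induction (auto simp: permutes_in_image)
qed

text \<open>The transposition inserts \<open>a\<close> directly in front of \<open>b\<close>: the
  preimage of \<open>b\<close> is redirected to \<open>a\<close>, and \<open>a\<close>, a fixed
  point of \<tau>, is sent to \<open>b\<close>. All other arrows stay.\<close>

lemma orbit_insert_point:
  assumes fin: "finite A" and \<tau>: "\<tau> permutes A" and a: "a \<notin> A" and b: "b \<in> A" and x: "x \<in> A"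
  shows "orbit (Transposition.transpose a b \<circ> \<tau>) x = (if b \<in> orbit \<tau> x then insert a (orbit \<tau> x) else orbit \<tau> x)"
    (is "orbit ?\<sigma> x = ?R")
proof
  have ta: "\<tau> a = a" using \<tau> a by (simp add: permutes_def)
  have sa: "?\<sigma> a = b" by (simp add: ta)
  have sb: "?\<sigma> y = a" if "\<tau> y = b" for y by (simp add: that)
  have so: "?\<sigma> y = \<tau> y" if "y \<in> A" "\<tau> y \<noteq> b" for y
    using that \<tau> a by (metis comp_apply permutes_in_image transpose_apply_other)
  have sub: "orbit \<tau> x \<subseteq> A" using \<tau> x by (rule orbit_permutes_subset)
  show "orbit ?\<sigma> x \<subseteq> ?R"
  proof
    fix y assume "y \<in> orbit ?\<sigma> x"
    then show "y \<in> ?R"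
    proof induction
      case base
      show ?case
      proof (cases "\<tau> x = b")
        case True
        then show ?thesis using sb[OF True] orbit.base[of \<tau> x] by auto
      next
        case False
        then show ?thesis using so[OF x False] orbit.base[of \<tau> x] by auto
      qed
    next
      case (step y)
      show ?case
      proof (cases "y = a")
        case True
        then have "b \<in> orbit \<tau> x" using step.IH sub a by (auto split: if_splits)
        then show ?thesis using True sa by auto
      next
        case False
        then have y: "y \<in> orbit \<tau> x" using step.IH by (auto split: if_splits)
        then have yA: "y \<in> A" using sub by auto
        have ty: "\<tau> y \<in> orbit \<tau> x" using y by (rule orbit.step)
        show ?thesis
        proof (cases "\<tau> y = b")
          case True
          then show ?thesis using sb[OF True] ty by auto
        next
          case False
          then show ?thesis using so[OF yA False] ty by auto
        qed
      qed
    qed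
  qed
  \<comment> \<open>One step of \<tau> is one step of the new permutation, or two when it arrives at
    \<open>b\<close>, the extra stop being \<open>a\<close>.\<close>
  have step2: "\<tau> y \<in> orbit ?\<sigma> x \<and> (\<tau> y = b \<longrightarrow> a \<in> orbit ?\<sigma> x)"
    if "y = x \<or> y \<in> orbit ?\<sigma> x" "y \<in> A" for y
  proof (cases "\<tau> y = b")
    case True
    have "?\<sigma> y \<in> orbit ?\<sigma> x" using that(1) by (metis orbit.base orbit.step)
    then have "a \<in> orbit ?\<sigma> x" by (simp only: sb[OF True])
    moreover from orbit.step[OF this] have "b \<in> orbit ?\<sigma> x" by (simp only: sa)
    ultimately show ?thesis using True by simp
  next
    case False
    have "?\<sigma> y \<in> orbit ?\<sigma> x" using that(1) by (metis orbit.base orbit.step)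
    then show ?thesis using False so[OF that(2) False] by simp
  qed
  have *: "y \<in> orbit ?\<sigma> x \<and> (y = b \<longrightarrow> a \<in> orbit ?\<sigma> x)" if "y \<in> orbit \<tau> x" for y
    using that
  proof induction
    case base
    show ?case using step2[of x] x by blast
  next
    case (step y)
    then have "y \<in> A" using sub by auto
    then show ?case using step2[of y] step.IH by blast
  qed
  show "?R \<subseteq> orbit ?\<sigma> x" using * by auto
qed

lemma cyc_type_insert_point:
  assumes fin: "finite A" and \<tau>: "\<tau> permutes A" and a: "a \<notin> A" and b: "b \<in> A"
  shows "cyc_type (insert a A) (Transposition.transpose a b \<circ> \<tau>) =
    add_mset (Suc (card (orbit \<tau> b))) (cyc_type A \<tau> - {#card (orbit \<tau> b)#})"
proof -
  let ?\<sigma> = "Transposition.transpose a b \<circ> \<tau>" and ?O = "orbit \<tau> b"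
  have ta: "\<tau> a = a" using \<tau> a by (simp add: permutes_def)
  have bO: "b \<in> ?O" using fin \<tau> permutation_permutes permutation_self_in_orbit by metis
  have \<sigma>: "?\<sigma> permutes insert a A"
    using \<tau> b by (intro permutes_compose permutes_swap_id) (auto intro: permutes_subset)
  have sub: "orbit \<tau> x \<subseteq> A" if "x \<in> A" for x using orbit_permutes_subset[OF \<tau> that] .
  have finO: "finite ?O" using sub[OF b] fin finite_subset by blast
  have ob: "orbit ?\<sigma> b = insert a ?O" using orbit_insert_point[OF fin \<tau> a b b] bO by simp
  then have oa: "orbit ?\<sigma> a = insert a ?O"
    using orbit_permutes_eq[OF _ \<sigma>, of a b] fin by auto
  have ox: "orbit ?\<sigma> x = (if orbit \<tau> x = ?O then insert a ?O else orbit \<tau> x)" if x: "x \<in> A" for x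
  proof -
    have "b \<in> orbit \<tau> x \<longleftrightarrow> orbit \<tau> x = ?O"
      using orbit_permutes_eq[OF fin \<tau>, of b x] bO by auto
    then show ?thesis using orbit_insert_point[OF fin \<tau> a b x] by simp
  qed
  have img: "orbit ?\<sigma> ` insert a A = insert (insert a ?O) (orbit \<tau> ` A - {?O})"
    using oa ox b by (auto simp: image_iff)
  have "insert a ?O \<notin> orbit \<tau> ` A - {?O}" using sub a by auto
  then have "cyc_type (insert a A) ?\<sigma> = add_mset (card (insert a ?O)) (image_mset card (mset_set (orbit \<tau> ` A - {?O})))"
    unfolding cyc_type_def img using fin by simp
  moreover have "card (insert a ?O) = Suc (card ?O)"
    using finO sub[OF b] a by (subst card_insert_disjoint) auto
  moreover have "image_mset card (mset_set (orbit \<tau> ` A - {?O})) = cyc_type A \<tau> - {#card ?O#}"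
    unfolding cyc_type_def using fin b by (subst mset_set_Diff) (auto simp: image_mset_Diff)
  ultimately show ?thesis by simp
qed

lemma cyc_type_insert_fixpoint:
  assumes fin: "finite A" and \<tau>: "\<tau> permutes A" and a: "a \<notin> A"
  shows "cyc_type (insert a A) \<tau> = add_mset 1 (cyc_type A \<tau>)"
proof -
  have "\<tau> a = a" using \<tau> a by (simp add: permutes_def)
  then have "orbit \<tau> a = {a}" by (simp add: orbit_eq_singleton_iff)
  moreover have "{a} \<notin> orbit \<tau> ` A" using orbit_permutes_subset[OF \<tau>] a by blast
  ultimately show ?thesis using fin by (simp add: cyc_type_def)
qed

text \<open>A cycle is counted once for each of its points, which is where the factor x in
  \<open>insert_point\<close> comes from.\<close>

lemma sum_orbit_cyc_type:
  assumes fin: "finite A" and \<tau>: "\<tau> permutes A"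
  shows "(\<Sum>b\<in>A. h (card (orbit \<tau> b))) = (\<Sum>x\<in>#cyc_type A \<tau>. real x * h x)"
proof -
  have "(\<Sum>b\<in>A. h (card (orbit \<tau> b))) = (\<Sum>O'\<in>orbit \<tau> ` A. \<Sum>b\<in>{b\<in>A. orbit \<tau> b = O'}. h (card (orbit \<tau> b)))"
    by (rule sum.image_gen[OF fin])
  also have "\<dots> = (\<Sum>O'\<in>orbit \<tau> ` A. real (card O') * h (card O'))"
  proof (rule sum.cong[OF refl])
    fix O' assume "O' \<in> orbit \<tau> ` A"
    then obtain x where x: "x \<in> A" "O' = orbit \<tau> x" by auto
    have self: "b \<in> orbit \<tau> b" for b using fin \<tau> permutation_permutes permutation_self_in_orbit by metis
    have "{b\<in>A. orbit \<tau> b = O'} = O'"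
      using x orbit_permutes_subset[OF \<tau> x(1)] orbit_permutes_eq[OF fin \<tau>] self by blast
    moreover have "(\<Sum>b\<in>{b\<in>A. orbit \<tau> b = O'}. h (card (orbit \<tau> b))) = (\<Sum>b\<in>{b\<in>A. orbit \<tau> b = O'}. h (card O'))"
      by (rule sum.cong) auto
    ultimately show "(\<Sum>b\<in>{b\<in>A. orbit \<tau> b = O'}. h (card (orbit \<tau> b))) = real (card O') * h (card O')"
      by simp
  qed
  also have "\<dots> = (\<Sum>x\<in>#cyc_type A \<tau>. real x * h x)"
    unfolding cyc_type_def by (simp add: sum_unfold_sum_mset multiset.map_comp o_def)
  finally show ?thesis .
qed

text \<open>Each permutation of \<open>insert a A\<close> is a transposition of \<open>a\<close>
  with some b applied after a permutation of \<open>A\<close>, in a unique way, and b = a makes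
  \<open>a\<close> a fixed point. Hence both sides obey the insertion recursion.\<close>

lemma sum_permutes_cyc_type:
  assumes "finite A"
  shows "(\<Sum>\<sigma> | \<sigma> permutes A. \<Psi> (cyc_type A \<sigma>)) = fact (card A) * cyc_sum (\<lambda>_. 1) (card A) (\<lambda>xs. \<Psi> (mset xs))"
  using assms
proof (induction A arbitrary: \<Psi> rule: finite_induct)
  case empty
  then show ?case by (simp add: cyc_type_def)
next
  case (insert a A)
  have "(\<Sum>\<sigma> | \<sigma> permutes insert a A. \<Psi> (cyc_type (insert a A) \<sigma>)) =
     (\<Sum>b\<in>insert a A. \<Sum>\<tau> | \<tau> permutes A. \<Psi> (cyc_type (insert a A) (Transposition.transpose a b \<circ> \<tau>)))"
    by (rule sum_over_permutations_insert) fact+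
  also have "\<dots> = (\<Sum>\<tau> | \<tau> permutes A. \<Sum>b\<in>insert a A. \<Psi> (cyc_type (insert a A) (Transposition.transpose a b \<circ> \<tau>)))"
    by (rule sum.swap)
  also have "\<dots> = (\<Sum>\<tau> | \<tau> permutes A. insert_point \<Psi> (cyc_type A \<tau>))"
  proof (intro sum.cong refl)
    fix \<tau> assume "\<tau> \<in> {\<tau>. \<tau> permutes A}"
    then have \<tau>: "\<tau> permutes A" by simp
    have "(\<Sum>b\<in>insert a A. \<Psi> (cyc_type (insert a A) (Transposition.transpose a b \<circ> \<tau>))) =
      \<Psi> (add_mset 1 (cyc_type A \<tau>)) + (\<Sum>b\<in>A. \<Psi> (add_mset (Suc (card (orbit \<tau> b))) (cyc_type A \<tau> - {#card (orbit \<tau> b)#})))"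
      using insert(1,2) cyc_type_insert_fixpoint[OF insert(1) \<tau> insert(2)] cyc_type_insert_point[OF insert(1) \<tau> insert(2)]
      by simp
    also have "\<dots> = insert_point \<Psi> (cyc_type A \<tau>)"
      unfolding insert_point_def
      using sum_orbit_cyc_type[OF insert(1) \<tau>, of "\<lambda>x. \<Psi> (add_mset (Suc x) (cyc_type A \<tau> - {#x#}))"] by simp
    finally show "(\<Sum>b\<in>insert a A. \<Psi> (cyc_type (insert a A) (Transposition.transpose a b \<circ> \<tau>))) = insert_point \<Psi> (cyc_type A \<tau>)" .
  qed
  also have "\<dots> = fact (card A) * (real (Suc (card A)) * cyc_sum (\<lambda>_. 1) (Suc (card A)) (\<lambda>xs. \<Psi> (mset xs)))"
    unfolding cyc_sum_insert_point by (rule insert.IH)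
  finally show ?case using insert(1,2) by (simp del: cyc_sum.simps)
qed

lemma ens_weight_cyc_type:
  assumes "\<sigma> permutes {1..N}"
  shows "ens_weight \<theta> \<kappa> N \<sigma> = (\<Prod>x\<in>#cyc_type {1..N} \<sigma>. \<theta> x + real N * \<kappa> x)"
proof -
  let ?w = "\<lambda>x. \<theta> x + real N * \<kappa> x" and ?C = "cycles_of N \<sigma>"
  have C: "?C = orbit \<sigma> ` {1..N}" by (simp add: cycles_of_def)
  have card_C: "card c \<in> {1..N}" if c: "c \<in> ?C" for c
  proof -
    obtain x where x: "x \<in> {1..N}" "c = orbit \<sigma> x" using c C by auto
    then have "c \<subseteq> {1..N}" using orbit_permutes_subset[OF assms] by auto
    moreover have "c \<noteq> {}" using x orbit_nonempty by metis
    ultimately show ?thesis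
      using card_mono[of "{1..N}" c] finite_subset[of c "{1..N}"] card_gt_0_iff[of c] by (simp add: Suc_le_eq)
  qed
  have "(\<Prod>x\<in>#cyc_type {1..N} \<sigma>. ?w x) = (\<Prod>c\<in>?C. ?w (card c))"
    unfolding cyc_type_def C[symmetric] by (simp add: prod_unfold_prod_mset multiset.map_comp o_def)
  also have "\<dots> = (\<Prod>j\<in>card ` ?C. \<Prod>c\<in>{c\<in>?C. card c = j}. ?w (card c))"
    by (rule prod.image_gen) (simp add: C)
  also have "\<dots> = (\<Prod>j\<in>card ` ?C. ?w j ^ cycle_count N \<sigma> j)"
    by (intro prod.cong refl) (simp add: cycle_count_def)
  also have "\<dots> = (\<Prod>j\<in>{1..N}. ?w j ^ cycle_count N \<sigma> j)"
  proof (rule prod.mono_neutral_left)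
    show "\<forall>i\<in>{1..N} - card ` ?C. ?w i ^ cycle_count N \<sigma> i = 1"
    proof
      fix i assume "i \<in> {1..N} - card ` ?C"
      then have "{c \<in> ?C. card c = i} = {}" by auto
      then show "?w i ^ cycle_count N \<sigma> i = 1" by (simp only: cycle_count_def) simp
    qed
  qed (use card_C in auto)
  finally show ?thesis by (simp add: ens_weight_def)
qed

lemma ens_sum_cyc_sum:
  "(\<Sum>\<sigma> | \<sigma> permutes {1..N}. ens_weight \<theta> \<kappa> N \<sigma> * \<Psi> (cyc_type {1..N} \<sigma>)) =
   fact N * cyc_sum (\<lambda>j. \<theta> j + real N * \<kappa> j) N (\<lambda>xs. \<Psi> (mset xs))"
proof -
  let ?w = "\<lambda>x. \<theta> x + real N * \<kappa> x"
  have "(\<Sum>\<sigma> | \<sigma> permutes {1..N}. ens_weight \<theta> \<kappa> N \<sigma> * \<Psi> (cyc_type {1..N} \<sigma>)) =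
    (\<Sum>\<sigma> | \<sigma> permutes {1..N}. (\<lambda>X. (\<Prod>x\<in>#X. ?w x) * \<Psi> X) (cyc_type {1..N} \<sigma>))"
    by (intro sum.cong refl) (simp add: ens_weight_cyc_type)
  also have "\<dots> = fact N * cyc_sum (\<lambda>_. 1) N (\<lambda>xs. (\<Prod>x\<in>#mset xs. ?w x) * \<Psi> (mset xs))"
    by (subst sum_permutes_cyc_type) auto
  also have "cyc_sum (\<lambda>_. 1) N (\<lambda>xs. (\<Prod>x\<in>#mset xs. ?w x) * \<Psi> (mset xs)) = cyc_sum ?w N (\<lambda>xs. \<Psi> (mset xs))"
    by (simp only: cyc_sum_absorb[of ?w] mset_map[symmetric] prod_mset_prod_list)
  finally show ?thesis .
qed

lemma ens_prob_expectation:
  "(\<Sum>\<sigma> | \<sigma> permutes {1..N}. ens_prob \<theta> \<kappa> N \<sigma> * \<Psi> (cyc_type {1..N} \<sigma>)) =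
   cyc_sum (\<lambda>j. \<theta> j + real N * \<kappa> j) N (\<lambda>xs. \<Psi> (mset xs)) / cyc_total (\<lambda>j. \<theta> j + real N * \<kappa> j) N"
proof -
  have "(\<Sum>\<sigma> | \<sigma> permutes {1..N}. ens_prob \<theta> \<kappa> N \<sigma> * \<Psi> (cyc_type {1..N} \<sigma>)) =
    (\<Sum>\<sigma> | \<sigma> permutes {1..N}. ens_weight \<theta> \<kappa> N \<sigma> * \<Psi> (cyc_type {1..N} \<sigma>)) / (\<Sum>\<sigma> | \<sigma> permutes {1..N}. ens_weight \<theta> \<kappa> N \<sigma>)"
    unfolding ens_prob_def sum_divide_distrib by simp
  moreover have "(\<Sum>\<sigma> | \<sigma> permutes {1..N}. ens_weight \<theta> \<kappa> N \<sigma>) = fact N * cyc_total (\<lambda>j. \<theta> j + real N * \<kappa> j) N"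
    using ens_sum_cyc_sum[where \<Psi> = "\<lambda>_. 1" and N = N and \<theta> = \<theta> and \<kappa> = \<kappa>] by simp
  ultimately show ?thesis by (simp only: ens_sum_cyc_sum) simp
qed

section \<open>Generating functions\<close>

text \<open>Bounded weights thus give radius of convergence at least 1; this is needed before any
  generating function may be formed.\<close>

lemma cyc_total_exp_growth:
  assumes w: "\<And>j. 1 \<le> j \<Longrightarrow> \<bar>w j\<bar> \<le> C" and s: "1 < s"
  shows "\<exists>K. \<forall>n. \<bar>cyc_total w n\<bar> \<le> K * s ^ n"
proof -
  \<comment> \<open>From \<open>n0\<close> on, n \<ge> C / (s - 1) absorbs the geometric sum that
    the recursion produces; \<open>K\<close> takes care of the smaller indices.\<close>
  define n0 where "n0 = nat \<lceil>C / (s - 1)\<rceil>"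
  define K where "K = (\<Sum>i\<le>n0. \<bar>cyc_total w i\<bar>)"
  have C0: "0 \<le> C" using w[of 1] by simp
  have K0: "0 \<le> K" by (simp add: K_def sum_nonneg)
  have "\<bar>cyc_total w n\<bar> \<le> K * s ^ n" for n
  proof (induction n rule: less_induct)
    case (less n)
    show ?case
    proof (cases "n \<le> n0")
      case True
      then have "\<bar>cyc_total w n\<bar> \<le> K" unfolding K_def by (intro member_le_sum) auto
      also have "K * 1 \<le> K * s ^ n" using K0 s by (intro mult_left_mono one_le_power) auto
      finally show ?thesis by simp
    next
      case False
      have sn: "C / (s - 1) \<le> real n" using False unfolding n0_def by linarith
      have "real n * \<bar>cyc_total w n\<bar> = \<bar>\<Sum>j\<in>{1..n}. w j * cyc_total w (n - j)\<bar>"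
        by (simp only: cyc_total_rec[symmetric] abs_mult abs_of_nat)
      also have "\<dots> \<le> (\<Sum>j\<in>{1..n}. C * (K * s ^ (n - j)))"
        by (rule order_trans[OF sum_abs])
           (auto simp: abs_mult C0 intro!: sum_mono mult_mono w less)
      also have "\<dots> = C * K * (\<Sum>i<n. s ^ i)"
        unfolding sum_distrib_left
        by (rule sum.reindex_bij_witness[of _ "\<lambda>i. n - i" "\<lambda>j. n - j"]) auto
      also have "(\<Sum>i<n. s ^ i) = (s ^ n - 1) / (s - 1)"
        using s by (subst geometric_sum) auto
      also have "C * K * ((s ^ n - 1) / (s - 1)) \<le> C * K * (s ^ n / (s - 1))"
        using s C0 K0 by (intro mult_left_mono divide_right_mono) auto
      also have "\<dots> = (C / (s - 1)) * (K * s ^ n)" by simp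
      also have "\<dots> \<le> real n * (K * s ^ n)" using sn K0 s by (intro mult_right_mono) auto
      finally show ?thesis using False by simp
    qed
  qed
  then show ?thesis by blast
qed

lemma cyc_total_summable_power:
  assumes w: "\<And>j. 1 \<le> j \<Longrightarrow> \<bar>w j\<bar> \<le> C" and r: "\<bar>r\<bar> < 1"
  shows "summable (\<lambda>n. \<bar>cyc_total w n * r ^ n\<bar>)"
proof -
  \<comment> \<open>The midpoint of 1 and 1 / |r|, so that both s > 1 and s |r| < 1; the value for r
    = 0 is arbitrary.\<close>
  define s where "s = (if r = 0 then 2 else (1 + 1 / \<bar>r\<bar>) / 2)"
  have s: "1 < s" "s * \<bar>r\<bar> < 1"
    using r by (auto simp: s_def distrib_right less_divide_eq)
  obtain K where K: "\<And>n. \<bar>cyc_total w n\<bar> \<le> K * s ^ n"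
    using cyc_total_exp_growth[of w C s] w s(1) by blast
  have "summable (\<lambda>n. K * (s * \<bar>r\<bar>) ^ n)"
    using s by (intro summable_mult summable_geometric) (simp add: abs_mult)
  then show ?thesis
  proof (rule summable_comparison_test'[where N = 0])
    show "norm \<bar>cyc_total w n * r ^ n\<bar> \<le> K * (s * \<bar>r\<bar>) ^ n" if "n \<ge> 0" for n
      using mult_right_mono[OF K, of "\<bar>r\<bar> ^ n" n] by (simp add: abs_mult power_abs power_mult_distrib mult.assoc)
  qed
qed

text \<open>The exponential formula. The recursion says F' = W' F for the two power series, so F exp
  (- W) is constant, with value 1 at 0.\<close>

lemma cyc_total_generating_function:
  assumes w: "\<And>j. 1 \<le> j \<Longrightarrow> \<bar>w j\<bar> \<le> C" and w0: "w 0 = 0" and r: "\<bar>r\<bar> < 1"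
  shows "(\<Sum>n. cyc_total w n * r ^ n) = exp (\<Sum>j. w j / real j * r ^ j)"
proof -
  let ?a = "cyc_total w"
  define F where "F = (\<lambda>r. \<Sum>n. ?a n * r ^ n)"
  define W where "W = (\<lambda>r. \<Sum>j. w j / real j * r ^ j)"
  define V where "V = (\<lambda>r. \<Sum>j. w (Suc j) * r ^ j)"
  have C0: "0 \<le> C" using w[of 1] by simp
  have sa: "summable (\<lambda>n. \<bar>?a n * x ^ n\<bar>)" if "\<bar>x\<bar> < 1" for x
    using cyc_total_summable_power[OF w that] .
  have wj: "\<bar>w j\<bar> \<le> C" for j using w[of j] w0 C0 by (cases j) auto
  have sw: "summable (\<lambda>n. \<bar>w (Suc n) * x ^ n\<bar>)" if "\<bar>x\<bar> < 1" for x
    by (rule summable_comparison_test'[OF summable_mult[OF summable_geometric[of "\<bar>x\<bar>"], of C]])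
       (use that in \<open>auto simp: abs_mult power_abs intro!: mult_right_mono wj\<close>)
  have sW: "summable (\<lambda>n. w n / real n * x ^ n)" if "\<bar>x\<bar> < 1" for x
  proof (rule summable_comparison_test'[OF summable_mult[OF summable_geometric[of "\<bar>x\<bar>"], of C]])
    fix n :: nat assume "n \<ge> 0"
    have "\<bar>w n / real n\<bar> \<le> C"
    proof (cases "n = 0")
      case False
      then have "\<bar>w n\<bar> / real n \<le> C / 1" using wj[of n] by (intro frac_le) auto
      then show ?thesis by (simp add: abs_divide)
    qed (use C0 in simp)
    then show "norm (w n / real n * x ^ n) \<le> C * \<bar>x\<bar> ^ n"
      by (simp only: abs_mult power_abs real_norm_def mult_right_mono zero_le_power abs_ge_zero)
  qed (use that in auto)
  have dF: "(F has_real_derivative V x * F x) (at x)" if x: "\<bar>x\<bar> < 1" for x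
  proof -
    obtain K where K: "\<bar>x\<bar> < K" "K < 1" using dense[OF x] by auto
    have "(F has_real_derivative (\<Sum>n. diffs ?a n * x ^ n)) (at x)"
      unfolding F_def
      by (rule termdiffs_strong[of _ K]) (use K sa[of K] in \<open>auto intro: summable_rabs_cancel\<close>)
    also have "(\<Sum>n. diffs ?a n * x ^ n) = (\<Sum>n. \<Sum>i\<le>n. (w (Suc i) * x ^ i) * (?a (n - i) * x ^ (n - i)))"
    proof (intro suminf_cong)
      fix n
      have "diffs ?a n = (\<Sum>j\<in>{1..Suc n}. w j * ?a (Suc n - j))"
        by (simp only: diffs_def cyc_total_rec[symmetric] of_nat_Suc of_nat_id)
      also have "\<dots> = (\<Sum>i\<le>n. w (Suc i) * ?a (n - i))"
        by (rule sum.reindex_bij_witness[of _ Suc "\<lambda>j. j - 1"]) auto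
      also have "\<dots> * x ^ n = (\<Sum>i\<le>n. (w (Suc i) * x ^ i) * (?a (n - i) * x ^ (n - i)))"
        unfolding sum_distrib_right
      proof (rule sum.cong[OF refl])
        fix i assume "i \<in> {..n}"
        then have "x ^ n = x ^ i * x ^ (n - i)" by (simp flip: power_add)
        then show "w (Suc i) * ?a (n - i) * x ^ n = (w (Suc i) * x ^ i) * (?a (n - i) * x ^ (n - i))" by simp
      qed
      finally show "diffs ?a n * x ^ n = (\<Sum>i\<le>n. (w (Suc i) * x ^ i) * (?a (n - i) * x ^ (n - i)))" .
    qed
    also have "\<dots> = V x * F x"
      unfolding V_def F_def using sa[OF x] sw[OF x] by (subst Cauchy_product) auto
    finally show ?thesis .
  qed
  have dW: "(W has_real_derivative V x) (at x)" if x: "\<bar>x\<bar> < 1" for x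
  proof -
    obtain K where K: "\<bar>x\<bar> < K" "K < 1" using dense[OF x] by auto
    have "(W has_real_derivative (\<Sum>n. diffs (\<lambda>j. w j / real j) n * x ^ n)) (at x)"
      unfolding W_def
      by (rule termdiffs_strong[of _ K]) (use K sW[of K] in auto)
    also have "(\<lambda>n. diffs (\<lambda>j. w j / real j) n * x ^ n) = (\<lambda>n. w (Suc n) * x ^ n)"
      by (intro ext) (simp add: diffs_def)
    finally show ?thesis unfolding V_def .
  qed
  have "\<exists>c. \<forall>x\<in>{-1<..<1}. F x * exp (- W x) = c"
  proof (rule has_field_derivative_zero_constant)
    fix x :: real assume "x \<in> {-1<..<1}"
    then have x: "\<bar>x\<bar> < 1" by auto
    have "((\<lambda>x. F x * exp (- W x)) has_real_derivative V x * F x * exp (- W x) + F x * (exp (- W x) * (- V x))) (at x)"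
      using dF[OF x] dW[OF x] by (auto intro!: derivative_eq_intros)
    then show "((\<lambda>x. F x * exp (- W x)) has_real_derivative 0) (at x within {-1<..<1})"
      by (simp add: mult_ac has_field_derivative_at_within)
  qed simp
  then obtain c where c: "\<And>x. x \<in> {-1<..<1} \<Longrightarrow> F x * exp (- W x) = c" by auto
  have "F 0 = 1" "W 0 = 0" unfolding F_def W_def by (subst powser_zero; simp add: w0)+
  then have "c = 1" using c[of 0] by simp
  moreover have "r \<in> {-1<..<1}" unfolding greaterThanLessThan_iff using r by linarith
  ultimately have "F r * exp (- W r) = 1" using c[of r] by auto
  then show ?thesis unfolding F_def W_def by (simp add: exp_minus field_simps)
qed

text \<open>On the boundary of the disc: for r < 1 the exponential formula bounds each partial sum
  independently of r, and r may then tend to 1.\<close>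

lemma cyc_total_sums_nonneg:
  assumes w: "\<And>j. 0 \<le> w j" "\<And>j. w j \<le> C" and w0: "w 0 = 0" and sm: "summable (\<lambda>j. w j / real j)"
  shows "summable (cyc_total w)"
proof (rule bounded_imp_summable)
  show "0 \<le> cyc_total w n" for n by (rule cyc_total_nonneg) (rule w)
  fix n
  have "(\<Sum>k\<le>n. cyc_total w k * r ^ k) \<le> exp (\<Sum>j. w j / real j)" if r: "0 < r" "r < 1" for r
  proof -
    have "(\<Sum>k\<le>n. cyc_total w k * r ^ k) \<le> (\<Sum>k. cyc_total w k * r ^ k)"
      using r w by (intro sum_le_suminf summable_rabs_cancel[OF cyc_total_summable_power[of _ C]])
        (auto intro!: mult_nonneg_nonneg cyc_total_nonneg)
    also have "\<dots> = exp (\<Sum>j. w j / real j * r ^ j)"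
      using w r by (intro cyc_total_generating_function[of _ C] w0) auto
    also have "(\<Sum>j. w j / real j * r ^ j) \<le> (\<Sum>j. w j / real j)"
    proof (rule suminf_le)
      show *: "w j / real j * r ^ j \<le> w j / real j" for j
        using w r by (intro mult_right_le_one_le power_le_one) auto
      show "summable (\<lambda>j. w j / real j * r ^ j)"
        using * r w by (intro summable_comparison_test'[OF sm]) auto
    qed (fact sm)
    finally show ?thesis by simp
  qed
  then have ev: "eventually (\<lambda>r. (\<Sum>k\<le>n. cyc_total w k * r ^ k) \<le> exp (\<Sum>j. w j / real j)) (at_left 1)"
    by (intro eventually_at_leftI[of 0]) auto
  have "((\<lambda>r. \<Sum>k\<le>n. cyc_total w k * r ^ k) \<longlongrightarrow> (\<Sum>k\<le>n. cyc_total w k * 1 ^ k)) (at_left 1)"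
    by (intro tendsto_intros)
  from tendsto_upperbound[OF this ev trivial_limit_at_left_real]
  show "(\<Sum>k\<le>n. cyc_total w k) \<le> exp (\<Sum>j. w j / real j)" by simp
qed

lemma powser_tendsto_at_left_1:
  fixes a :: "nat \<Rightarrow> real"
  assumes "summable (\<lambda>n. \<bar>a n\<bar>)"
  shows "((\<lambda>r. \<Sum>n. a n * r ^ n) \<longlongrightarrow> (\<Sum>n. a n)) (at_left 1)"
proof -
  have "eventually (\<lambda>r::real. 0 < r \<and> r < 1) (at_left 1)"
    by (intro eventually_at_leftI[of 0]) auto
  then have "eventually (\<lambda>(k,r). norm (a k * r ^ k) \<le> \<bar>a k\<bar>) (at_top \<times>\<^sub>F at_left (1::real))"
    unfolding eventually_prod_filter
    by (intro exI[of _ "\<lambda>_. True"] exI[of _ "\<lambda>r. 0 < r \<and> r < 1"])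
       (auto simp: abs_mult power_abs intro!: mult_right_le_one_le power_le_one)
  moreover have "((\<lambda>r. a k * r ^ k) \<longlongrightarrow> a k * 1 ^ k) (at_left 1)" for k
    by (intro tendsto_intros)
  ultimately show ?thesis
    using tannerys_theorem[of "\<lambda>k r. a k * r ^ k" a "at_left 1" "\<lambda>k. \<bar>a k\<bar>"] assms by simp
qed

text \<open>The absolute values of the weights give a summable majorant; letting r tend to 1 on both
  sides of the exponential formula then yields the value of the sum.\<close>

lemma cyc_total_sums:
  assumes w: "\<And>j. \<bar>w j\<bar> \<le> C" and w0: "w 0 = 0" and sm: "summable (\<lambda>j. \<bar>w j\<bar> / real j)"
  shows "summable (\<lambda>n. \<bar>cyc_total w n\<bar>)" "(\<Sum>n. cyc_total w n) = exp (\<Sum>j. w j / real j)"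
proof -
  have "summable (cyc_total (\<lambda>j. \<bar>w j\<bar>))"
    using w w0 sm by (intro cyc_total_sums_nonneg[of _ C]) auto
  then show s1: "summable (\<lambda>n. \<bar>cyc_total w n\<bar>)"
  proof (rule summable_comparison_test'[where N = 0])
    show "norm \<bar>cyc_total w n\<bar> \<le> cyc_total (\<lambda>j. \<bar>w j\<bar>) n" for n
      using cyc_sum_abs_le[of n "\<lambda>_. 1" "\<lambda>_. 1" w "\<lambda>j. \<bar>w j\<bar>"] by simp
  qed
  have A: "((\<lambda>r. \<Sum>n. cyc_total w n * r ^ n) \<longlongrightarrow> (\<Sum>n. cyc_total w n)) (at_left 1)"
    by (rule powser_tendsto_at_left_1[OF s1])
  have B: "((\<lambda>r. exp (\<Sum>j. w j / real j * r ^ j)) \<longlongrightarrow> exp (\<Sum>j. w j / real j)) (at_left 1)"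
    using sm by (intro tendsto_exp powser_tendsto_at_left_1) (simp add: abs_divide)
  have "eventually (\<lambda>r. (\<Sum>n. cyc_total w n * r ^ n) = exp (\<Sum>j. w j / real j * r ^ j)) (at_left 1)"
    by (intro eventually_at_leftI[of 0] cyc_total_generating_function[of _ C] w w0) auto
  from Lim_transform_eventually[OF A this] show "(\<Sum>n. cyc_total w n) = exp (\<Sum>j. w j / real j)"
    using B by (rule tendsto_unique[OF trivial_limit_at_left_real])
qed

text \<open>These are the coefficients of (1 - z)^(-t). Comparing the recursion at n and n + 1
  leaves a first-order recurrence.\<close>

lemma cyc_total_const: "cyc_total (\<lambda>_. t) n = pochhammer t n / fact n"
proof (induction n)
  case (Suc n)
  let ?a = "cyc_total (\<lambda>_. t)"
  have shift: "(\<Sum>j\<in>{1..m}. t * ?a (m - j)) = t * (\<Sum>i<m. ?a i)" for m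
    unfolding sum_distrib_left by (rule sum.reindex_bij_witness[of _ "\<lambda>i. m - i" "\<lambda>j. m - j"]) auto
  have "real (Suc n) * ?a (Suc n) = t * (\<Sum>i<n. ?a i) + t * ?a n"
    unfolding cyc_total_rec shift by (simp add: distrib_left)
  also have "t * (\<Sum>i<n. ?a i) = real n * ?a n"
    unfolding cyc_total_rec shift ..
  finally have "?a (Suc n) = (t + real n) * ?a n / real (Suc n)" by (simp add: field_simps)
  then show ?case by (simp only: Suc) (simp add: pochhammer_Suc mult_ac)
qed simp

lemma sum_cyc_total_const:
  "t * (\<Sum>i\<le>n. cyc_total (\<lambda>_. t) i) = real (Suc n) * cyc_total (\<lambda>_. t) (Suc n)"
  unfolding cyc_total_rec sum_distrib_left
  by (rule sum.reindex_bij_witness[of _ "\<lambda>j. Suc n - j" "\<lambda>i. Suc n - i"]) auto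

text \<open>The reciprocal of the product that defines \<open>Gamma_series'\<close>.\<close>

lemma cyc_total_const_asymp:
  assumes t: "0 < (t :: real)"
  shows "(\<lambda>n. cyc_total (\<lambda>_. t) n / real n powr (t - 1)) \<longlonglongrightarrow> 1 / Gamma t"
proof -
  have "Gamma_series' t \<longlonglongrightarrow> Gamma t" by (rule Gamma_series'_LIMSEQ)
  then have "(\<lambda>n. 1 / Gamma_series' t n) \<longlonglongrightarrow> 1 / Gamma t"
    using Gamma_real_pos[OF t] by (intro tendsto_intros) auto
  moreover have "eventually (\<lambda>n. 1 / Gamma_series' t n = cyc_total (\<lambda>_. t) n / real n powr (t - 1)) sequentially"
    using eventually_gt_at_top[of 0]
  proof eventually_elim
    case (elim n)
    then have "(fact n :: real) = real n * fact (n - 1)" by (simp add: fact_reduce)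
    moreover have "real n powr (t - 1) = exp (t * ln (real n)) / real n"
      using elim by (simp add: powr_diff) (simp add: powr_def)
    ultimately show ?case
      using elim by (simp add: Gamma_series'_def cyc_total_const field_simps)
  qed
  ultimately show ?thesis by (rule Lim_transform_eventually)
qed

section \<open>Coefficients of logarithmic generating functions\<close>

lemma tendsto_convolution:
  fixes b c :: "nat \<Rightarrow> real"
  assumes b: "summable (\<lambda>n. \<bar>b n\<bar>)" and c: "c \<longlonglongrightarrow> L"
  shows "(\<lambda>n. \<Sum>k<n. b k * c (n - k)) \<longlonglongrightarrow> (\<Sum>k. b k) * L"
proof -
  obtain C where C: "\<And>n. \<bar>c n\<bar> \<le> C"
    using convergent_imp_Bseq[of c] c by (auto simp: convergent_def Bseq_def)
  let ?f = "\<lambda>k n. if k < n then b k * c (n - k) else 0"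
  have "(\<lambda>n. \<Sum>k. ?f k n) \<longlonglongrightarrow> (\<Sum>k. b k * L)"
  proof (rule tannerys_theorem[of ?f "\<lambda>k. b k * L" sequentially "\<lambda>k. \<bar>b k\<bar> * C", THEN conjunct2, THEN conjunct2])
    fix k
    have "(\<lambda>n. c (n - k)) \<longlonglongrightarrow> L" by (rule LIMSEQ_offset[where k = k]) (simp add: c)
    then have "(\<lambda>n. b k * c (n - k)) \<longlonglongrightarrow> b k * L" by (intro tendsto_intros)
    then show "(\<lambda>n. ?f k n) \<longlonglongrightarrow> b k * L"
      by (rule Lim_transform_eventually) (use eventually_gt_at_top[of k] in eventually_elim, simp)
    show "\<forall>\<^sub>F (k, n) in at_top \<times>\<^sub>F sequentially. norm (?f k n) \<le> \<bar>b k\<bar> * C"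
      using order_trans[OF abs_ge_zero C] by (intro always_eventually) (auto simp: abs_mult C intro!: mult_left_mono)
  qed (use b in \<open>auto intro: summable_mult2\<close>)
  moreover have "(\<Sum>k. ?f k n) = (\<Sum>k<n. b k * c (n - k))" for n
    by (subst suminf_finite[of "{..<n}"]) auto
  moreover have "(\<Sum>k. b k * L) = (\<Sum>k. b k) * L"
    using suminf_mult2[OF summable_rabs_cancel[OF b]] by simp
  ultimately show ?thesis by simp
qed

text \<open>Treats both signs of the exponent together, since t - 1 may have either.\<close>

lemma powr_le_powr_between:
  fixes x y :: real
  assumes "0 < l" "l \<le> 1" "l * y \<le> x" "x \<le> y" "0 < y"
  shows "x powr p \<le> max 1 (l powr p) * y powr p" "min 1 (l powr p) * y powr p \<le> x powr p"
proof -
  have xp: "0 < x" using assms by (meson less_le_trans mult_pos_pos)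
  have l: "(l * y) powr p = l powr p * y powr p" using assms by (simp add: powr_mult)
  have "x powr p \<le> max 1 (l powr p) * y powr p \<and> min 1 (l powr p) * y powr p \<le> x powr p"
  proof (cases "p \<ge> 0")
    case True
    have "x powr p \<le> 1 * y powr p" using True xp assms by (simp add: powr_mono2)
    also have "\<dots> \<le> max 1 (l powr p) * y powr p" by (intro mult_right_mono) auto
    finally have 1: "x powr p \<le> max 1 (l powr p) * y powr p" .
    have "min 1 (l powr p) * y powr p \<le> l powr p * y powr p" by (intro mult_right_mono) auto
    also have "\<dots> \<le> x powr p" unfolding l[symmetric] using True assms by (intro powr_mono2) auto
    finally show ?thesis using 1 by simp
  next
    case False
    have "x powr p \<le> l powr p * y powr p" unfolding l[symmetric] using False assms by (intro powr_mono2') auto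
    also have "\<dots> \<le> max 1 (l powr p) * y powr p" by (intro mult_right_mono) auto
    finally have 1: "x powr p \<le> max 1 (l powr p) * y powr p" .
    have "min 1 (l powr p) * y powr p \<le> 1 * y powr p" by (intro mult_right_mono) auto
    also have "\<dots> \<le> x powr p" using False assms xp by (simp add: powr_mono2')
    finally show ?thesis using 1 by simp
  qed
  then show "x powr p \<le> max 1 (l powr p) * y powr p" "min 1 (l powr p) * y powr p \<le> x powr p" by auto
qed

text \<open>The recursion writes n b_n as the convolution of the summable sequence b with the null
  sequence c.\<close>

lemma cyc_total_null:
  assumes c: "c \<longlonglongrightarrow> 0" and c0: "c 0 = 0" and sm: "summable (\<lambda>j. \<bar>c j\<bar> / real j)"
  shows "(\<lambda>n. real n * cyc_total c n) \<longlonglongrightarrow> 0"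
proof -
  obtain C where C: "\<And>n. \<bar>c n\<bar> \<le> C"
    using convergent_imp_Bseq[of c] c by (auto simp: convergent_def Bseq_def)
  have "summable (\<lambda>n. \<bar>cyc_total c n\<bar>)" by (rule cyc_total_sums[OF C c0 sm])
  from tendsto_convolution[OF this c]
  have "(\<lambda>n. \<Sum>k<n. cyc_total c k * c (n - k)) \<longlonglongrightarrow> 0" by simp
  moreover have "(\<Sum>k<n. cyc_total c k * c (n - k)) = real n * cyc_total c n" for n
    unfolding cyc_total_rec
    by (rule sum.reindex_bij_witness[of _ "\<lambda>j. n - j" "\<lambda>k. n - k"]) auto
  ultimately show ?thesis by simp
qed

lemma sum_cyc_total_const_bound:
  assumes t: "0 < (t :: real)"
  shows "\<exists>B. \<forall>n\<ge>1. (\<Sum>i\<le>n. cyc_total (\<lambda>_. t) i) \<le> B * real n powr t"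
proof -
  let ?a = "cyc_total (\<lambda>_. t)"
  have "(\<lambda>n. ?a (Suc n) / real (Suc n) powr (t - 1)) \<longlonglongrightarrow> 1 / Gamma t"
    using cyc_total_const_asymp[OF t] by (rule LIMSEQ_Suc)
  then obtain M where M: "\<And>n. \<bar>?a (Suc n) / real (Suc n) powr (t - 1)\<bar> \<le> M"
    using convergent_imp_Bseq[of "\<lambda>n. ?a (Suc n) / real (Suc n) powr (t - 1)"] by (auto simp: convergent_def Bseq_def)
  have M0: "0 \<le> M" using order_trans[OF abs_ge_zero M] .
  have "(\<Sum>i\<le>n. ?a i) \<le> M / t * 2 powr t * real n powr t" if n: "n \<ge> 1" for n
  proof -
    have "?a (Suc n) \<le> M * real (Suc n) powr (t - 1)"
      using M[of n] by (simp add: abs_le_iff divide_le_eq)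
    then have "real (Suc n) * ?a (Suc n) \<le> M * (real (Suc n) * real (Suc n) powr (t - 1))"
      by (simp add: mult.left_commute mult_left_mono)
    also have "real (Suc n) * real (Suc n) powr (t - 1) = real (Suc n) powr t"
      by (simp add: powr_diff)
    also have "\<dots> \<le> (2 * real n) powr t" using n t by (intro powr_mono2) auto
    also have "\<dots> = 2 powr t * real n powr t" by (simp add: powr_mult)
    finally have "t * (\<Sum>i\<le>n. ?a i) \<le> M * (2 powr t * real n powr t)"
      using M0 by (simp add: sum_cyc_total_const mult_left_mono)
    then show ?thesis using t by (simp add: field_simps)
  qed
  then show ?thesis by blast
qed

text \<open>The generating function is (1 - z)^(-t) times a factor whose coefficients b are
  absolutely summable. In the convolution the terms with 2 k \<le> n are dominated and give the
  limit; the others vanish.\<close>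

lemma cyc_total_asymp:
  assumes t: "0 < (t :: real)" and w: "\<And>j. 1 \<le> j \<Longrightarrow> w j = t + c j"
    and c: "c \<longlonglongrightarrow> 0" and c0: "c 0 = 0" and sm: "summable (\<lambda>j. \<bar>c j\<bar> / real j)"
  shows "(\<lambda>n. cyc_total w n / real n powr (t - 1)) \<longlonglongrightarrow> exp (\<Sum>j. c j / real j) / Gamma t"
proof -
  let ?a = "cyc_total (\<lambda>_. t)" and ?b = "cyc_total c"
  obtain C where C: "\<And>n. \<bar>c n\<bar> \<le> C"
    using convergent_imp_Bseq[of c] c by (auto simp: convergent_def Bseq_def)
  note b = cyc_total_sums[OF C c0 sm]
  have conv: "cyc_total w n = (\<Sum>k\<le>n. ?b k * ?a (n - k))" for n
  proof -
    have "cyc_total w n = cyc_total (\<lambda>j. c j + t) n" by (intro cyc_sum_cong) (auto simp: w)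
    then show ?thesis by (simp add: cyc_total_plus)
  qed
  have a0: "0 \<le> ?a n" for n using t by (intro cyc_total_nonneg) auto
  have aG: "(\<lambda>n. ?a n / real n powr (t - 1)) \<longlonglongrightarrow> 1 / Gamma t" by (rule cyc_total_const_asymp[OF t])
  then obtain M where M': "\<And>n. \<bar>?a n / real n powr (t - 1)\<bar> \<le> M"
    using convergent_imp_Bseq[of "\<lambda>n. ?a n / real n powr (t - 1)"] by (auto simp: convergent_def Bseq_def)
  have M: "?a n \<le> M * real n powr (t - 1)" if "n \<ge> 1" for n
    using abs_le_D1[OF M'[of n]] that by (simp add: divide_le_eq)
  have M0: "0 \<le> M" using M[of 1] a0[of 1] by simp
  define M2 where "M2 = max 1 ((1/2) powr (t - 1))"
  let ?f = "\<lambda>k n. if 2 * k \<le> n then ?b k * ?a (n - k) / real n powr (t - 1) else 0"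
  have "(\<lambda>n. \<Sum>k. ?f k n) \<longlonglongrightarrow> (\<Sum>k. ?b k * (1 / Gamma t))"
  proof (rule tannerys_theorem[of ?f "\<lambda>k. ?b k * (1 / Gamma t)" sequentially "\<lambda>k. \<bar>?b k\<bar> * (M * M2)", THEN conjunct2, THEN conjunct2])
    fix k
    have "(\<lambda>n. ?a (n - k) / real (n - k) powr (t - 1)) \<longlonglongrightarrow> 1 / Gamma t"
      by (rule LIMSEQ_offset[where k = k]) (simp add: aG)
    moreover have "(\<lambda>n. (real (n - k) / real n) powr (t - 1)) \<longlonglongrightarrow> 1 powr (t - 1)"
    proof (intro tendsto_powr tendsto_const)
      have "(\<lambda>n. 1 - real k / real n) \<longlonglongrightarrow> 1 - 0"
        by (intro tendsto_intros lim_const_over_n)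
      then have "(\<lambda>n. 1 - real k / real n) \<longlonglongrightarrow> 1" by simp
      then show "(\<lambda>n. real (n - k) / real n) \<longlonglongrightarrow> 1"
        by (rule Lim_transform_eventually)
           (use eventually_gt_at_top[of k] in eventually_elim, simp add: of_nat_diff field_simps)
    qed simp
    ultimately have "(\<lambda>n. ?b k * (?a (n - k) / real (n - k) powr (t - 1) * (real (n - k) / real n) powr (t - 1))) \<longlonglongrightarrow> ?b k * (1 / Gamma t * 1 powr (t - 1))"
      by (intro tendsto_mult tendsto_const)
    then have "(\<lambda>n. ?b k * (?a (n - k) / real (n - k) powr (t - 1) * (real (n - k) / real n) powr (t - 1))) \<longlonglongrightarrow> ?b k * (1 / Gamma t)"
      by simp
    then show "(\<lambda>n. ?f k n) \<longlonglongrightarrow> ?b k * (1 / Gamma t)"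
      by (rule Lim_transform_eventually)
         (use eventually_gt_at_top[of "2 * k"] in eventually_elim, simp add: powr_divide field_simps)
    have "norm (?f k n) \<le> \<bar>?b k\<bar> * (M * M2)" if n: "n \<ge> 1" for k n
    proof (cases "2 * k \<le> n")
      case True
      then have "real (n - k) powr (t - 1) \<le> M2 * real n powr (t - 1)"
        unfolding M2_def using n by (intro powr_le_powr_between) (auto simp: of_nat_diff)
      then have "?a (n - k) \<le> M * (M2 * real n powr (t - 1))"
        using True n by (intro order_trans[OF M mult_left_mono[OF _ M0]]) auto
      then have "\<bar>?b k\<bar> * ?a (n - k) \<le> \<bar>?b k\<bar> * (M * M2 * real n powr (t - 1))"
        by (intro mult_left_mono) (auto simp: mult.assoc)
      then show ?thesis using True n a0[of "n - k"] by (simp add: abs_mult divide_le_eq mult.assoc)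
    qed (use M0 in \<open>simp add: M2_def\<close>)
    then show "\<forall>\<^sub>F (k, n) in at_top \<times>\<^sub>F sequentially. norm (?f k n) \<le> \<bar>?b k\<bar> * (M * M2)"
      unfolding eventually_prod_filter
      by (intro exI[of _ "\<lambda>_. True"] exI[of _ "\<lambda>n::nat. n \<ge> 1"]) (auto intro: eventually_ge_at_top)
  qed (use b(1) in \<open>auto intro: summable_mult2\<close>)
  also have "(\<Sum>k. ?b k * (1 / Gamma t)) = exp (\<Sum>j. c j / real j) / Gamma t"
    using suminf_mult2[OF summable_rabs_cancel[OF b(1)], of "1 / Gamma t"] b(2) by simp
  finally have main: "(\<lambda>n. \<Sum>k. ?f k n) \<longlonglongrightarrow> exp (\<Sum>j. c j / real j) / Gamma t" .
  obtain B where B: "\<And>n. n \<ge> 1 \<Longrightarrow> (\<Sum>i\<le>n. ?a i) \<le> B * real n powr t"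
    using sum_cyc_total_const_bound[OF t] by blast
  \<comment> \<open>For 2 k > n the quotient of a_{n-k} and n^(t-1) has no uniform bound when t < 1.
    Instead b_k = o(1 / n) is used together with the bound O(n^t) for the sum of all a_i.\<close>
  define E where "E = (\<lambda>n. \<Sum>k | k \<le> n \<and> n < 2 * k. ?b k * ?a (n - k) / real n powr (t - 1))"
  have "E \<longlonglongrightarrow> 0"
  proof (rule LIMSEQ_I)
    fix r :: real assume r: "0 < r"
    define e where "e = r / (4 * (\<bar>B\<bar> + 1))"
    have e: "0 < e" using r by (simp add: e_def)
    from LIMSEQ_D[OF cyc_total_null[OF c c0 sm] e]
    obtain n0 where n0: "\<And>n. n \<ge> n0 \<Longrightarrow> \<bar>real n * ?b n\<bar> < e" by auto
    have "\<bar>E n\<bar> < r" if n: "n \<ge> max 1 (2 * n0)" for n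
    proof -
      have n1: "n \<ge> 1" using n by simp
      have "\<bar>E n\<bar> \<le> (\<Sum>k | k \<le> n \<and> n < 2 * k. (2 * e / real n) * (?a (n - k) / real n powr (t - 1)))"
        unfolding E_def
      proof (rule order_trans[OF sum_abs], rule sum_mono)
        fix k assume "k \<in> {k. k \<le> n \<and> n < 2 * k}"
        then have k: "k \<le> n" "n < 2 * k" by auto
        then have "\<bar>real k * ?b k\<bar> < e" using n by (intro n0) auto
        then have "real k * \<bar>?b k\<bar> \<le> e" by (simp add: abs_mult)
        then have "\<bar>?b k\<bar> \<le> e / real k" using k n1 by (simp add: field_simps)
        also have "\<dots> \<le> e / (real n / 2)" using k n1 e by (intro divide_left_mono) auto
        finally have "\<bar>?b k\<bar> \<le> 2 * e / real n" by (simp add: field_simps)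
        then have "\<bar>?b k\<bar> * (?a (n - k) / real n powr (t - 1)) \<le> (2 * e / real n) * (?a (n - k) / real n powr (t - 1))"
          using a0 by (intro mult_right_mono) auto
        then show "\<bar>?b k * ?a (n - k) / real n powr (t - 1)\<bar> \<le> (2 * e / real n) * (?a (n - k) / real n powr (t - 1))"
          using a0 by (simp add: abs_mult)
      qed
      also have "\<dots> \<le> (\<Sum>k\<le>n. (2 * e / real n) * (?a (n - k) / real n powr (t - 1)))"
        using e a0 by (intro sum_mono2) auto
      also have "\<dots> = 2 * e / real n * (\<Sum>k\<le>n. ?a (n - k)) / real n powr (t - 1)"
        by (simp add: sum_distrib_left sum_divide_distrib)
      also have "(\<Sum>k\<le>n. ?a (n - k)) = (\<Sum>k\<le>n. ?a k)"
        by (rule sum.reindex_bij_witness[of _ "\<lambda>k. n - k" "\<lambda>k. n - k"]) auto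
      also have "2 * e / real n * (\<Sum>k\<le>n. ?a k) / real n powr (t - 1) \<le> 2 * e / real n * (B * real n powr t) / real n powr (t - 1)"
        using e B[OF n1] by (intro divide_right_mono mult_left_mono) auto
      also have "\<dots> = 2 * e * B" using n1 by (simp add: powr_diff)
      also have "\<dots> \<le> 2 * e * (\<bar>B\<bar> + 1)" using e by (intro mult_left_mono) auto
      also have "\<dots> = r / 2" unfolding e_def by (simp add: field_simps)
      finally show ?thesis using r by linarith
    qed
    then show "\<exists>no. \<forall>n\<ge>no. norm (E n - 0) < r" by (auto intro!: exI[of _ "max 1 (2 * n0)"])
  qed
  from tendsto_add[OF main this]
  have "(\<lambda>n. (\<Sum>k. ?f k n) + E n) \<longlonglongrightarrow> exp (\<Sum>j. c j / real j) / Gamma t" by simp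
  moreover have "(\<Sum>k. ?f k n) + E n = cyc_total w n / real n powr (t - 1)" for n
  proof -
    have "(\<Sum>k. ?f k n) = (\<Sum>k\<le>n. ?f k n)"
      by (rule suminf_finite) auto
    also have "\<dots> = (\<Sum>k | k \<le> n \<and> 2 * k \<le> n. ?b k * ?a (n - k) / real n powr (t - 1))"
      by (rule sum.mono_neutral_cong_right) auto
    finally have "(\<Sum>k. ?f k n) + E n = (\<Sum>k\<in>{k. k \<le> n \<and> 2 * k \<le> n} \<union> {k. k \<le> n \<and> n < 2 * k}. ?b k * ?a (n - k) / real n powr (t - 1))"
      unfolding E_def by (subst sum.union_disjoint) auto
    also have "{k. k \<le> n \<and> 2 * k \<le> n} \<union> {k. k \<le> n \<and> n < 2 * k} = {..n}" by auto
    finally show ?thesis by (simp add: conv sum_divide_distrib)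
  qed
  ultimately show ?thesis by simp
qed

section \<open>The total length of the subcritical cycles\<close>

text \<open>The law of the total length of the cycles of weights \<open>N w\<^sub>j\<close> without conditioning: the total of a compound
  Poisson process with intensities \<open>N w\<^sub>j / j\<close>.\<close>
definition mass_law :: "(nat \<Rightarrow> real) \<Rightarrow> nat \<Rightarrow> nat \<Rightarrow> real" where
  "mass_law w N k = cyc_total (\<lambda>j. real N * w j) k * exp (- real N * (\<Sum>j. w j / real j))"

text \<open>In the application \<open>w j\<close> is \<kappa>_j R^j. Then \<open>\<mu>\<close> is
  the value of z g_\<kappa>'(z) at R, which is the mean of K / N, and 1 - \<mu> is the share left to
  the \<theta>-cycles.\<close>

locale cond_weights =
  fixes w :: "nat \<Rightarrow> real" and C \<mu> :: real
  assumes w_nonneg: "\<And>j. 0 \<le> w j" and w0: "w 0 = 0"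
    and w_le: "\<And>j. real j * w j \<le> C"
    and w_sums: "w sums \<mu>"
begin

lemma C_nonneg: "0 \<le> C" using w_le[of 0] by simp

lemma mu_nonneg: "0 \<le> \<mu>"
  using w_nonneg w_sums suminf_nonneg[of w] by (simp add: sums_iff)

lemma w_summable: "summable w" using w_sums by (rule sums_summable)

lemma w_le_C: "w j \<le> C"
proof (cases "j = 0")
  case False
  then have "1 * w j \<le> real j * w j" using w_nonneg by (intro mult_right_mono) auto
  then show ?thesis using w_le[of j] by simp
qed (simp add: w0 C_nonneg)

lemma div_le: "w j / real j \<le> w j"
proof (cases "j = 0")
  case False
  then have "w j / real j \<le> w j / 1" using w_nonneg by (intro divide_left_mono) auto
  then show ?thesis by simp
qed (simp add: w0)

lemma div_summable: "summable (\<lambda>j. w j / real j)"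
  by (rule summable_comparison_test'[OF w_summable, of 0]) (auto simp: w_nonneg div_le)

lemma mass_law_nonneg: "0 \<le> mass_law w N k"
  unfolding mass_law_def using w_nonneg by (intro mult_nonneg_nonneg cyc_total_nonneg) auto

lemma mass_law_generating_function:
  assumes r: "0 \<le> r" "r < 1"
  shows "(\<lambda>k. mass_law w N k * r ^ k) sums exp (real N * (\<Sum>j. w j / real j * (r ^ j - 1)))"
proof -
  let ?v = "\<lambda>j. real N * w j"
  have v: "\<bar>?v j\<bar> \<le> real N * C" for j using w_nonneg w_le_C by (simp add: abs_mult mult_left_mono)
  have "summable (\<lambda>k. cyc_total ?v k * r ^ k)"
    using cyc_total_summable_power[of ?v, OF v] r by (intro summable_rabs_cancel[of "\<lambda>k. cyc_total ?v k * r ^ k"]) auto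
  moreover have "(\<Sum>k. cyc_total ?v k * r ^ k) = exp (\<Sum>j. ?v j / real j * r ^ j)"
    by (rule cyc_total_generating_function[of ?v, OF v]) (use r w0 in auto)
  ultimately have "(\<lambda>k. cyc_total ?v k * r ^ k) sums exp (\<Sum>j. ?v j / real j * r ^ j)"
    by (simp add: sums_iff)
  from sums_mult2[OF this, of "exp (- real N * (\<Sum>j. w j / real j))"]
  have "(\<lambda>k. mass_law w N k * r ^ k) sums exp ((\<Sum>j. ?v j / real j * r ^ j) - real N * (\<Sum>j. w j / real j))"
    unfolding mass_law_def by (simp add: mult_ac exp_minus exp_diff divide_inverse)
  moreover have "(\<Sum>j. ?v j / real j * r ^ j) - real N * (\<Sum>j. w j / real j) = real N * (\<Sum>j. w j / real j * (r ^ j - 1))"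
  proof -
    have s: "summable (\<lambda>j. w j / real j * r ^ j)"
    proof (rule summable_comparison_test'[OF div_summable, of 0])
      show "norm (w j / real j * r ^ j) \<le> w j / real j" for j
        using mult_left_mono[OF power_le_one[of r j], of "w j / real j"] r w_nonneg by (simp add: abs_mult)
    qed
    have A1: "(\<Sum>j. ?v j / real j * r ^ j) = real N * (\<Sum>j. w j / real j * r ^ j)"
      using suminf_mult[OF s, of "real N"] by (simp add: mult_ac)
    have A2: "(\<Sum>j. w j / real j * r ^ j) - (\<Sum>j. w j / real j) = (\<Sum>j. w j / real j * (r ^ j - 1))"
      using suminf_diff[OF s div_summable] by (simp add: right_diff_distrib)
    show ?thesis unfolding A1 A2[symmetric] by (rule right_diff_distrib[symmetric])
  qed
  ultimately show ?thesis by simp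
qed

lemma mass_law_sums_1: "mass_law w N sums 1"
proof -
  let ?v = "\<lambda>j. real N * w j"
  have v: "\<bar>?v j\<bar> \<le> real N * C" for j using w_nonneg w_le_C by (simp add: abs_mult mult_left_mono)
  have sm: "summable (\<lambda>j. \<bar>?v j\<bar> / real j)"
    using summable_mult[OF div_summable, of "real N"] w_nonneg by (simp add: abs_mult)
  have "(\<Sum>j. ?v j / real j) = real N * (\<Sum>j. w j / real j)"
    using suminf_mult[OF div_summable, of "real N"] by simp
  then have "cyc_total ?v sums exp (real N * (\<Sum>j. w j / real j))"
    using cyc_total_sums[of ?v, OF v _ sm] w0 by (auto simp: sums_iff dest: summable_rabs_cancel)
  from sums_mult2[OF this, of "exp (- real N * (\<Sum>j. w j / real j))"]
  show ?thesis unfolding mass_law_def by (simp add: exp_minus)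
qed

text \<open>The exponent converges term by term to - l w_j and is dominated by l w_j because 1 - exp
  (- x) \<le> x. Only summability of \<open>w\<close> enters, so an infinite variance of K does no
  harm.\<close>

lemma mass_law_laplace:
  assumes l: "0 < l"
  shows "(\<lambda>N. \<Sum>k. mass_law w N k * exp (- l / real N) ^ k) \<longlonglongrightarrow> exp (- l * \<mu>)"
proof -
  let ?f = "\<lambda>j N. w j / real j * (real N * (exp (- l / real N) ^ j - 1))"
  have "(\<lambda>N. \<Sum>j. ?f j N) \<longlonglongrightarrow> (\<Sum>j. w j * (- l))"
  proof (rule tannerys_theorem[of ?f "\<lambda>j. w j * (- l)" sequentially "\<lambda>j. w j * l", THEN conjunct2, THEN conjunct2])
    fix j
    show "(\<lambda>N. ?f j N) \<longlonglongrightarrow> w j * (- l)"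
    proof (cases "j = 0")
      case False
      have "(\<lambda>N. real N * (exp (- l / real N * real j) - 1)) \<longlonglongrightarrow> - l * real j"
        using l by real_asymp
      then have "(\<lambda>N. w j / real j * (real N * (exp (- l / real N * real j) - 1))) \<longlonglongrightarrow> w j / real j * (- l * real j)"
        by (rule tendsto_mult_left)
      then have "(\<lambda>N. ?f j N) \<longlonglongrightarrow> w j / real j * (- l * real j)" by (simp only: exp_of_nat2_mult)
      then show ?thesis using False by simp
    qed (simp add: w0)
    have "norm (?f j N) \<le> w j * l" for j N
    proof (cases "j = 0 \<or> N = 0")
      case True
      then show ?thesis using w_nonneg l by auto
    next
      case False
      have "1 + - l / real N * real j \<le> exp (- l / real N * real j)" by (rule exp_ge_add_one_self)
      then have "1 - exp (- l / real N * real j) \<le> l * real j / real N" by (simp add: field_simps)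
      moreover have "exp (- l / real N * real j) \<le> 1" using l by simp
      ultimately have "\<bar>exp (- l / real N * real j) - 1\<bar> \<le> l * real j / real N" by simp
      then have "w j / real j * (real N * \<bar>exp (- l / real N * real j) - 1\<bar>) \<le> w j / real j * (real N * (l * real j / real N))"
        using w_nonneg by (intro mult_left_mono) auto
      then have "w j / real j * (real N * \<bar>exp (- l / real N) ^ j - 1\<bar>) \<le> w j / real j * (real N * (l * real j / real N))"
        by (simp only: exp_of_nat2_mult)
      then show ?thesis using False w_nonneg by (simp add: abs_mult)
    qed
    then show "\<forall>\<^sub>F (k, n) in at_top \<times>\<^sub>F sequentially. norm (?f k n) \<le> w k * l"
      by (intro always_eventually) auto
  qed (use w_summable in \<open>auto intro: summable_mult2\<close>)
  also have "(\<Sum>j. w j * (- l)) = - l * \<mu>"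
    using sums_mult2[OF w_sums, of "- l"] by (simp add: sums_iff mult.commute)
  finally have "(\<lambda>N. exp (\<Sum>j. ?f j N)) \<longlonglongrightarrow> exp (- l * \<mu>)" by (intro tendsto_exp)
  moreover have "eventually (\<lambda>N. exp (\<Sum>j. ?f j N) = (\<Sum>k. mass_law w N k * exp (- l / real N) ^ k)) sequentially"
    using eventually_gt_at_top[of 0]
  proof eventually_elim
    case (elim N)
    let ?r = "exp (- l / real N)"
    have r: "0 \<le> ?r" "?r < 1" using elim l by auto
    have "summable (\<lambda>j. w j / real j * (?r ^ j - 1))"
    proof (rule summable_comparison_test'[OF div_summable, of 0])
      fix j :: nat
      have "\<bar>?r ^ j - 1\<bar> \<le> 1" using r power_le_one[of ?r j] by (simp add: abs_le_iff)
      then have "w j / real j * \<bar>?r ^ j - 1\<bar> \<le> w j / real j * 1" using w_nonneg by (intro mult_left_mono) auto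
      then show "norm (w j / real j * (?r ^ j - 1)) \<le> w j / real j" using w_nonneg by (simp add: abs_mult)
    qed
    from suminf_mult[OF this, of "real N"]
    have "(\<Sum>j. ?f j N) = real N * (\<Sum>j. w j / real j * (?r ^ j - 1))" by (simp add: mult_ac)
    then show ?case using mass_law_generating_function[OF r, of N] by (simp add: sums_iff)
  qed
  ultimately show ?thesis by (rule Lim_transform_eventually)
qed

text \<open>Chebyshev's inequality for \<open>exp (- K / N)\<close>, whose moments stay bounded, in place of \<open>K\<close>,
  whose variance may be infinite.\<close>
lemma mass_law_concentration:
  assumes e: "0 < e"
  shows "(\<lambda>N. \<Sum>k. mass_law w N k * of_bool (e < \<bar>real k / real N - \<mu>\<bar>)) \<longlonglongrightarrow> 0"
proof -
  define v where "v = exp (- \<mu>)"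
  \<comment> \<open>The smaller of the distances from v = exp (- \<mu>) to exp (- \<mu> - e) and exp
    (- \<mu> + e): a deviation of K / N by more than e moves exp (- K / N) away from v by at least
    d.\<close>
  define d where "d = min (v - v * exp (- e)) (v * exp e - v)"
  have d: "0 < d" using e by (auto simp: d_def v_def)
  define U where "U = (\<lambda>N k. exp (- 1 / real N) ^ k)"
  have U2: "U N k ^ 2 = exp (- 2 / real N) ^ k" for N k
  proof -
    have "exp (- 1 / real N) ^ 2 = exp (- 2 / real N)" by (simp add: exp_double[symmetric])
    then show ?thesis unfolding U_def by (metis power_mult mult.commute)
  qed
  \<comment> \<open>The second moment of exp (- K / N) - v, multiplied out; the Laplace limits at 2
    and 1 make it tend to v^2 - 2 v^2 + v^2 = 0.\<close>
  define V where "V = (\<lambda>N. (\<Sum>k. mass_law w N k * exp (- 2 / real N) ^ k) - 2 * v * (\<Sum>k. mass_law w N k * exp (- 1 / real N) ^ k) + v ^ 2)"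
  have "V \<longlonglongrightarrow> exp (- 2 * \<mu>) - 2 * v * exp (- 1 * \<mu>) + v ^ 2"
    unfolding V_def by (intro tendsto_intros mass_law_laplace) auto
  also have "exp (- 2 * \<mu>) - 2 * v * exp (- 1 * \<mu>) + v ^ 2 = 0"
  proof -
    have "exp (- 2 * \<mu>) = v ^ 2" unfolding v_def by (simp add: exp_double[symmetric])
    then show ?thesis by (simp add: v_def power2_eq_square)
  qed
  finally have V0: "(\<lambda>N. V N / d ^ 2) \<longlonglongrightarrow> 0" by (auto intro: tendsto_divide_zero)
  show ?thesis
  proof (rule tendsto_sandwich[OF _ _ tendsto_const V0])
    have sp: "summable (mass_law w N)" for N using mass_law_sums_1 by (rule sums_summable)
    have si: "summable (\<lambda>k. mass_law w N k * of_bool (e < \<bar>real k / real N - \<mu>\<bar>))" for N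
      by (rule summable_comparison_test'[OF sp, of 0]) (auto simp: mass_law_nonneg)
    show "\<forall>\<^sub>F N in sequentially. 0 \<le> (\<Sum>k. mass_law w N k * of_bool (e < \<bar>real k / real N - \<mu>\<bar>))"
      by (intro always_eventually allI suminf_nonneg si) (simp add: mass_law_nonneg)
    show "\<forall>\<^sub>F N in sequentially. (\<Sum>k. mass_law w N k * of_bool (e < \<bar>real k / real N - \<mu>\<bar>)) \<le> V N / d ^ 2"
      using eventually_gt_at_top[of 0]
    proof eventually_elim
      case (elim N)
      have s1: "summable (\<lambda>k. mass_law w N k * exp (- 1 / real N) ^ k)"
        using mass_law_generating_function[of "exp (- 1 / real N)" N] elim by (auto dest: sums_summable)
      have s2: "summable (\<lambda>k. mass_law w N k * exp (- 2 / real N) ^ k)"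
        using mass_law_generating_function[of "exp (- 2 / real N)" N] elim by (auto dest: sums_summable)
      have "(\<lambda>k. mass_law w N k * exp (- 2 / real N) ^ k - 2 * v * (mass_law w N k * exp (- 1 / real N) ^ k) + v ^ 2 * mass_law w N k)
        sums ((\<Sum>k. mass_law w N k * exp (- 2 / real N) ^ k) - 2 * v * (\<Sum>k. mass_law w N k * exp (- 1 / real N) ^ k) + v ^ 2 * 1)"
        by (intro sums_add sums_diff sums_mult summable_sums s1 s2 mass_law_sums_1)
      moreover have "(\<lambda>k. mass_law w N k * exp (- 2 / real N) ^ k - 2 * v * (mass_law w N k * exp (- 1 / real N) ^ k) + v ^ 2 * mass_law w N k)
         = (\<lambda>k. mass_law w N k * (U N k - v) ^ 2)"
        unfolding power2_diff U2 by (intro ext) (simp add: U_def algebra_simps)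
      ultimately have sV: "(\<lambda>k. mass_law w N k * (U N k - v) ^ 2) sums V N" by (simp add: V_def)
      have pt: "of_bool (e < \<bar>real k / real N - \<mu>\<bar>) \<le> (U N k - v) ^ 2 / d ^ 2" for k
      proof (cases "e < \<bar>real k / real N - \<mu>\<bar>")
        case True
        have Ue: "U N k = exp (- (real k / real N))" unfolding U_def by (simp flip: exp_of_nat2_mult)
        have "d \<le> \<bar>U N k - v\<bar>"
        proof (cases "real k / real N > \<mu>")
          case True2: True
          then have "U N k \<le> exp (- \<mu> + - e)" using True unfolding Ue by simp
          then have "U N k \<le> v * exp (- e)" by (simp only: exp_add v_def)
          then show ?thesis unfolding d_def by linarith
        next
          case False
          then have "exp (- \<mu> + e) \<le> U N k" using True unfolding Ue by simp
          then have "v * exp e \<le> U N k" by (simp only: exp_add v_def)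
          then show ?thesis unfolding d_def by linarith
        qed
        then have "d ^ 2 \<le> (U N k - v) ^ 2" using d by (simp add: abs_le_square_iff[symmetric])
        then show ?thesis using d by simp
      qed simp
      have "(\<Sum>k. mass_law w N k * of_bool (e < \<bar>real k / real N - \<mu>\<bar>)) \<le> (\<Sum>k. mass_law w N k * (U N k - v) ^ 2 / d ^ 2)"
      proof (rule suminf_le[OF _ si])
        show "mass_law w N k * of_bool (e < \<bar>real k / real N - \<mu>\<bar>) \<le> mass_law w N k * (U N k - v) ^ 2 / d ^ 2" for k
          using mult_left_mono[OF pt[of k] mass_law_nonneg[of N k]] by simp
        show "summable (\<lambda>k. mass_law w N k * (U N k - v) ^ 2 / d ^ 2)"
          using sV by (intro summable_divide sums_summable)
      qed
      also have "\<dots> = V N / d ^ 2" using sums_divide[OF sV, of "d ^ 2"] by (simp add: sums_iff)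
      finally show ?case .
    qed
  qed
qed

lemma mass_law_rec: "real k * mass_law w N k = real N * (\<Sum>j\<in>{1..k}. w j * mass_law w N (k - j))"
proof -
  have "real k * mass_law w N k = (real k * cyc_total (\<lambda>j. real N * w j) k) * exp (- real N * (\<Sum>j. w j / real j))"
    by (simp add: mass_law_def)
  then show ?thesis
    unfolding cyc_total_rec by (simp add: mass_law_def sum_distrib_left sum_distrib_right mult_ac)
qed

lemma sum_mass_law_le_1: "finite A \<Longrightarrow> sum (mass_law w N) A \<le> 1"
  using sum_le_suminf[of "mass_law w N" A] mass_law_sums_1[of N] mass_law_nonneg by (simp add: sums_iff)

text \<open>Above its mean the law of \<open>K\<close> has local probabilities of order \<open>1 / N\<close>: the bound \<open>D / (k - a N)\<close>
  is a supersolution of the recursion \<open>mass_law_rec\<close>.\<close>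
lemma mass_law_local_bound:
  assumes a: "\<mu> < a"
  shows "\<exists>D\<ge>0. \<forall>N k. N \<ge> 1 \<longrightarrow> a * real N < real k \<longrightarrow> mass_law w N k \<le> D / (real k - a * real N)"
proof -
  have a0: "0 < a" using a mu_nonneg by simp
  \<comment> \<open>Chosen so that a (1 - \<tau>) is the midpoint of a and \<mu>, still above \<mu>;
    hence \<rho> < 1.\<close>
  define \<tau> where "\<tau> = (1 - \<mu> / a) / 2"
  have \<tau>: "0 < \<tau>" "\<tau> < 1" using a a0 mu_nonneg by (auto simp: \<tau>_def field_simps)
  define \<rho> where "\<rho> = \<mu> / (a * (1 - \<tau>))"
  have h: "a * (1 - \<tau>) = (a + \<mu>) / 2" using a0 by (simp add: \<tau>_def field_simps)
  have \<rho>: "0 \<le> \<rho>" "\<rho> < 1" unfolding \<rho>_def h using a a0 mu_nonneg by (auto simp: field_simps)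
  \<comment> \<open>The solution of D = \<rho> D + C / (a \<tau>), the equation under which the
    bound reproduces itself in the recursion.\<close>
  define D where "D = C / (a * \<tau>) / (1 - \<rho>)"
  have D0: "0 \<le> D" using C_nonneg a0 \<tau> \<rho> by (simp add: D_def)
  have D: "\<rho> * D + C / (a * \<tau>) = D"
  proof -
    have "D * (1 - \<rho>) = C / (a * \<tau>)" using \<rho> by (simp add: D_def)
    then show ?thesis by (simp add: algebra_simps)
  qed
  have "mass_law w N k \<le> D / (real k - a * real N)" if N: "N \<ge> 1" and "a * real N < real k" for N k
    using that(2)
  proof (induction k rule: less_induct)
    case (less k)
    define x where "x = real k - a * real N"
    have x: "0 < x" using less.prems by (simp add: x_def)
    have "0 < a * real N" using N a0 by simp
    then have k0: "0 < real k" using less.prems by linarith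
    \<comment> \<open>Short jumps j \<le> \<tau> x keep k - j above a N by at least (1 - \<tau>) x,
      so the induction hypothesis applies. Long jumps have weight at most C / (\<tau> x) and are
      charged to the total mass 1 of the law.\<close>
    have "w j * mass_law w N (k - j) \<le> w j * (D / ((1 - \<tau>) * x)) + C / (\<tau> * x) * mass_law w N (k - j)"
      if j: "j \<in> {1..k}" for j
    proof (cases "real j \<le> \<tau> * x")
      case True
      have "(1 - \<tau>) * x \<le> real (k - j) - a * real N"
        using True j by (simp add: x_def of_nat_diff algebra_simps)
      moreover have "0 < (1 - \<tau>) * x" using x \<tau> by simp
      ultimately have "mass_law w N (k - j) \<le> D / (real (k - j) - a * real N)"
        using j by (intro less.IH) auto
      also have "\<dots> \<le> D / ((1 - \<tau>) * x)"
        using \<open>0 < (1 - \<tau>) * x\<close> \<open>(1 - \<tau>) * x \<le> _\<close> D0 by (intro frac_le) auto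
      finally have "w j * mass_law w N (k - j) \<le> w j * (D / ((1 - \<tau>) * x))"
        using w_nonneg by (intro mult_left_mono)
      moreover have "0 \<le> C / (\<tau> * x) * mass_law w N (k - j)"
        using C_nonneg \<tau> x mass_law_nonneg by simp
      ultimately show ?thesis by linarith
    next
      case False
      have "w j \<le> C / real j" using w_le[of j] j by (simp add: field_simps)
      also have "\<dots> \<le> C / (\<tau> * x)"
        using False C_nonneg \<tau> x j by (intro divide_left_mono mult_pos_pos) auto
      finally have "w j * mass_law w N (k - j) \<le> C / (\<tau> * x) * mass_law w N (k - j)"
        using mass_law_nonneg by (intro mult_right_mono)
      moreover have "0 \<le> w j * (D / ((1 - \<tau>) * x))"
        using w_nonneg D0 \<tau> x by simp
      ultimately show ?thesis by linarith
    qed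
    then have "(\<Sum>j\<in>{1..k}. w j * mass_law w N (k - j)) \<le>
      (\<Sum>j\<in>{1..k}. w j * (D / ((1 - \<tau>) * x)) + C / (\<tau> * x) * mass_law w N (k - j))"
      by (rule sum_mono)
    also have "\<dots> = (\<Sum>j\<in>{1..k}. w j) * (D / ((1 - \<tau>) * x)) + C / (\<tau> * x) * (\<Sum>j\<in>{1..k}. mass_law w N (k - j))"
      by (simp only: sum.distrib sum_distrib_left sum_distrib_right)
    also have "\<dots> \<le> \<mu> * (D / ((1 - \<tau>) * x)) + C / (\<tau> * x) * 1"
    proof (intro add_mono mult_right_mono mult_left_mono)
      show "(\<Sum>j\<in>{1..k}. w j) \<le> \<mu>"
        using sum_le_suminf[OF w_summable, of "{1..k}"] w_nonneg w_sums by (simp add: sums_iff)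
      have "(\<Sum>j\<in>{1..k}. mass_law w N (k - j)) = sum (mass_law w N) {..<k}"
        by (rule sum.reindex_bij_witness[of _ "\<lambda>i. k - i" "\<lambda>j. k - j"]) auto
      then show "(\<Sum>j\<in>{1..k}. mass_law w N (k - j)) \<le> 1" using sum_mass_law_le_1 by simp
    qed (use D0 C_nonneg \<tau> x in auto)
    finally have S: "(\<Sum>j\<in>{1..k}. w j * mass_law w N (k - j)) \<le> \<mu> * (D / ((1 - \<tau>) * x)) + C / (\<tau> * x) * 1" .
    have Nk: "real N / real k \<le> 1 / a" using less.prems a0 k0 by (simp add: field_simps)
    have "mass_law w N k = real N / real k * (\<Sum>j\<in>{1..k}. w j * mass_law w N (k - j))"
      using mass_law_rec[of k N] k0 by (simp add: field_simps)
    also have "\<dots> \<le> 1 / a * (\<mu> * (D / ((1 - \<tau>) * x)) + C / (\<tau> * x) * 1)"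
      using Nk S w_nonneg mass_law_nonneg a0 by (intro mult_mono sum_nonneg) auto
    also have "\<dots> = (\<rho> * D + C / (a * \<tau>)) / x"
      unfolding \<rho>_def using a0 \<tau> x by (simp add: field_simps)
    also have "\<dots> = D / x" by (simp only: D)
    finally show ?case by (simp only: x_def)
  qed
  then show ?thesis using D0 by blast
qed

end

section \<open>Conditioning the \<kappa>-mass on total length N\<close>

locale mixed_weights = cond_weights +
  fixes q :: "nat \<Rightarrow> real" and t A :: real
  assumes t: "0 < t" and A: "0 < A" and q_nonneg: "\<And>n. 0 \<le> q n"
    and q_asymp: "(\<lambda>n. q n / real n powr (t - 1)) \<longlonglongrightarrow> A"
    and mu_less: "\<mu> < 1" and w_null: "(\<lambda>j. real j * w j) \<longlonglongrightarrow> 0"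
begin

lemma q_upper: "\<exists>B\<ge>0. \<forall>n\<ge>1. q n \<le> B * real n powr (t - 1)"
proof -
  obtain B where B: "\<And>n. \<bar>q n / real n powr (t - 1)\<bar> \<le> B"
    using convergent_imp_Bseq[of "\<lambda>n. q n / real n powr (t - 1)"] q_asymp by (auto simp: convergent_def Bseq_def)
  have "q n \<le> B * real n powr (t - 1)" if "n \<ge> 1" for n
    using abs_le_D1[OF B[of n]] that by (simp add: divide_le_eq)
  moreover have "0 \<le> B" using order_trans[OF abs_ge_zero B] .
  ultimately show ?thesis by blast
qed

lemma q_lower: "eventually (\<lambda>n. A / 2 * real n powr (t - 1) \<le> q n) sequentially"
proof -
  have "eventually (\<lambda>n. A / 2 < q n / real n powr (t - 1)) sequentially"
    using A by (intro order_tendstoD[OF q_asymp]) auto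
  then show ?thesis using eventually_gt_at_top[of 0]
    by eventually_elim (simp add: less_divide_eq)
qed

text \<open>q is compared with the coefficients of (1 - z)^(-t), whose partial sums are explicit; no
  estimate for sums of real powers is required, and n = 0 needs no separate treatment.\<close>

lemma q_sum_upper: "\<exists>B\<ge>0. \<forall>n\<ge>1. (\<Sum>i\<le>n. q i) \<le> B * real n powr t"
proof -
  let ?a = "cyc_total (\<lambda>_. t)"
  have a: "0 < ?a n" for n
    unfolding cyc_total_const using t by (intro divide_pos_pos pochhammer_pos) auto
  have "(\<lambda>n. (q n / real n powr (t - 1)) / (?a n / real n powr (t - 1))) \<longlonglongrightarrow> A / (1 / Gamma t)"
    using Gamma_real_pos[OF t] by (intro tendsto_divide q_asymp cyc_total_const_asymp t) auto
  then have "(\<lambda>n. q n / ?a n) \<longlonglongrightarrow> A / (1 / Gamma t)"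
    by (rule Lim_transform_eventually) (use eventually_gt_at_top[of 0] in eventually_elim, simp)
  then obtain B1 where B1: "\<And>n. \<bar>q n / ?a n\<bar> \<le> B1"
    using convergent_imp_Bseq[of "\<lambda>n. q n / ?a n"] by (auto simp: convergent_def Bseq_def)
  have B10: "0 \<le> B1" using order_trans[OF abs_ge_zero B1] .
  have qa: "q n \<le> B1 * ?a n" for n using abs_le_D1[OF B1[of n]] a[of n] by (simp add: divide_le_eq)
  obtain B2 where B2: "\<And>n. n \<ge> 1 \<Longrightarrow> (\<Sum>i\<le>n. ?a i) \<le> B2 * real n powr t"
    using sum_cyc_total_const_bound[OF t] by blast
  have "(\<Sum>i\<le>n. q i) \<le> B1 * \<bar>B2\<bar> * real n powr t" if "n \<ge> 1" for n
  proof -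
    have "(\<Sum>i\<le>n. q i) \<le> B1 * (\<Sum>i\<le>n. ?a i)"
      unfolding sum_distrib_left by (intro sum_mono qa)
    also have "\<dots> \<le> B1 * (\<bar>B2\<bar> * real n powr t)"
      using B10 by (intro mult_left_mono order_trans[OF B2[OF that]] mult_right_mono) auto
    finally show ?thesis by (simp add: mult.assoc)
  qed
  then show ?thesis using B10 by (intro exI[of _ "B1 * \<bar>B2\<bar>"]) auto
qed

text \<open>Up to normalisation the probability that the cycles of both colours together have total length \<open>n\<close>.\<close>
definition Z :: "nat \<Rightarrow> nat \<Rightarrow> real" where
  "Z N n = (\<Sum>k\<le>n. mass_law w N k * q (n - k))"

lemma Z_nonneg: "0 \<le> Z N n"
  unfolding Z_def by (intro sum_nonneg mult_nonneg_nonneg mass_law_nonneg q_nonneg)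

text \<open>The typical values of K alone already contribute the order N^(t-1): they carry at least
  half of the mass and leave a number of points proportional to N.\<close>

lemma Z_lower: "\<exists>c>0. eventually (\<lambda>N. c * real N powr (t - 1) \<le> Z N N) sequentially"
proof -
  \<comment> \<open>With this choice \<mu> + e = 1 - e, so a typical K leaves at least e N
    points.\<close>
  define e where "e = (1 - \<mu>) / 2"
  have e: "0 < e" "e \<le> 1" using mu_less mu_nonneg by (auto simp: e_def)
  define m where "m = min 1 (e powr (t - 1))"
  have m: "0 < m" using e by (simp add: m_def)
  define b where "b = (\<lambda>N k. of_bool (e < \<bar>real k / real N - \<mu>\<bar>) :: real)"
  obtain n0 where n0: "\<And>n. n \<ge> n0 \<Longrightarrow> A / 2 * real n powr (t - 1) \<le> q n"
    using q_lower unfolding eventually_sequentially by blast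
  have "eventually (\<lambda>N. (\<Sum>k. mass_law w N k * b N k) < 1 / 2) sequentially"
    using order_tendstoD(2)[OF mass_law_concentration[OF e(1)], of "1/2"] unfolding b_def by simp
  moreover have "eventually (\<lambda>N. real n0 \<le> e * real N) sequentially"
    using e by real_asymp
  moreover have "eventually (\<lambda>N::nat. N > 0) sequentially" by (rule eventually_gt_at_top)
  ultimately have "eventually (\<lambda>N. A / 2 * m / 2 * real N powr (t - 1) \<le> Z N N) sequentially"
  proof eventually_elim
    case (elim N)
    let ?R = "real N powr (t - 1)"
    have sb: "summable (\<lambda>k. mass_law w N k * b N k)"
      by (rule summable_comparison_test'[OF sums_summable[OF mass_law_sums_1[of N]], of 0])
         (auto simp: mass_law_nonneg b_def)
    have "(\<lambda>k. mass_law w N k - mass_law w N k * b N k) sums (1 - (\<Sum>k. mass_law w N k * b N k))"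
      by (intro sums_diff mass_law_sums_1 summable_sums sb)
    \<comment> \<open>All k > N deviate from \<mu> N by more than e N, so the series of typical
      terms is in fact the finite sum up to N.\<close>
    moreover have "(\<lambda>k. mass_law w N k - mass_law w N k * b N k) sums (\<Sum>k\<le>N. mass_law w N k - mass_law w N k * b N k)"
    proof (rule sums_finite)
      fix k assume "k \<notin> {..N}"
      then have "real k / real N > 1" using elim(3) by simp
      moreover have "e < x - \<mu>" if "1 < x" for x using that mu_less unfolding e_def by (simp add: field_simps)
      ultimately have "e < real k / real N - \<mu>" by blast
      then have "b N k = 1" unfolding b_def by simp
      then show "mass_law w N k - mass_law w N k * b N k = 0" by simp
    qed simp
    ultimately have half: "1 / 2 \<le> (\<Sum>k\<le>N. mass_law w N k - mass_law w N k * b N k)"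
      using elim(1) sums_unique2 by fastforce
    have "A / 2 * m * ?R * (mass_law w N k - mass_law w N k * b N k) \<le> mass_law w N k * q (N - k)" if k: "k \<le> N" for k
    proof (cases "e < \<bar>real k / real N - \<mu>\<bar>")
      case True
      then show ?thesis using mass_law_nonneg q_nonneg by (simp add: b_def)
    next
      case False
      then have "real k / real N \<le> \<mu> + e" by (simp add: abs_le_iff not_less)
      then have "real k / real N \<le> 1 - e" by (simp add: e_def field_simps)
      then have l: "e * real N \<le> real (N - k)" using elim(3) k by (simp add: of_nat_diff field_simps)
      then have "n0 \<le> N - k" using elim(2) by linarith
      then have "A / 2 * real (N - k) powr (t - 1) \<le> q (N - k)" by (rule n0)
      moreover have "m * ?R \<le> real (N - k) powr (t - 1)"
        unfolding m_def using e l elim(3) by (intro powr_le_powr_between(2)) auto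
      ultimately have "A / 2 * (m * ?R) \<le> q (N - k)"
        using A by (meson mult_left_mono order_trans less_imp_le half_gt_zero)
      then have "(A / 2 * (m * ?R)) * mass_law w N k \<le> q (N - k) * mass_law w N k" by (rule mult_right_mono) (rule mass_law_nonneg)
      then show ?thesis using False by (simp add: b_def mult_ac)
    qed
    then have "A / 2 * m * ?R * (\<Sum>k\<le>N. mass_law w N k - mass_law w N k * b N k) \<le> Z N N"
      unfolding Z_def sum_distrib_left by (intro sum_mono) auto
    moreover have "A / 2 * m * ?R * (1 / 2) \<le> A / 2 * m * ?R * (\<Sum>k\<le>N. mass_law w N k - mass_law w N k * b N k)"
      using half A m by (intro mult_left_mono) auto
    ultimately show ?case by simp
  qed
  then show ?thesis using A m by (intro exI[of _ "A / 2 * m / 2"]) auto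
qed

lemma eventually_Z_pos: "eventually (\<lambda>N. 0 < Z N N) sequentially"
proof -
  obtain c where c: "c > 0" "eventually (\<lambda>N. c * real N powr (t - 1) \<le> Z N N) sequentially"
    using Z_lower by blast
  from c(2) eventually_gt_at_top[of 0] show ?thesis
  proof eventually_elim
    case (elim N)
    then have "0 < c * real N powr (t - 1)" using c(1) by simp
    then show ?case using elim(1) by linarith
  qed
qed

lemma tendsto_div_Z:
  assumes f: "\<And>N. 0 \<le> f N"
    and small: "\<And>r. 0 < r \<Longrightarrow> eventually (\<lambda>N. f N \<le> r * real N powr (t - 1)) sequentially"
  shows "(\<lambda>N. f N / Z N N) \<longlonglongrightarrow> 0"
proof (rule order_tendstoI)
  obtain c where c: "c > 0" "eventually (\<lambda>N. c * real N powr (t - 1) \<le> Z N N) sequentially"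
    using Z_lower by blast
  fix r :: real assume r: "0 < r"
  have "eventually (\<lambda>N. f N \<le> (r * c / 2) * real N powr (t - 1)) sequentially"
    using r c by (intro small) auto
  with c(2) eventually_Z_pos eventually_gt_at_top[of 0]
  show "eventually (\<lambda>N. f N / Z N N < r) sequentially"
  proof eventually_elim
    case (elim N)
    have "f N \<le> r / 2 * (c * real N powr (t - 1))" using elim(4) by (simp add: mult_ac)
    also have "\<dots> \<le> r / 2 * Z N N" using elim(1) r by (intro mult_left_mono) auto
    also have "\<dots> < r * Z N N" using elim(2) r by simp
    finally show ?case using elim(2) by (simp add: divide_less_eq)
  qed
next
  fix r :: real assume r: "r < 0"
  then show "eventually (\<lambda>N. r < f N / Z N N) sequentially"
    by (intro always_eventually allI less_le_trans[OF r] divide_nonneg_nonneg f Z_nonneg)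
qed

text \<open>Away from k = N the factor q (N - k) is of order at most N^(t-1) and the unconditioned
  law of large numbers applies. Near k = N it may be larger when t < 1; there the bound O(1 / N) for
  \<open>mass_law\<close> is summed against q over the last h N indices, which gives at most a
  multiple of h^t N^(t-1).\<close>

lemma Z_concentration:
  assumes e: "0 < e"
  shows "(\<lambda>N. (\<Sum>k\<le>N. mass_law w N k * q (N - k) * of_bool (e < \<bar>real k / real N - \<mu>\<bar>)) / Z N N) \<longlonglongrightarrow> 0"
proof (rule tendsto_div_Z)
  show "0 \<le> (\<Sum>k\<le>N. mass_law w N k * q (N - k) * of_bool (e < \<bar>real k / real N - \<mu>\<bar>))" for N
    by (intro sum_nonneg mult_nonneg_nonneg mass_law_nonneg q_nonneg) auto
  fix r :: real assume r: "0 < r"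
  define a where "a = (1 + \<mu>) / 2"
  have a: "\<mu> < a" "a < 1" using mu_less by (auto simp: a_def)
  obtain D where D0: "D \<ge> 0" and D: "\<And>N k. N \<ge> 1 \<Longrightarrow> a * real N < real k \<Longrightarrow> mass_law w N k \<le> D / (real k - a * real N)"
    using mass_law_local_bound[OF a(1)] by blast
  obtain B where B0: "B \<ge> 0" and B: "\<And>n. n \<ge> 1 \<Longrightarrow> q n \<le> B * real n powr (t - 1)"
    using q_upper by blast
  obtain B' where B'0: "B' \<ge> 0" and B': "\<And>n. n \<ge> 1 \<Longrightarrow> (\<Sum>i\<le>n. q i) \<le> B' * real n powr t"
    using q_sum_upper by blast
  define K where "K = 2 * D / (1 - a) * B' + 1"
  have K: "0 < K" using D0 a B'0 by (simp add: K_def add_nonneg_pos)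
  \<comment> \<open>The first entry keeps k - a N \<ge> (1 - a) N / 2 for the last h N indices, so
    the local bound is of order 1 / N there; the second makes their contribution at most r / 2 times
    N^(t-1).\<close>
  define h where "h = min ((1 - a) / 2) ((r / (2 * K)) powr (1 / t))"
  have h2: "h \<le> (1 - a) / 2" unfolding h_def by (rule min.cobounded1)
  have h: "0 < h" "h \<le> (1 - a) / 2" "h \<le> 1" using a r K mu_nonneg h2 by (auto simp: h_def)
  have ht: "h powr t \<le> r / (2 * K)"
  proof -
    have "h powr t \<le> ((r / (2 * K)) powr (1 / t)) powr t"
      using h t by (intro powr_mono2) (auto simp: h_def)
    also have "\<dots> = r / (2 * K)" using t r K by (simp add: powr_powr)
    finally show ?thesis .
  qed
  define M where "M = max 1 (h powr (t - 1))"
  have M: "1 \<le> M" by (simp add: M_def)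
  define b where "b = (\<lambda>N k. of_bool (e < \<bar>real k / real N - \<mu>\<bar>) :: real)"
  have "eventually (\<lambda>N. (\<Sum>k. mass_law w N k * b N k) < r / (2 * (B * M + 1))) sequentially"
    using r B0 M unfolding b_def
    by (intro order_tendstoD(2)[OF mass_law_concentration[OF e]] divide_pos_pos mult_pos_pos add_nonneg_pos) auto
  moreover have "eventually (\<lambda>N. 1 \<le> h * real N) sequentially" using h by real_asymp
  moreover have "eventually (\<lambda>N::nat. N \<ge> 1) sequentially" by (rule eventually_ge_at_top)
  ultimately show "eventually (\<lambda>N. (\<Sum>k\<le>N. mass_law w N k * q (N - k) * of_bool (e < \<bar>real k / real N - \<mu>\<bar>)) \<le> r * real N powr (t - 1)) sequentially"
  proof eventually_elim
    case (elim N)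
    let ?R = "real N powr (t - 1)"
    define L where "L = nat \<lfloor>h * real N\<rfloor>"
    have L: "1 \<le> L" "real L \<le> h * real N" "h * real N < real L + 1"
      using elim(2) by (auto simp: L_def le_nat_iff)
    have LN: "L \<le> N" using L(2) h elim(3) mult_right_mono[OF h(3), of "real N"] by linarith
    let ?P = "2 * D / (1 - a) / real N"
    have P0: "0 \<le> ?P" using D0 a by simp
    have pt: "mass_law w N k * q (N - k) * b N k \<le> ?P * (q (N - k) * of_bool (N - k \<le> L)) + B * M * ?R * (mass_law w N k * b N k)"
      if k: "k \<le> N" for k
    proof (cases "N - k \<le> L")
      case True
      then have "real N - real k \<le> h * real N" using L(2) k by linarith
      also have "\<dots> \<le> (1 - a) / 2 * real N" using h by (intro mult_right_mono) auto
      finally have gap: "(1 - a) / 2 * real N \<le> real k - a * real N" by (simp add: field_simps)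
      moreover have pos: "0 < (1 - a) / 2 * real N" using a elim(3) by simp
      ultimately have "mass_law w N k \<le> D / (real k - a * real N)" using elim(3) by (intro D) auto
      also have "\<dots> \<le> D / ((1 - a) / 2 * real N)" using gap pos D0 by (intro frac_le) auto
      also have "\<dots> = ?P" by simp
      finally have "mass_law w N k * (q (N - k) * b N k) \<le> ?P * (q (N - k) * b N k)"
        using q_nonneg by (intro mult_right_mono) (auto simp: b_def)
      also have "\<dots> \<le> ?P * q (N - k)" using P0 q_nonneg by (intro mult_left_mono) (auto simp: b_def)
      finally show ?thesis using True B0 M mass_law_nonneg
        by (auto simp: b_def mult.assoc intro!: add_increasing2 mult_nonneg_nonneg)
    next
      case False
      then have l: "h * real N \<le> real (N - k)" using L(3) by linarith
      have "q (N - k) \<le> B * real (N - k) powr (t - 1)" using False L by (intro B) auto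
      also have "real (N - k) powr (t - 1) \<le> M * ?R"
        unfolding M_def using h l elim(3) by (intro powr_le_powr_between(1)) auto
      finally have "q (N - k) \<le> B * M * ?R" using B0 by (simp add: mult.assoc mult_left_mono)
      then have "q (N - k) * (mass_law w N k * b N k) \<le> B * M * ?R * (mass_law w N k * b N k)"
        using mass_law_nonneg by (intro mult_right_mono) (auto simp: b_def)
      then show ?thesis using False by (simp add: mult_ac)
    qed
    have "(\<Sum>k\<le>N. mass_law w N k * q (N - k) * b N k) \<le>
      (\<Sum>k\<le>N. ?P * (q (N - k) * of_bool (N - k \<le> L)) + B * M * ?R * (mass_law w N k * b N k))"
      by (intro sum_mono pt) auto
    also have "\<dots> = ?P * (\<Sum>k\<le>N. q (N - k) * of_bool (N - k \<le> L)) + B * M * ?R * (\<Sum>k\<le>N. mass_law w N k * b N k)"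
      by (simp only: sum.distrib sum_distrib_left)
    also have "(\<Sum>k\<le>N. q (N - k) * of_bool (N - k \<le> L)) = (\<Sum>i\<le>N. q i * of_bool (i \<le> L))"
      by (rule sum.reindex_bij_witness[of _ "\<lambda>i. N - i" "\<lambda>k. N - k"]) auto
    also have "\<dots> = (\<Sum>i\<le>L. q i)" using LN by (intro sum.mono_neutral_cong_right) auto
    also have "?P * (\<Sum>i\<le>L. q i) \<le> ?P * (B' * (h * real N) powr t)"
      using P0 B'0 L t by (intro mult_left_mono order_trans[OF B'[OF L(1)]] powr_mono2) auto
    also have "?P * (B' * (h * real N) powr t) = (2 * D / (1 - a) * B') * h powr t * ?R"
      using h elim(3) by (simp add: powr_mult powr_diff)
    also have "\<dots> \<le> K * (r / (2 * K)) * ?R"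
      using ht D0 B'0 a K by (intro mult_right_mono mult_mono) (auto simp: K_def)
    also have "K * (r / (2 * K)) = r / 2" using K by simp
    also have "B * M * ?R * (\<Sum>k\<le>N. mass_law w N k * b N k) \<le> B * M * ?R * (r / (2 * (B * M + 1)))"
    proof (rule mult_left_mono)
      have "(\<Sum>k\<le>N. mass_law w N k * b N k) \<le> (\<Sum>k. mass_law w N k * b N k)"
      proof (rule sum_le_suminf)
        show "summable (\<lambda>k. mass_law w N k * b N k)"
          by (rule summable_comparison_test'[OF sums_summable[OF mass_law_sums_1[of N]], of 0])
             (auto simp: mass_law_nonneg b_def)
      qed (auto simp: mass_law_nonneg b_def)
      then show "(\<Sum>k\<le>N. mass_law w N k * b N k) \<le> r / (2 * (B * M + 1))" using elim(1) by linarith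
    qed (use B0 M in auto)
    also have "\<dots> = (B * M) / (B * M + 1) * (r / 2) * ?R" by (simp add: field_simps)
    also have "\<dots> \<le> 1 * (r / 2) * ?R"
    proof (intro mult_right_mono)
      have "0 \<le> B * M" using B0 M by simp
      then show "B * M / (B * M + 1) \<le> 1" by (simp add: divide_le_eq)
    qed (use r in auto)
    finally show ?case unfolding b_def by (simp add: algebra_simps)
  qed
qed

text \<open>Summation over n integrates out K, whose law has total mass 1.\<close>

lemma sum_Z_le: "(\<Sum>n\<le>N. Z M n) \<le> (\<Sum>i\<le>N. q i)"
proof -
  have "(\<Sum>n\<le>N. Z M n) = (\<Sum>(i,j)\<in>{(i,j). i + j \<le> N}. mass_law w M i * q j)"
    unfolding Z_def by (rule sum.triangle_reindex_eq[symmetric])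
  also have "\<dots> \<le> (\<Sum>(i,j)\<in>{..N} \<times> {..N}. mass_law w M i * q j)"
    by (rule sum_mono2) (auto intro!: mult_nonneg_nonneg mass_law_nonneg q_nonneg)
  also have "\<dots> = (\<Sum>i\<le>N. mass_law w M i) * (\<Sum>j\<le>N. q j)"
    by (simp add: sum_product sum.cartesian_product)
  also have "\<dots> \<le> 1 * (\<Sum>j\<le>N. q j)"
    by (intro mult_right_mono sum_mass_law_le_1 sum_nonneg q_nonneg) auto
  finally show ?thesis by simp
qed

text \<open>Up to normalisation the sum is the mean number of \<kappa>-cycles longer than e N, so
  this is a first-moment bound. As j w_j tends to 0, N w_j / j is o(1 / N) uniformly in this range,
  and the Z N (N - j) add up to O(N^t).\<close>

lemma large_cycles_negligible:
  assumes e: "0 < e"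
  shows "(\<lambda>N. (\<Sum>j\<in>{1..N}. of_bool (e * real N < real j) * (real N * w j) / real j * Z N (N - j)) / Z N N) \<longlonglongrightarrow> 0"
proof (rule tendsto_div_Z)
  show "0 \<le> (\<Sum>j\<in>{1..N}. of_bool (e * real N < real j) * (real N * w j) / real j * Z N (N - j))" for N
    by (intro sum_nonneg mult_nonneg_nonneg divide_nonneg_nonneg Z_nonneg w_nonneg) auto
  fix r :: real assume r: "0 < r"
  obtain B' where B'0: "B' \<ge> 0" and B': "\<And>n. n \<ge> 1 \<Longrightarrow> (\<Sum>i\<le>n. q i) \<le> B' * real n powr t"
    using q_sum_upper by blast
  define d where "d = r * e\<^sup>2 / (B' + 1)"
  have d: "0 < d" using r e B'0 by (simp add: d_def add_nonneg_pos)
  obtain j0 where j0: "\<And>j. j \<ge> j0 \<Longrightarrow> real j * w j < d"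
    using order_tendstoD(2)[OF w_null d] unfolding eventually_sequentially by blast
  have "eventually (\<lambda>N. real j0 \<le> e * real N) sequentially" using e by real_asymp
  moreover have "eventually (\<lambda>N::nat. N \<ge> 1) sequentially" by (rule eventually_ge_at_top)
  ultimately show "eventually (\<lambda>N. (\<Sum>j\<in>{1..N}. of_bool (e * real N < real j) * (real N * w j) / real j * Z N (N - j)) \<le> r * real N powr (t - 1)) sequentially"
  proof eventually_elim
    case (elim N)
    have "of_bool (e * real N < real j) * (real N * w j) / real j * Z N (N - j) \<le> d / (e\<^sup>2 * real N) * Z N (N - j)"
      if j: "j \<in> {1..N}" for j
    proof (rule mult_right_mono[OF _ Z_nonneg])
      show "of_bool (e * real N < real j) * (real N * w j) / real j \<le> d / (e\<^sup>2 * real N)"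
      proof (cases "e * real N < real j")
        case True
        then have "real j * w j \<le> d" using elim(1) by (intro less_imp_le[OF j0]) linarith
        then have "(real N * w j) / real j \<le> real N * d / (real j * real j)"
          using j by (simp add: field_simps mult_left_mono)
        also have "\<dots> \<le> real N * d / ((e * real N) * (e * real N))"
          using True e elim(2) d j by (intro divide_left_mono mult_mono mult_pos_pos) auto
        also have "\<dots> = d / (e\<^sup>2 * real N)" using elim(2) by (simp add: power2_eq_square)
        finally show ?thesis using True by simp
      qed (use d in auto)
    qed
    then have "(\<Sum>j\<in>{1..N}. of_bool (e * real N < real j) * (real N * w j) / real j * Z N (N - j)) \<le>
       (\<Sum>j\<in>{1..N}. d / (e\<^sup>2 * real N) * Z N (N - j))" by (rule sum_mono)
    also have "\<dots> = d / (e\<^sup>2 * real N) * (\<Sum>n<N. Z N n)"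
      unfolding sum_distrib_left by (rule sum.reindex_bij_witness[of _ "\<lambda>n. N - n" "\<lambda>j. N - j"]) auto
    also have "\<dots> \<le> d / (e\<^sup>2 * real N) * (B' * real N powr t)"
    proof (rule mult_left_mono)
      have "(\<Sum>n<N. Z N n) \<le> (\<Sum>n\<le>N. Z N n)" by (intro sum_mono2 Z_nonneg) auto
      also have "\<dots> \<le> B' * real N powr t" using sum_Z_le B'[OF elim(2)] by (rule order_trans)
      finally show "(\<Sum>n<N. Z N n) \<le> B' * real N powr t" .
    qed (use d in auto)
    also have "d / (e\<^sup>2 * real N) * (B' * real N powr t) = r * (B' / (B' + 1)) * real N powr (t - 1)"
      using e elim(2) by (simp add: d_def powr_diff)
    also have "\<dots> \<le> r * 1 * real N powr (t - 1)"
      using r B'0 by (intro mult_right_mono mult_left_mono) auto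
    finally show ?case by simp
  qed
qed

end

section \<open>Decreasing rearrangements\<close>

text \<open>The right-hand side involves no cardinality of a level set that may be infinite: it
  compares single entries with t, which suits both Lipschitz estimates and measurability.\<close>

lemma finite_card_le_iff:
  "finite {n. t < Y n} \<and> card {n. t < Y n} \<le> i \<longleftrightarrow> (\<forall>F\<in>{F. finite F \<and> card F = Suc i}. \<exists>n\<in>F. Y n \<le> (t :: real))"
  for Y :: "nat \<Rightarrow> real"
proof
  assume *: "finite {n. t < Y n} \<and> card {n. t < Y n} \<le> i"
  show "\<forall>F\<in>{F. finite F \<and> card F = Suc i}. \<exists>n\<in>F. Y n \<le> t"
  proof (rule ballI, rule ccontr)
    fix F assume F: "F \<in> {F. finite F \<and> card F = Suc i}" and "\<not> (\<exists>n\<in>F. Y n \<le> t)"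
    then have "F \<subseteq> {n. t < Y n}" by (auto simp: not_le)
    then have "card F \<le> card {n. t < Y n}" using * by (intro card_mono) auto
    then show False using F * by auto
  qed
next
  assume *: "\<forall>F\<in>{F. finite F \<and> card F = Suc i}. \<exists>n\<in>F. Y n \<le> t"
  show "finite {n. t < Y n} \<and> card {n. t < Y n} \<le> i"
  proof (rule ccontr)
    assume "\<not> ?thesis"
    then have "infinite {n. t < Y n} \<or> Suc i \<le> card {n. t < Y n}" by auto
    then obtain F where "F \<subseteq> {n. t < Y n}" "finite F" "card F = Suc i"
      by (metis infinite_arbitrarily_large obtain_subset_with_card_n)
    then show False using * by fastforce
  qed
qed

definition rearr_levels :: "(nat \<Rightarrow> real) \<Rightarrow> nat \<Rightarrow> real set" where
  "rearr_levels Y i = {t. 0 \<le> t \<and> (\<forall>F\<in>{F. finite F \<and> card F = Suc i}. \<exists>n\<in>F. Y n \<le> t)}"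

lemma dec_rearr_eq_Inf: "dec_rearr Y i = Inf (rearr_levels Y i)"
  unfolding dec_rearr_def rearr_levels_def finite_card_le_iff ..

lemma rearr_levels_up: "t \<in> rearr_levels Y i \<Longrightarrow> t \<le> t' \<Longrightarrow> t' \<in> rearr_levels Y i"
  unfolding rearr_levels_def by (auto intro: order_trans) (meson order_trans)

lemma rearr_levels_nonempty:
  assumes "bdd_above (range Y)"
  shows "rearr_levels Y i \<noteq> {}"
proof -
  obtain b where b: "\<And>n. Y n \<le> b" using assms by (auto simp: bdd_above_def)
  have "\<exists>n\<in>F. Y n \<le> max 0 b" if "card F = Suc i" for F
  proof -
    have "F \<noteq> {}" using that by auto
    then show ?thesis using b by (auto simp: le_max_iff_disj)
  qed
  then have "max 0 b \<in> rearr_levels Y i" unfolding rearr_levels_def by simp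
  then show ?thesis by auto
qed

text \<open>The infimum is attained, since finitely many values above t all stay above some larger
  level, here the midpoint of t and their minimum. Nonemptiness excludes the unspecified
  \<open>Inf {}\<close>.\<close>

lemma dec_rearr_le_iff:
  assumes "rearr_levels Y i \<noteq> {}"
  shows "dec_rearr Y i \<le> t \<longleftrightarrow> t \<in> rearr_levels Y i"
proof
  have bdd: "bdd_below (rearr_levels Y i)" by (rule bdd_belowI[of _ 0]) (simp add: rearr_levels_def)
  show "t \<in> rearr_levels Y i \<Longrightarrow> dec_rearr Y i \<le> t"
    unfolding dec_rearr_eq_Inf using bdd by (rule cInf_lower[rotated])
  assume le: "dec_rearr Y i \<le> t"
  have above: "t' \<in> rearr_levels Y i" if "t < t'" for t'
    using le that cInf_lessD[OF assms, of t'] rearr_levels_up[of _ Y i t'] unfolding dec_rearr_eq_Inf by fastforce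
  have "0 \<le> dec_rearr Y i"
    unfolding dec_rearr_eq_Inf using assms by (rule cInf_greatest) (simp add: rearr_levels_def)
  then have "0 \<le> t" using le by simp
  moreover have "\<exists>n\<in>F. Y n \<le> t" if F: "finite F" "card F = Suc i" for F
  proof (rule ccontr)
    assume no: "\<not> (\<exists>n\<in>F. Y n \<le> t)"
    have ne: "F \<noteq> {}" using F by auto
    define m where "m = Min (Y ` F)"
    have "m \<in> Y ` F" unfolding m_def using F ne by (intro Min_in) auto
    then have "t < m" using no by auto
    then have "(t + m) / 2 \<in> rearr_levels Y i" by (intro above) simp
    then obtain n where n: "n \<in> F" "Y n \<le> (t + m) / 2" using F unfolding rearr_levels_def by auto
    have "m \<le> Y n" unfolding m_def using F n by (intro Min_le) auto
    then show False using n \<open>t < m\<close> by simp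
  qed
  ultimately show "t \<in> rearr_levels Y i" unfolding rearr_levels_def by simp
qed

text \<open>Raising an admissible level of one sequence by d makes it admissible for the
  other.\<close>

lemma dec_rearr_lipschitz:
  assumes Y: "bdd_above (range Y)" and Y': "bdd_above (range Y')" and d: "\<And>n. \<bar>Y n - Y' n\<bar> \<le> d"
  shows "\<bar>dec_rearr Y i - dec_rearr Y' i\<bar> \<le> d"
proof -
  have one: "dec_rearr X i \<le> dec_rearr X' i + d"
    if X: "bdd_above (range X)" and X': "bdd_above (range X')" and dd: "\<And>n. \<bar>X n - X' n\<bar> \<le> d" for X X' :: "nat \<Rightarrow> real"
  proof -
    let ?t = "dec_rearr X' i"
    have "?t \<in> rearr_levels X' i"
      using dec_rearr_le_iff[OF rearr_levels_nonempty[OF X'], of i ?t] by simp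
    then have t: "0 \<le> ?t" "\<forall>F\<in>{F. finite F \<and> card F = Suc i}. \<exists>n\<in>F. X' n \<le> ?t"
      unfolding rearr_levels_def by auto
    have "X n \<le> ?t + d" if "X' n \<le> ?t" for n using dd[of n] that by linarith
    then have "\<forall>F\<in>{F. finite F \<and> card F = Suc i}. \<exists>n\<in>F. X n \<le> ?t + d" using t(2) by blast
    moreover have "0 \<le> ?t + d" using t(1) order_trans[OF abs_ge_zero dd[of 0]] by simp
    ultimately have "?t + d \<in> rearr_levels X i" unfolding rearr_levels_def by simp
    then show ?thesis using dec_rearr_le_iff[OF rearr_levels_nonempty[OF X]] by simp
  qed
  have "\<bar>Y' n - Y n\<bar> \<le> d" for n using d[of n] by (simp add: abs_minus_commute)
  then show ?thesis using one[OF Y Y' d] one[OF Y' Y] by (simp add: abs_le_iff)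
qed

lemma measurable_dec_rearr [measurable]:
  "(\<lambda>Y. dec_rearr Y i) \<in> borel_measurable (Pi\<^sub>M UNIV (\<lambda>_. borel))"
proof (subst borel_measurable_iff_le, intro allI)
  fix a :: real
  let ?M = "Pi\<^sub>M UNIV (\<lambda>_. borel) :: (nat \<Rightarrow> real) measure"
  have pred: "Measurable.pred ?M (\<lambda>Y. t \<in> rearr_levels Y i)" for t
  proof -
    have A: "Measurable.pred ?M (\<lambda>Y. \<exists>n\<in>F. Y n \<le> t)" if "finite F" for F
      using that by (intro pred_intros_finite) measurable
    \<comment> \<open>Finite index sets are enumerated by lists, which form a countable
      type.\<close>
    have "Measurable.pred ?M (\<lambda>Y. \<forall>xs::nat list. card (set xs) = Suc i \<longrightarrow> (\<exists>n\<in>set xs. Y n \<le> t))"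
      by (intro pred_intros_countable pred_intros_imp' A) auto
    also have "(\<lambda>Y. \<forall>xs::nat list. card (set xs) = Suc i \<longrightarrow> (\<exists>n\<in>set xs. Y n \<le> t)) =
      (\<lambda>Y. \<forall>F\<in>{F. finite F \<and> card F = Suc i}. \<exists>n\<in>F. Y n \<le> t)"
      using finite_list by (intro ext) (blast intro: List.finite_set)
    finally have "Measurable.pred ?M (\<lambda>Y. \<forall>F\<in>{F. finite F \<and> card F = Suc i}. \<exists>n\<in>F. Y n \<le> t)" .
    then show ?thesis unfolding rearr_levels_def mem_Collect_eq by measurable
  qed
  have ex: "(\<exists>m::nat. real m \<in> rearr_levels Y i) \<longleftrightarrow> rearr_levels Y i \<noteq> {}" for Y
    using rearr_levels_up real_arch_simple by (metis ex_in_conv)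
  \<comment> \<open>Sequences without any admissible level have the constant value
    \<open>Inf {}\<close>. Levels are closed upwards, so their existence can be tested at natural
    numbers, a countable condition.\<close>
  have "Measurable.pred ?M (\<lambda>Y. ((\<exists>m::nat. real m \<in> rearr_levels Y i) \<and> a \<in> rearr_levels Y i) \<or>
      (\<not> (\<exists>m::nat. real m \<in> rearr_levels Y i) \<and> Inf {} \<le> a))"
    using pred by (intro pred_intros_logic pred_intros_countable) auto
  also have "(\<lambda>Y. ((\<exists>m::nat. real m \<in> rearr_levels Y i) \<and> a \<in> rearr_levels Y i) \<or>
      (\<not> (\<exists>m::nat. real m \<in> rearr_levels Y i) \<and> Inf {} \<le> a)) = (\<lambda>Y. dec_rearr Y i \<le> a)"
    unfolding ex using dec_rearr_le_iff by (intro ext) (metis dec_rearr_eq_Inf)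
  finally show "{Y \<in> space ?M. dec_rearr Y i \<le> a} \<in> sets ?M" by simp
qed

definition pad :: "real list \<Rightarrow> nat \<Rightarrow> real" where
  "pad zs n = (if n < length zs then zs ! n else 0)"

lemma bdd_above_pad: "bdd_above (range (pad zs))"
proof -
  have "pad zs n \<le> Max (insert 0 (set zs))" for n
    unfolding pad_def by (intro Max_ge) auto
  then show ?thesis by (rule bdd_aboveI2)
qed

text \<open>Levels are nonnegative, so padding zeros never count as larger and only the multiset of
  entries matters.\<close>

lemma dec_rearr_pad_cong:
  assumes "mset zs = mset zs'"
  shows "dec_rearr (pad zs) = dec_rearr (pad zs')"
proof -
  have *: "{n. t < pad zs n} = {n. n < length zs \<and> t < zs ! n}" if "0 \<le> t" for t zs
    using that by (auto simp: pad_def split: if_splits)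
  have "card {n. t < pad zs n} = card {n. t < pad zs' n} \<and> finite {n. t < pad zs n} \<and> finite {n. t < pad zs' n}"
    if "0 \<le> t" for t
    unfolding *[OF that]
    using arg_cong[OF assms, of "\<lambda>M. size (filter_mset (\<lambda>x. t < x) M)"]
    by (simp flip: mset_filter add: length_filter_conv_card)
  then show ?thesis unfolding dec_rearr_def by (intro ext arg_cong[where f = Inf]) auto
qed

lemma dec_rearr_antimono:
  assumes Y: "antimono Y" "\<And>n. 0 \<le> Y n"
  shows "dec_rearr Y i = Y i"
proof -
  have "{t. 0 \<le> t \<and> finite {n. t < Y n} \<and> card {n. t < Y n} \<le> i} = {Y i..}"
  proof (intro set_eqI iffI)
    fix t assume t: "t \<in> {t. 0 \<le> t \<and> finite {n. t < Y n} \<and> card {n. t < Y n} \<le> i}"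
    show "t \<in> {Y i..}"
    proof (rule ccontr)
      assume "t \<notin> {Y i..}"
      then have "{..i} \<subseteq> {n. t < Y n}" using antimonoD[OF Y(1), of _ i] by (force simp: not_le)
      then have "card {..i} \<le> card {n. t < Y n}" using t by (intro card_mono) auto
      then show False using t by simp
    qed
  next
    fix t assume t: "t \<in> {Y i..}"
    have "{n. t < Y n} \<subseteq> {..<i}"
    proof
      fix n assume "n \<in> {n. t < Y n}"
      then have "Y i < Y n" using t by auto
      then show "n \<in> {..<i}" using Y(1) by (metis antimonoD lessThan_iff not_le)
    qed
    then have "finite {n. t < Y n}" "card {n. t < Y n} \<le> i"
      using finite_subset[of _ "{..<i}"] card_mono[of "{..<i}"] by auto
    then show "t \<in> {t. 0 \<le> t \<and> finite {n. t < Y n} \<and> card {n. t < Y n} \<le> i}" using t Y(2)[of i] by auto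
  qed
  then show ?thesis unfolding dec_rearr_def by simp
qed

lemma ord_cycle_lengths_eq_dec_rearr:
  assumes c: "0 < c" and xs: "mset xs = cyc_type {1..N} \<sigma>"
  shows "real (ord_cycle_lengths N \<sigma> i) / c = dec_rearr (pad (map (\<lambda>x. real x / c) xs)) i"
proof -
  define ys where "ys = rev (sorted_list_of_multiset (cyc_type {1..N} \<sigma>))"
  have ys: "mset ys = mset xs" by (simp add: ys_def xs)
  have sorted: "sorted (rev ys)" by (simp add: ys_def)
  have "antimono (pad (map (\<lambda>x. real x / c) ys))"
  proof (rule antimonoI)
    fix m n :: nat assume mn: "m \<le> n"
    show "pad (map (\<lambda>x. real x / c) ys) n \<le> pad (map (\<lambda>x. real x / c) ys) m"
      using mn c sorted by (auto simp: pad_def sorted_rev_iff_nth_mono divide_right_mono)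
  qed
  moreover have "0 \<le> pad (map (\<lambda>x. real x / c) ys) n" for n using c by (simp add: pad_def)
  ultimately have "dec_rearr (pad (map (\<lambda>x. real x / c) ys)) i = pad (map (\<lambda>x. real x / c) ys) i"
    by (rule dec_rearr_antimono)
  also have "\<dots> = real (ord_cycle_lengths N \<sigma> i) / c"
    by (simp add: pad_def ord_cycle_lengths_def ys_def cyc_type_def cycles_of_def Let_def)
  finally have "dec_rearr (pad (map (\<lambda>x. real x / c) ys)) i = real (ord_cycle_lengths N \<sigma> i) / c" .
  moreover have "dec_rearr (pad (map (\<lambda>x. real x / c) ys)) = dec_rearr (pad (map (\<lambda>x. real x / c) xs))"
    using ys by (intro dec_rearr_pad_cong) (simp only: mset_map)
  ultimately show ?thesis by simp
qed

text \<open>With the small entries placed behind the others they replace padding zeros, and each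
  coordinate moves by at most d.\<close>

lemma dec_rearr_append_small:
  assumes "\<And>x. x \<in> set xs \<Longrightarrow> 0 \<le> x \<and> x \<le> d" "0 \<le> d"
  shows "\<bar>dec_rearr (pad (ys @ xs)) i - dec_rearr (pad ys) i\<bar> \<le> d"
  using assms by (intro dec_rearr_lipschitz bdd_above_pad) (auto simp: pad_def nth_append)

section \<open>Size-biased cycle lengths and stick breaking\<close>

text \<open>Total mass at most 1 instead of exactly 1: the zero sequence, the base point of all
  bounds and the image of the empty permutation, must belong to it.\<close>

definition subprob :: "(nat \<Rightarrow> real) set" where
  "subprob = {y. (\<forall>n. 0 \<le> y n) \<and> summable y \<and> suminf y \<le> 1}"

definition l1_dist :: "(nat \<Rightarrow> real) \<Rightarrow> (nat \<Rightarrow> real) \<Rightarrow> real" where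
  "l1_dist y y' = (\<Sum>n. \<bar>y n - y' n\<bar>)"

text \<open>The Lipschitz condition is confined to \<open>subprob\<close>, where
  \<open>l1_dist\<close> is a convergent series; measurability is required on all sequences because
  the integrals below range over them.\<close>

definition lip_fun :: "real \<Rightarrow> ((nat \<Rightarrow> real) \<Rightarrow> real) \<Rightarrow> bool" where
  "lip_fun L \<Phi> \<longleftrightarrow> \<Phi> \<in> borel_measurable (Pi\<^sub>M UNIV (\<lambda>_. borel)) \<and>
     (\<forall>y\<in>subprob. \<forall>y'\<in>subprob. \<bar>\<Phi> y - \<Phi> y'\<bar> \<le> L * l1_dist y y')"

definition stick_cons :: "real \<Rightarrow> (nat \<Rightarrow> real) \<Rightarrow> nat \<Rightarrow> real" where
  "stick_cons x y = case_nat x (\<lambda>n. (1 - x) * y n)"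

lemma stick_cons_simps [simp]: "stick_cons x y 0 = x" "stick_cons x y (Suc n) = (1 - x) * y n"
  by (simp_all add: stick_cons_def)

lemma subprob_summable_diff:
  assumes "y \<in> subprob" "y' \<in> subprob"
  shows "summable (\<lambda>n. \<bar>y n - y' n\<bar>)"
proof (rule summable_comparison_test'[where N = 0])
  show "summable (\<lambda>n. y n + y' n)" using assms by (auto simp: subprob_def intro: summable_add)
  show "norm \<bar>y n - y' n\<bar> \<le> y n + y' n" for n using assms by (auto simp: subprob_def abs_le_iff)
qed

lemma subprob_stick_cons:
  assumes x: "0 \<le> x" "x \<le> 1" and y: "y \<in> subprob"
  shows "stick_cons x y \<in> subprob"
proof -
  have "(\<lambda>n. stick_cons x y (Suc n)) sums ((1 - x) * suminf y)"
    using y by (auto simp: subprob_def intro: sums_mult)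
  then have s: "stick_cons x y sums ((1 - x) * suminf y + x)" using sums_Suc[of "stick_cons x y"] by simp
  have "(1 - x) * suminf y \<le> (1 - x) * 1" using x y by (intro mult_left_mono) (auto simp: subprob_def)
  moreover have "0 \<le> stick_cons x y n" for n using x y by (cases n) (auto simp: subprob_def)
  ultimately show ?thesis using s by (simp add: subprob_def sums_iff)
qed

lemma zero_subprob: "(\<lambda>_. 0) \<in> subprob" by (simp add: subprob_def)

lemma l1_dist_zero: "y \<in> subprob \<Longrightarrow> l1_dist y (\<lambda>_. 0) \<le> 1" by (simp add: subprob_def l1_dist_def)

lemma l1_dist_stick_cons:
  assumes x: "x \<le> 1" and y: "y \<in> subprob" "y' \<in> subprob"
  shows "l1_dist (stick_cons x y) (stick_cons x y') = (1 - x) * l1_dist y y'"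
proof -
  have "(\<lambda>n. \<bar>stick_cons x y (Suc n) - stick_cons x y' (Suc n)\<bar>) = (\<lambda>n. (1 - x) * \<bar>y n - y' n\<bar>)"
    using x by (intro ext) (simp add: abs_mult flip: right_diff_distrib)
  moreover have "(\<lambda>n. (1 - x) * \<bar>y n - y' n\<bar>) sums ((1 - x) * l1_dist y y')"
    unfolding l1_dist_def by (intro sums_mult summable_sums subprob_summable_diff y)
  ultimately have "(\<lambda>n. \<bar>stick_cons x y n - stick_cons x y' n\<bar>) sums ((1 - x) * l1_dist y y')"
    using sums_Suc[of "\<lambda>n. \<bar>stick_cons x y n - stick_cons x y' n\<bar>"] by simp
  then show ?thesis unfolding l1_dist_def by (simp add: sums_iff)
qed

text \<open>One |x - x'| comes from the first coordinate, the other from rescaling a tail of mass at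
  most 1.\<close>

lemma l1_dist_stick_cons_arg:
  assumes y: "y \<in> subprob"
  shows "l1_dist (stick_cons x y) (stick_cons x' y) \<le> 2 * \<bar>x - x'\<bar>"
proof -
  have "\<bar>(1 - x) * y n - (1 - x') * y n\<bar> = \<bar>x - x'\<bar> * y n" for n
  proof -
    have "(1 - x) * y n - (1 - x') * y n = (x' - x) * y n" by (simp add: algebra_simps)
    then show ?thesis using y by (simp add: abs_mult subprob_def abs_minus_commute)
  qed
  then have "(\<lambda>n. \<bar>stick_cons x y (Suc n) - stick_cons x' y (Suc n)\<bar>) sums (\<bar>x - x'\<bar> * suminf y)"
    using y by (auto simp: subprob_def intro: sums_mult)
  then have "(\<lambda>n. \<bar>stick_cons x y n - stick_cons x' y n\<bar>) sums (\<bar>x - x'\<bar> * suminf y + \<bar>x - x'\<bar>)"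
    using sums_Suc[of "\<lambda>n. \<bar>stick_cons x y n - stick_cons x' y n\<bar>"] by simp
  moreover have "\<bar>x - x'\<bar> * suminf y \<le> \<bar>x - x'\<bar> * 1"
    using y by (intro mult_left_mono) (auto simp: subprob_def)
  ultimately show ?thesis unfolding l1_dist_def by (simp add: sums_iff)
qed

lemma lip_funD: "lip_fun L \<Phi> \<Longrightarrow> y \<in> subprob \<Longrightarrow> y' \<in> subprob \<Longrightarrow> \<bar>\<Phi> y - \<Phi> y'\<bar> \<le> L * l1_dist y y'"
  by (simp add: lip_fun_def)

lemma lip_fun_bound:
  assumes "lip_fun L \<Phi>" "0 \<le> L" "y \<in> subprob"
  shows "\<bar>\<Phi> y - \<Phi> (\<lambda>_. 0)\<bar> \<le> L"
proof -
  have "L * l1_dist y (\<lambda>_. 0) \<le> L * 1" using assms by (intro mult_left_mono l1_dist_zero)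
  then show ?thesis using lip_funD[OF assms(1,3) zero_subprob] by simp
qed

lemma measurable_stick_cons:
  assumes "f \<in> borel_measurable M" and "g \<in> measurable M (Pi\<^sub>M UNIV (\<lambda>_. borel))"
  shows "(\<lambda>z. stick_cons (f z) (g z)) \<in> measurable M (Pi\<^sub>M UNIV (\<lambda>_. borel))"
proof (rule measurable_PiM_single')
  note assms[measurable]
  have [measurable]: "(\<lambda>z. g z n) \<in> borel_measurable M" for n
    using measurable_compose[OF assms(2) measurable_component_singleton[of n UNIV]] by simp
  show "(\<lambda>z. stick_cons (f z) (g z) n) \<in> borel_measurable M" for n by (cases n) simp_all
qed simp_all

text \<open>The factor 1 - x is the source of the contraction.\<close>

lemma lip_fun_stick_cons:
  assumes \<Phi>: "lip_fun L \<Phi>" and x: "0 \<le> x" "x \<le> 1"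
  shows "lip_fun (L * (1 - x)) (\<lambda>y. \<Phi> (stick_cons x y))"
  unfolding lip_fun_def
proof (intro conjI ballI)
  have "(\<lambda>y. stick_cons x y) \<in> measurable (Pi\<^sub>M UNIV (\<lambda>_. borel)) (Pi\<^sub>M UNIV (\<lambda>_. borel))"
    by (rule measurable_stick_cons[of "\<lambda>_. x" _ "\<lambda>y. y"]) auto
  then show "(\<lambda>y. \<Phi> (stick_cons x y)) \<in> borel_measurable (Pi\<^sub>M UNIV (\<lambda>_. borel))"
    using \<Phi> by (auto simp: lip_fun_def intro: measurable_compose)
  fix y y' assume y: "y \<in> subprob" "y' \<in> subprob"
  show "\<bar>\<Phi> (stick_cons x y) - \<Phi> (stick_cons x y')\<bar> \<le> L * (1 - x) * l1_dist y y'"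
    using lip_funD[OF \<Phi> subprob_stick_cons[OF x y(1)] subprob_stick_cons[OF x y(2)]] l1_dist_stick_cons[OF x(2) y] by (simp add: mult.assoc)
qed

lemma pad_subprob:
  assumes "\<And>z. z \<in> set zs \<Longrightarrow> 0 \<le> z" "sum_list zs \<le> 1"
  shows "pad zs \<in> subprob"
proof -
  have "pad zs sums (\<Sum>n<length zs. pad zs n)" by (rule sums_finite) (auto simp: pad_def)
  also have "(\<Sum>n<length zs. pad zs n) = sum_list zs"
    by (simp add: sum_list_sum_nth pad_def atLeast0LessThan)
  finally have "pad zs sums sum_list zs" .
  moreover have "0 \<le> pad zs n" for n using assms(1) by (simp add: pad_def)
  ultimately show ?thesis using assms(2) by (simp add: subprob_def sums_iff)
qed

lemma pad_Cons: "pad (z # zs) = case_nat z (pad zs)"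
  by (auto simp: pad_def fun_eq_iff split: nat.split)

definition scaled :: "nat \<Rightarrow> nat list \<Rightarrow> nat \<Rightarrow> real" where
  "scaled m xs = pad (map (\<lambda>x. real x / real m) xs)"

lemma scaled_subprob: "sum_list xs = m \<Longrightarrow> scaled m xs \<in> subprob"
proof -
  assume "sum_list xs = m"
  moreover have "sum_list (map (\<lambda>x. real x / real m) xs) = real (sum_list xs) / real m"
    by (induction xs) (auto simp: add_divide_distrib)
  ultimately show ?thesis unfolding scaled_def by (intro pad_subprob) auto
qed

lemma scaled_Cons:
  assumes "sum_list xs = m - j" "\<forall>x\<in>set xs. 0 < x" "j \<le> m" "0 < m"
  shows "scaled m (j # xs) = stick_cons (real j / real m) (scaled (m - j) xs)"
proof -
  have M: "map (\<lambda>x. real x / real m) xs = map (\<lambda>x. (1 - real j / real m) * (real x / real (m - j))) xs"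
  proof (cases "j = m")
    \<comment> \<open>Here m - j = 0 and the right-hand side divides by zero; positivity of the
      parts forces \<open>xs\<close> to be empty.\<close>
    case True
    then have "\<forall>x\<in>set xs. x = 0" using assms(1) by simp
    then have "xs = []" using assms(2) by (metis less_irrefl list.set_intros(1) neq_Nil_conv)
    then show ?thesis by simp
  next
    case False
    then have "(1 - real j / real m) / real (m - j) = 1 / real m"
      using assms(3,4) by (simp add: of_nat_diff field_simps)
    then show ?thesis by (auto simp: divide_inverse mult_ac)
  qed
  have "scaled m (j # xs) = case_nat (real j / real m) (pad (map (\<lambda>x. real x / real m) xs))"
    unfolding scaled_def by (simp add: pad_Cons)
  also have "\<dots> = case_nat (real j / real m) (pad (map (\<lambda>x. (1 - real j / real m) * (real x / real (m - j))) xs))"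
    by (simp only: M)
  also have "\<dots> = stick_cons (real j / real m) (scaled (m - j) xs)"
    unfolding stick_cons_def scaled_def by (auto simp: pad_def fun_eq_iff split: nat.split)
  finally show ?thesis .
qed

definition scaled_mean :: "(nat \<Rightarrow> real) \<Rightarrow> nat \<Rightarrow> ((nat \<Rightarrow> real) \<Rightarrow> real) \<Rightarrow> real" where
  "scaled_mean v m \<Phi> = cyc_sum v m (\<lambda>xs. \<Phi> (scaled m xs)) / cyc_total v m"

lemma scaled_mean_bound:
  assumes \<Phi>: "lip_fun L \<Phi>" and L: "0 \<le> L" and v: "\<And>j. 0 \<le> v j" and q: "0 < cyc_total v m"
  shows "\<bar>scaled_mean v m \<Phi> - \<Phi> (\<lambda>_. 0)\<bar> \<le> L"
proof -
  have "scaled_mean v m \<Phi> - \<Phi> (\<lambda>_. 0) = cyc_sum v m (\<lambda>xs. \<Phi> (scaled m xs) - \<Phi> (\<lambda>_. 0)) / cyc_total v m"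
    using q by (simp add: scaled_mean_def cyc_sum_diff cyc_sum_const[of v m "\<Phi> (\<lambda>_. 0)"] diff_divide_distrib)
  also have "\<bar>\<dots>\<bar> = \<bar>cyc_sum v m (\<lambda>xs. \<Phi> (scaled m xs) - \<Phi> (\<lambda>_. 0))\<bar> / cyc_total v m"
    using q by (simp add: abs_divide)
  also have "\<dots> \<le> (L * cyc_total v m) / cyc_total v m"
    unfolding cyc_sum_const[of v m L, symmetric] using q v
    by (intro divide_right_mono cyc_sum_abs_le lip_fun_bound[OF \<Phi> L] scaled_subprob) auto
  finally show ?thesis using q by simp
qed

lemma scaled_mean_rec:
  assumes \<Phi>: "lip_fun L \<Phi>" and L: "0 \<le> L" and v: "\<And>j. 0 \<le> v j" and m: "0 < m" and q: "0 < cyc_total v m"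
  shows "scaled_mean v m \<Phi> = (\<Sum>j\<in>{1..m}. v j * cyc_total v (m - j) / (real m * cyc_total v m) * scaled_mean v (m - j) (\<lambda>y. \<Phi> (stick_cons (real j / real m) y)))"
proof -
  let ?G = "\<lambda>j. cyc_sum v (m - j) (\<lambda>xs. \<Phi> (stick_cons (real j / real m) (scaled (m - j) xs)))"
  have "real m * cyc_sum v m (\<lambda>xs. \<Phi> (scaled m xs)) = (\<Sum>j\<in>{1..m}. v j * ?G j)"
    unfolding cyc_sum_rec
  proof (intro sum.cong refl arg_cong2[where f = "(*)"] cyc_sum_cong)
    fix j xs assume "j \<in> {1..m}" "sum_list xs = m - j" "\<forall>x\<in>set xs. 0 < x"
    then show "\<Phi> (scaled m (j # xs)) = \<Phi> (stick_cons (real j / real m) (scaled (m - j) xs))"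
      using m by (subst scaled_Cons) auto
  qed
  moreover have "scaled_mean v m \<Phi> = (real m * cyc_sum v m (\<lambda>xs. \<Phi> (scaled m xs))) / (real m * cyc_total v m)"
    using m unfolding scaled_mean_def by simp
  ultimately have "scaled_mean v m \<Phi> = (\<Sum>j\<in>{1..m}. v j * ?G j) / (real m * cyc_total v m)"
    by (simp only:)
  also have "\<dots> = (\<Sum>j\<in>{1..m}. v j * cyc_total v (m - j) / (real m * cyc_total v m) * scaled_mean v (m - j) (\<lambda>y. \<Phi> (stick_cons (real j / real m) y)))"
    unfolding sum_divide_distrib
  proof (rule sum.cong[OF refl])
    fix j assume j: "j \<in> {1..m}"
    show "v j * ?G j / (real m * cyc_total v m) = v j * cyc_total v (m - j) / (real m * cyc_total v m) * scaled_mean v (m - j) (\<lambda>y. \<Phi> (stick_cons (real j / real m) y))"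
    proof (cases "cyc_total v (m - j) = 0")
      \<comment> \<open>\<open>scaled_mean\<close> divides by zero here. The numerator vanishes as
        well: \<Phi> is bounded on \<open>subprob\<close>, and the total weight is 0.\<close>
      case True
      have x: "0 \<le> real j / real m" "real j / real m \<le> 1" using j by auto
      have L': "0 \<le> L * (1 - real j / real m)" using L x by simp
      have "\<bar>\<Phi> (stick_cons (real j / real m) y)\<bar> \<le> L * (1 - real j / real m) + \<bar>\<Phi> (stick_cons (real j / real m) (\<lambda>_. 0))\<bar>"
        if "y \<in> subprob" for y
        using lip_fun_bound[OF lip_fun_stick_cons[OF \<Phi> x] L' that] by linarith
      then have "\<bar>?G j\<bar> \<le> cyc_sum v (m - j) (\<lambda>_. L * (1 - real j / real m) + \<bar>\<Phi> (stick_cons (real j / real m) (\<lambda>_. 0))\<bar>)"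
        using v by (intro cyc_sum_abs_le) (auto intro: scaled_subprob)
      also have "\<dots> = 0" by (subst cyc_sum_const) (simp add: True)
      finally show ?thesis using True by simp
    next
      case False
      then show ?thesis unfolding scaled_mean_def by simp
    qed
  qed
  finally show ?thesis .
qed

definition beta_density :: "real \<Rightarrow> real \<Rightarrow> real" where
  "beta_density t x = indicator {0<..<1} x * t * (1 - x) powr (t - 1)"

lemma beta_density_measurable [measurable]: "beta_density t \<in> borel_measurable borel"
  unfolding beta_density_def by measurable

lemma beta_density_nonneg: "0 < t \<Longrightarrow> 0 \<le> beta_density t x"
  by (simp add: beta_density_def)

lemma beta1_eq: "beta1 t = density lborel (\<lambda>x. ennreal (beta_density t x))"
  by (simp add: beta1_def beta_density_def)

lemma has_bochner_integral_powr_Ioo: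
  assumes t: "0 < (t :: real)"
  shows "has_bochner_integral lborel (\<lambda>x. indicator {0<..<1} x * (1 - x) powr (t - 1)) (1 / t)"
proof (rule has_bochner_integral_nn_integral)
  have "Gamma t \<noteq> 0" using Gamma_real_pos[OF t] by linarith
  then have "Beta 1 t = 1 / t"
    using t Gamma_plus1[of t]
    by (simp add: Beta_def add.commute nonpos_Ints_def divide_simps)
  moreover have "((\<lambda>x. x powr (1 - 1) * (1 - x) powr (t - 1)) has_integral Beta 1 t) {0<..<1}"
    using has_integral_Beta_real[of 1 t] t unfolding has_integral_Icc_iff_Ioo by simp
  ultimately have "((\<lambda>x. x powr (1 - 1) * (1 - x) powr (t - 1)) has_integral (1 / t)) {0<..<1}" by simp
  then have "((\<lambda>x. (1 - x) powr (t - 1)) has_integral (1 / t)) {0<..<1}"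
    by (rule has_integral_eq[rotated]) auto
  then show "integral\<^sup>N lborel (\<lambda>x. ennreal (indicator {0<..<1} x * (1 - x) powr (t - 1))) = ennreal (1 / t)"
    by (intro nn_integral_has_integral_lebesgue) auto
qed (use t in auto)

lemma has_bochner_integral_beta_density:
  assumes t: "0 < (t :: real)"
  shows "has_bochner_integral lborel (beta_density t) 1"
  using has_bochner_integral_mult_right[OF has_bochner_integral_powr_Ioo[OF t], of t] t
  unfolding beta_density_def by (simp add: mult_ac)

lemma prob_space_beta1:
  assumes t: "0 < (t :: real)"
  shows "prob_space (beta1 t)"
proof (rule prob_spaceI)
  have "emeasure (beta1 t) (space (beta1 t)) = (\<integral>\<^sup>+x. ennreal (beta_density t x) \<partial>lborel)"
    unfolding beta1_eq by (simp add: emeasure_density)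
  also have "\<dots> = ennreal 1"
    using has_bochner_integral_beta_density[OF t] beta_density_nonneg[OF t]
    by (subst nn_integral_eq_integral) (auto simp: has_bochner_integral_iff)
  finally show "emeasure (beta1 t) (space (beta1 t)) = 1" by simp
qed

lemma integral_beta1:
  assumes "0 < t" "f \<in> borel_measurable borel"
  shows "(\<integral>x. f x \<partial>beta1 t) = (\<integral>x. beta_density t x * f x \<partial>lborel)"
  unfolding beta1_eq using assms beta_density_nonneg[of t] by (subst integral_density) auto

lemma AE_beta1: "AE x in beta1 t. 0 < x \<and> x < 1"
  unfolding beta1_eq by (subst AE_density) (auto simp: beta_density_def split: split_indicator)

lemma sets_beta1 [measurable_cong]: "sets (beta1 t) = sets borel"
  by (simp add: beta1_eq)

lemma space_beta1 [simp]: "space (beta1 t) = UNIV"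
  by (simp add: beta1_eq)

section \<open>The first size-biased cycle and the Beta density\<close>

locale log_weights =
  fixes v :: "nat \<Rightarrow> real" and t A :: real
  assumes v_nonneg: "\<And>j. 0 \<le> v j" and v_lim: "v \<longlonglongrightarrow> t" and t: "0 < t" and A: "0 < A"
    and q_asymp: "(\<lambda>n. cyc_total v n / real n powr (t - 1)) \<longlonglongrightarrow> A"
begin

abbreviation q :: "nat \<Rightarrow> real" where "q \<equiv> cyc_total v"

text \<open>The probability that the first size-biased cycle of a random permutation of m points has
  length j.\<close>

definition W :: "nat \<Rightarrow> nat \<Rightarrow> real" where
  "W m j = v j * q (m - j) / (real m * q m)"

lemma q_nonneg: "0 \<le> q n"
  by (rule cyc_total_nonneg) (rule v_nonneg)

lemma W_nonneg: "0 \<le> W m j"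
  unfolding W_def using v_nonneg q_nonneg by simp

lemma sum_W: "0 < m \<Longrightarrow> 0 < q m \<Longrightarrow> (\<Sum>j\<in>{1..m}. W m j) = 1"
  unfolding W_def sum_divide_distrib[symmetric] cyc_total_rec[symmetric] by simp

lemma eventually_q_lower: "eventually (\<lambda>n. A / 2 * real n powr (t - 1) \<le> q n \<and> 0 < q n) sequentially"
proof -
  have "eventually (\<lambda>n. A / 2 < q n / real n powr (t - 1)) sequentially"
    using A by (intro order_tendstoD[OF q_asymp]) auto
  then show ?thesis using eventually_gt_at_top[of 0]
  proof eventually_elim
    case (elim n)
    then have "A / 2 * real n powr (t - 1) < q n" by (simp add: less_divide_eq)
    moreover have "0 < A / 2 * real n powr (t - 1)" using A elim by simp
    ultimately show ?case by linarith
  qed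
qed

text \<open>The shift to n + 1 includes n = 0, where q is 1 but \<open>0 powr p\<close> is
  0.\<close>

lemma q_upper: "\<exists>B\<ge>0. \<forall>n. q n \<le> B * real (Suc n) powr (t - 1)"
proof -
  have "(\<lambda>n. q n / real n powr (t - 1) * (real n / real (Suc n)) powr (t - 1)) \<longlonglongrightarrow> A * 1 powr (t - 1)"
    by (intro tendsto_mult q_asymp tendsto_powr LIMSEQ_n_over_Suc_n tendsto_const) auto
  then have "(\<lambda>n. q n / real (Suc n) powr (t - 1)) \<longlonglongrightarrow> A * 1 powr (t - 1)"
    by (rule Lim_transform_eventually)
       (use eventually_gt_at_top[of 0] in eventually_elim, simp add: powr_divide)
  then obtain B where B: "\<And>n. \<bar>q n / real (Suc n) powr (t - 1)\<bar> \<le> B"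
    using convergent_imp_Bseq[of "\<lambda>n. q n / real (Suc n) powr (t - 1)"] by (auto simp: convergent_def Bseq_def)
  have "q n \<le> B * real (Suc n) powr (t - 1)" for n
    using abs_le_D1[OF B[of n]] by (simp add: divide_le_eq)
  moreover have "0 \<le> B" using order_trans[OF abs_ge_zero B] .
  ultimately show ?thesis by blast
qed

definition cell :: "nat \<Rightarrow> nat \<Rightarrow> real set" where
  "cell m j = {(real j - 1) / real m<..real j / real m}"

text \<open>The point mass at j / m is spread over the interval of length 1 / m to its left. The
  convergence of laws becomes convergence of densities in L1, which is uniform over bounded test
  functions.\<close>

definition dens :: "nat \<Rightarrow> real \<Rightarrow> real" where
  "dens m x = (\<Sum>j\<in>{1..m}. indicator (cell m j) x * (real m * W m j))"

lemma cell_iff: "0 < m \<Longrightarrow> x \<in> cell m j \<longleftrightarrow> real j - 1 < real m * x \<and> real m * x \<le> real j"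
  by (auto simp: cell_def field_simps)

lemma cell_unique: "0 < m \<Longrightarrow> x \<in> cell m i \<Longrightarrow> x \<in> cell m j \<Longrightarrow> i = j"
  by (auto simp: cell_iff)

lemma sum_cell:
  assumes m: "0 < m" and x: "x \<in> cell m j" and j: "j \<in> {1..m}"
  shows "(\<Sum>i\<in>{1..m}. indicator (cell m i) x * (f i :: real)) = f j"
proof -
  have "(\<Sum>i\<in>{1..m}. indicator (cell m i) x * f i) = (\<Sum>i\<in>{j}. indicator (cell m i) x * f i)"
    using j cell_unique[OF m x] by (intro sum.mono_neutral_right) (auto simp: indicator_def)
  then show ?thesis using x by simp
qed

lemma ex_cell:
  assumes m: "0 < m" and x: "0 < x" "x \<le> 1"
  obtains j where "j \<in> {1..m}" "x \<in> cell m j"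
proof -
  define j where "j = nat \<lceil>real m * x\<rceil>"
  have "0 < real m * x" using m x by simp
  moreover have "real m * x \<le> real m" using m x by simp
  ultimately have "j \<in> {1..m}" "x \<in> cell m j"
    unfolding cell_iff[OF m] j_def by (auto simp: le_nat_iff ceiling_le_iff nat_le_iff) linarith+
  then show ?thesis using that by blast
qed

lemma not_in_cell: "0 < m \<Longrightarrow> j \<in> {1..m} \<Longrightarrow> x \<le> 0 \<or> 1 < x \<Longrightarrow> x \<notin> cell m j"
proof
  assume m: "0 < m" and j: "j \<in> {1..m}" and x: "x \<le> 0 \<or> 1 < x" and c: "x \<in> cell m j"
  from x show False
  proof
    assume "x \<le> 0"
    then have "real m * x \<le> 0" by (simp add: mult_le_0_iff)
    then show False using c j unfolding cell_iff[OF m] by auto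
  next
    assume "1 < x"
    then have "real m * 1 < real m * x" using m by (intro mult_strict_left_mono) auto
    then show False using c j unfolding cell_iff[OF m] by auto
  qed
qed

lemma has_bochner_integral_cell:
  assumes "0 < m"
  shows "has_bochner_integral lborel (indicator (cell m j) :: real \<Rightarrow> real) (1 / real m)"
proof -
  have "(real j - 1) / real m \<le> real j / real m" using assms by (simp add: divide_right_mono)
  then have "measure lborel (cell m j) = 1 / real m" "emeasure lborel (cell m j) < \<infinity>"
    unfolding cell_def using assms by (auto simp: diff_divide_distrib[symmetric])
  then show ?thesis using has_bochner_integral_real_indicator[of "cell m j" lborel] by (simp add: cell_def)
qed

lemma has_bochner_integral_cells:
  assumes "0 < m"
  shows "has_bochner_integral lborel (\<lambda>x. \<Sum>j\<in>{1..m}. indicator (cell m j) x * (real m * W m j * f j)) (\<Sum>j\<in>{1..m}. W m j * f j)"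
proof -
  have "has_bochner_integral lborel (\<lambda>x. \<Sum>j\<in>{1..m}. indicator (cell m j) x * (real m * W m j * f j)) (\<Sum>j\<in>{1..m}. 1 / real m * (real m * W m j * f j))"
    by (intro has_bochner_integral_sum has_bochner_integral_mult_left has_bochner_integral_cell assms)
  then show ?thesis using assms by simp
qed

lemma integrable_dens: "0 < m \<Longrightarrow> integrable lborel (dens m)"
  using has_bochner_integral_cells[of m "\<lambda>_. 1"] unfolding dens_def by (simp add: has_bochner_integral_iff)

text \<open>At x the density is \<open>v (J m) * q (m - J m) / q m\<close> with J m about m x. Both
  J m and m - J m tend to infinity, so the first factor tends to t and the quotient of the power
  laws to (1 - x)^(t-1).\<close>

lemma dens_tendsto:
  assumes x: "0 < x" "x < 1"
  shows "(\<lambda>m. dens m x) \<longlonglongrightarrow> beta_density t x"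
proof -
  define J where "J = (\<lambda>m. nat \<lceil>real m * x\<rceil>)"
  have J: "J m \<in> {1..m}" "x \<in> cell m (J m)" "real m * x \<le> real (J m)" "real (J m) \<le> real m * x + 1" if m: "0 < m" for m
  proof -
    have "0 < real m * x" using m x by simp
    moreover have "real m * x \<le> real m" using m x by simp
    ultimately show "J m \<in> {1..m}" "x \<in> cell m (J m)" "real m * x \<le> real (J m)" "real (J m) \<le> real m * x + 1"
      unfolding cell_iff[OF m] J_def by (auto simp: le_nat_iff ceiling_le_iff nat_le_iff) linarith+
  qed
  have dens_eq: "dens m x = v (J m) * q (m - J m) / q m" if m: "0 < m" for m
    unfolding dens_def sum_cell[OF m J(2,1)[OF m]] using m by (simp add: W_def)
  have J_top: "filterlim J at_top sequentially"
  proof (rule filterlim_at_top_mono[where f = "\<lambda>m. nat \<lfloor>real m * x\<rfloor>"])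
    show "filterlim (\<lambda>m. nat \<lfloor>real m * x\<rfloor>) at_top sequentially" using x by real_asymp
    show "eventually (\<lambda>m. nat \<lfloor>real m * x\<rfloor> \<le> J m) sequentially"
      unfolding J_def by (intro always_eventually allI nat_mono floor_le_ceiling)
  qed
  have R_lim: "(\<lambda>m. real (m - J m) / real m) \<longlonglongrightarrow> 1 - x"
  proof (rule tendsto_sandwich[of "\<lambda>m. 1 - x - 1 / real m" _ _ "\<lambda>_. 1 - x"])
    show "(\<lambda>m. 1 - x - 1 / real m) \<longlonglongrightarrow> 1 - x" by real_asymp
    have *: "real (m - J m) = real m - real (J m)" if "0 < m" for m using J(1)[OF that] by (simp add: of_nat_diff)
    show "eventually (\<lambda>m. 1 - x - 1 / real m \<le> real (m - J m) / real m) sequentially"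
      using eventually_gt_at_top[of 0]
    proof eventually_elim
      case (elim m)
      have "1 - x - 1 / real m = (real m - (real m * x + 1)) / real m" using elim by (simp add: field_simps)
      also have "\<dots> \<le> real (m - J m) / real m"
        using J(4)[OF elim] by (intro divide_right_mono) (auto simp: *[OF elim])
      finally show ?case .
    qed
    show "eventually (\<lambda>m. real (m - J m) / real m \<le> 1 - x) sequentially"
      using eventually_gt_at_top[of 0]
    proof eventually_elim
      case (elim m)
      then show ?case using J(3)[OF elim] by (simp add: * field_simps)
    qed
  qed simp
  have R_top: "filterlim (\<lambda>m. m - J m) at_top sequentially"
  proof -
    have "filterlim (\<lambda>m. real (m - J m) / real m * real m) at_top sequentially"
      using R_lim x by (intro filterlim_tendsto_pos_mult_at_top[OF R_lim] filterlim_real_sequentially) auto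
    then have "filterlim (\<lambda>m. real (m - J m)) at_top sequentially"
      by (rule filterlim_mono_eventually[OF _ order_refl order_refl])
         (use eventually_gt_at_top[of 0] in eventually_elim, simp)
    then show ?thesis using filterlim_sequentially_iff_filterlim_real by blast
  qed
  have "(\<lambda>m. v (J m) * (q (m - J m) / real (m - J m) powr (t - 1)) * (real (m - J m) / real m) powr (t - 1) / (q m / real m powr (t - 1)))
     \<longlonglongrightarrow> t * A * (1 - x) powr (t - 1) / A"
    using A x by (intro tendsto_divide tendsto_mult tendsto_powr q_asymp R_lim tendsto_const
        filterlim_compose[OF v_lim J_top] filterlim_compose[OF q_asymp R_top]) auto
  also have "t * A * (1 - x) powr (t - 1) / A = beta_density t x"
    using A x by (simp add: beta_density_def)
  finally show ?thesis
  proof (rule Lim_transform_eventually)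
    have "eventually (\<lambda>m. 1 \<le> m - J m) sequentially"
      using R_top unfolding filterlim_at_top by blast
    then have "eventually (\<lambda>m. 0 < m - J m) sequentially" by (rule eventually_mono) simp
    then show "eventually (\<lambda>m. v (J m) * (q (m - J m) / real (m - J m) powr (t - 1)) * (real (m - J m) / real m) powr (t - 1) / (q m / real m powr (t - 1)) = dens m x) sequentially"
      using eventually_gt_at_top[of 0]
    proof eventually_elim
      case (elim m)
      have "real (m - J m) powr (t - 1) \<noteq> 0" "real m powr (t - 1) \<noteq> 0" using elim by auto
      then show ?case using elim by (simp add: dens_eq powr_divide)
    qed
  qed
qed

text \<open>The two summands of the majorant serve t \<ge> 1 and t < 1 at once. The point 1 lies in
  the last cell but outside the open interval, hence its exclusion.\<close>

lemma dens_dominated: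
  "\<exists>K. eventually (\<lambda>m. \<forall>x. x \<noteq> 1 \<longrightarrow> \<bar>dens m x\<bar> \<le> K * (indicator {0<..<1} x + indicator {0<..<1} x * (1 - x) powr (t - 1))) sequentially"
proof -
  obtain V where V: "\<And>n. \<bar>v n\<bar> \<le> V"
    using convergent_imp_Bseq[of v] v_lim by (auto simp: convergent_def Bseq_def)
  have V0: "0 \<le> V" using order_trans[OF abs_ge_zero V] .
  obtain B where B0: "B \<ge> 0" and B: "\<And>n. q n \<le> B * real (Suc n) powr (t - 1)" using q_upper by blast
  define K where "K = V * B * 2 / A"
  have K: "0 \<le> K" using V0 B0 A by (simp add: K_def)
  have "eventually (\<lambda>m. \<forall>x. x \<noteq> 1 \<longrightarrow> \<bar>dens m x\<bar> \<le> K * (indicator {0<..<1} x + indicator {0<..<1} x * (1 - x) powr (t - 1))) sequentially"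
    using eventually_q_lower eventually_gt_at_top[of 0]
  proof eventually_elim
    case (elim m)
    have "\<bar>dens m x\<bar> \<le> K * (indicator {0<..<1} x + indicator {0<..<1} x * (1 - x) powr (t - 1))" if x1: "x \<noteq> 1" for x
    proof (cases "0 < x \<and> x < 1")
      case True
      then obtain j where j: "j \<in> {1..m}" "x \<in> cell m j" using ex_cell[OF elim(2), of x] by auto
      have "dens m x = v j * q (m - j) / q m"
        unfolding dens_def sum_cell[OF elim(2) j(2,1)] using elim(2) by (simp add: W_def)
      then have abs: "\<bar>dens m x\<bar> = v j * q (m - j) / q m" using v_nonneg q_nonneg by simp
      have "q (m - j) \<le> B * real (Suc (m - j)) powr (t - 1)" by (rule B)
      also have "\<dots> \<le> B * (max 1 ((1 - x) powr (t - 1)) * real m powr (t - 1))"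
      proof (intro mult_left_mono powr_le_powr_between(1) B0)
        \<comment> \<open>The shift by one in \<open>q_upper\<close> absorbs the rounding: a point
          of the cell only satisfies j - 1 < m x.\<close>
        show "(1 - x) * real m \<le> real (Suc (m - j))"
          using j unfolding cell_iff[OF elim(2)] by (auto simp: of_nat_diff algebra_simps)
      qed (use True j elim(2) in auto)
      also have "\<dots> \<le> B * ((1 + (1 - x) powr (t - 1)) * real m powr (t - 1))"
        by (intro mult_left_mono mult_right_mono B0) auto
      finally have "v j * q (m - j) \<le> V * (B * ((1 + (1 - x) powr (t - 1)) * real m powr (t - 1)))"
        using V[of j] q_nonneg V0 by (intro mult_mono) auto
      also have "\<dots> = K * (1 + (1 - x) powr (t - 1)) * (A / 2 * real m powr (t - 1))"
        using A by (simp add: K_def)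
      also have "\<dots> \<le> K * (1 + (1 - x) powr (t - 1)) * q m"
        using elim(1) K by (intro mult_left_mono) auto
      finally have "v j * q (m - j) / q m \<le> K * (1 + (1 - x) powr (t - 1))"
        using elim(1) by (simp add: divide_le_eq)
      then show ?thesis using True abs by simp
    next
      case False
      then have "x \<le> 0 \<or> 1 < x" using x1 by auto
      then have "dens m x = 0" unfolding dens_def using not_in_cell[OF elim(2)] by (intro sum.neutral) auto
      then show ?thesis using False by simp
    qed
    then show ?case by blast
  qed
  then show ?thesis by blast
qed

lemma dens_L1: "(\<lambda>m. \<integral>x. \<bar>dens m x - beta_density t x\<bar> \<partial>lborel) \<longlonglongrightarrow> 0"
proof -
  obtain K where K: "eventually (\<lambda>m. \<forall>x. x \<noteq> 1 \<longrightarrow> \<bar>dens m x\<bar> \<le> K * (indicator {0<..<1} x + indicator {0<..<1} x * (1 - x) powr (t - 1))) sequentially"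
    using dens_dominated by blast
  then obtain m0 where m0: "\<And>m x. m \<ge> m0 \<Longrightarrow> x \<noteq> 1 \<Longrightarrow> \<bar>dens m x\<bar> \<le> K * (indicator {0<..<1} x + indicator {0<..<1} x * (1 - x) powr (t - 1))"
    unfolding eventually_sequentially by blast
  let ?w = "\<lambda>x. K * (indicator {0<..<1} x + indicator {0<..<1} x * (1 - x) powr (t - 1)) + beta_density t x"
  have ne1: "AE x in lborel. x \<noteq> (1::real)" by (rule AE_lborel_singleton)
  have meas: "dens m \<in> borel_measurable borel" for m unfolding dens_def cell_def by measurable
  have "(\<lambda>i. \<integral>x. \<bar>dens (i + m0) x - beta_density t x\<bar> \<partial>lborel) \<longlonglongrightarrow> (\<integral>x. 0 \<partial>(lborel :: real measure))"
  proof (rule integral_dominated_convergence[where w = ?w])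
    show "integrable lborel ?w"
      using has_bochner_integral_powr_Ioo[OF t] has_bochner_integral_beta_density[OF t]
      by (intro Bochner_Integration.integrable_add integrable_mult_right) (auto simp: has_bochner_integral_iff)
    show "AE x in lborel. (\<lambda>i. \<bar>dens (i + m0) x - beta_density t x\<bar>) \<longlonglongrightarrow> 0"
      using ne1
    proof eventually_elim
      case (elim x)
      have "(\<lambda>m. dens m x) \<longlonglongrightarrow> beta_density t x"
      proof (cases "0 < x \<and> x < 1")
        case True
        then show ?thesis by (intro dens_tendsto) auto
      next
        case False
        then have "x \<le> 0 \<or> 1 < x" using elim by auto
        then have "dens m x = 0" if "0 < m" for m unfolding dens_def using not_in_cell[OF that] by (intro sum.neutral) auto
        moreover have "beta_density t x = 0" using False by (auto simp: beta_density_def)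
        ultimately show ?thesis
          by (intro tendsto_eventually eventually_mono[OF eventually_gt_at_top[of "0::nat"]]) simp
      qed
      then have "(\<lambda>m. \<bar>dens m x - beta_density t x\<bar>) \<longlonglongrightarrow> \<bar>beta_density t x - beta_density t x\<bar>"
        by (intro tendsto_intros)
      then show ?case by (intro LIMSEQ_ignore_initial_segment) simp
    qed
    show "AE x in lborel. norm \<bar>dens (i + m0) x - beta_density t x\<bar> \<le> ?w x" for i
      using ne1
    proof eventually_elim
      case (elim x)
      have "\<bar>dens (i + m0) x - beta_density t x\<bar> \<le> \<bar>dens (i + m0) x\<bar> + beta_density t x"
        using beta_density_nonneg[OF t, of x] by linarith
      then show ?case using m0[of "i + m0" x] elim by simp
    qed
  qed (use meas in auto)
  then show ?thesis by (simp add: LIMSEQ_offset)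
qed

text \<open>The first summand is the L1 distance of the densities; the second pays for rounding x to
  j / m inside a function with Lipschitz constant 2 L.\<close>

definition err :: "nat \<Rightarrow> real" where
  "err m = (\<integral>x. \<bar>dens m x - beta_density t x\<bar> \<partial>lborel) + 2 / real m"

lemma err_tendsto: "err \<longlonglongrightarrow> 0"
proof -
  have "(\<lambda>m. 2 / real m) \<longlonglongrightarrow> 0" by real_asymp
  from tendsto_add[OF dens_L1 this] show ?thesis unfolding err_def by simp
qed

text \<open>The error depends on \<psi> only through L, as the contraction argument needs it for all
  test functions at once.\<close>

lemma first_pick:
  assumes m: "0 < m" and L: "0 \<le> L" and \<psi>: "\<psi> \<in> borel_measurable borel"
    and b: "\<And>x. 0 \<le> x \<Longrightarrow> x \<le> 1 \<Longrightarrow> \<bar>\<psi> x\<bar> \<le> L"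
    and lip: "\<And>x y. 0 \<le> x \<Longrightarrow> x \<le> 1 \<Longrightarrow> 0 \<le> y \<Longrightarrow> y \<le> 1 \<Longrightarrow> \<bar>\<psi> x - \<psi> y\<bar> \<le> 2 * L * \<bar>x - y\<bar>"
  shows "\<bar>(\<Sum>j\<in>{1..m}. W m j * \<psi> (real j / real m)) - (\<integral>x. \<psi> x \<partial>beta1 t)\<bar> \<le> err m * L"
proof -
  let ?G = "\<lambda>x. \<Sum>j\<in>{1..m}. indicator (cell m j) x * (real m * W m j * \<psi> (real j / real m))"
  let ?b = "beta_density t"
  let ?R = "\<lambda>x. \<bar>dens m x - ?b x\<bar> * L + ?b x * (2 * L / real m)"
  have G: "has_bochner_integral lborel ?G (\<Sum>j\<in>{1..m}. W m j * \<psi> (real j / real m))"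
    by (rule has_bochner_integral_cells[OF m])
  then have iG: "integrable lborel ?G" by (simp only: has_bochner_integral_iff)
  have ib: "integrable lborel ?b" "integral\<^sup>L lborel ?b = 1"
    using has_bochner_integral_beta_density[OF t] by (auto simp: has_bochner_integral_iff)
  have ibp: "integrable lborel (\<lambda>x. ?b x * \<psi> x)"
  proof (rule Bochner_Integration.integrable_bound[of _ "\<lambda>x. L * ?b x"])
    show "AE x in lborel. norm (?b x * \<psi> x) \<le> norm (L * ?b x)"
    proof (rule AE_I2)
      fix x :: real
      show "norm (?b x * \<psi> x) \<le> norm (L * ?b x)"
      proof (cases "0 < x \<and> x < 1")
        case True
        then have "\<bar>?b x\<bar> * \<bar>\<psi> x\<bar> \<le> \<bar>?b x\<bar> * L" using b by (intro mult_left_mono) auto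
        then show ?thesis using L by (simp add: abs_mult mult.commute)
      next
        case False
        then have "?b x = 0" by (auto simp: beta_density_def)
        then show ?thesis by simp
      qed
    qed
  qed (use ib \<psi> in auto)
  have iR: "integrable lborel ?R"
    using ib integrable_dens[OF m] by (intro Bochner_Integration.integrable_add integrable_mult_left integrable_abs Bochner_Integration.integrable_diff) auto
  have E1: "(\<Sum>j\<in>{1..m}. W m j * \<psi> (real j / real m)) - (\<integral>x. \<psi> x \<partial>beta1 t) = (\<integral>x. ?G x - ?b x * \<psi> x \<partial>lborel)"
    using G by (simp only: Bochner_Integration.integral_diff[OF iG ibp] integral_beta1[OF t \<psi>] has_bochner_integral_iff)
  have E2: "\<bar>\<integral>x. ?G x - ?b x * \<psi> x \<partial>lborel\<bar> \<le> (\<integral>x. \<bar>?G x - ?b x * \<psi> x\<bar> \<partial>lborel)" by (rule integral_abs_bound)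
  have E3: "(\<integral>x. \<bar>?G x - ?b x * \<psi> x\<bar> \<partial>lborel) \<le> (\<integral>x. ?R x \<partial>lborel)"
  proof (rule integral_mono)
    show "integrable lborel (\<lambda>x. \<bar>?G x - ?b x * \<psi> x\<bar>)"
      by (intro integrable_abs Bochner_Integration.integrable_diff iG ibp)
    fix x :: real
    show "\<bar>?G x - ?b x * \<psi> x\<bar> \<le> ?R x"
    proof (cases "0 < x \<and> x \<le> 1")
      case True
      then obtain j where j: "j \<in> {1..m}" "x \<in> cell m j" using ex_cell[OF m, of x] by auto
      let ?y = "real j / real m"
      have y: "0 \<le> ?y" "?y \<le> 1" using j m by auto
      have xy: "\<bar>?y - x\<bar> \<le> 1 / real m" using j(2) by (auto simp: cell_def diff_divide_distrib abs_le_iff)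
      have "?G x - ?b x * \<psi> x = (dens m x - ?b x) * \<psi> ?y + ?b x * (\<psi> ?y - \<psi> x)"
        unfolding dens_def sum_cell[OF m j(2,1)] by (simp add: algebra_simps)
      then have "\<bar>?G x - ?b x * \<psi> x\<bar> \<le> \<bar>dens m x - ?b x\<bar> * \<bar>\<psi> ?y\<bar> + ?b x * \<bar>\<psi> ?y - \<psi> x\<bar>"
        using beta_density_nonneg[OF t, of x] abs_triangle_ineq[of "(dens m x - ?b x) * \<psi> ?y" "?b x * (\<psi> ?y - \<psi> x)"]
        by (simp only: abs_mult abs_of_nonneg)
      moreover have "\<bar>dens m x - ?b x\<bar> * \<bar>\<psi> ?y\<bar> \<le> \<bar>dens m x - ?b x\<bar> * L"
        using y by (intro mult_left_mono b) auto
      moreover have "?b x * \<bar>\<psi> ?y - \<psi> x\<bar> \<le> ?b x * (2 * L / real m)"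
      proof (rule mult_left_mono[OF _ beta_density_nonneg[OF t]])
        have "\<bar>\<psi> ?y - \<psi> x\<bar> \<le> 2 * L * \<bar>?y - x\<bar>" using y True by (intro lip) auto
        also have "\<dots> \<le> 2 * L * (1 / real m)" using L xy by (intro mult_left_mono) auto
        finally show "\<bar>\<psi> ?y - \<psi> x\<bar> \<le> 2 * L / real m" by simp
      qed
      ultimately show ?thesis by linarith
    next
      case False
      then have x: "x \<le> 0 \<or> 1 < x" by auto
      then have "?G x = 0" using not_in_cell[OF m] by (intro sum.neutral) auto
      moreover have "?b x = 0" using x by (auto simp: beta_density_def)
      ultimately show ?thesis using L by simp
    qed
  qed (fact iR)
  have E4: "(\<integral>x. ?R x \<partial>lborel) = (\<integral>x. \<bar>dens m x - ?b x\<bar> \<partial>lborel) * L + 1 * (2 * L / real m)"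
    using ib integrable_dens[OF m] by (subst Bochner_Integration.integral_add) auto
  have E5: "(\<integral>x. \<bar>dens m x - ?b x\<bar> \<partial>lborel) * L + 1 * (2 * L / real m) = err m * L"
    by (simp add: err_def field_simps)
  show ?thesis using E2 E3 unfolding E1 E4 E5 by (rule order_trans)
qed

end

section \<open>The stick-breaking law and its recursion\<close>

definition GEM :: "real \<Rightarrow> (nat \<Rightarrow> real) measure" where
  "GEM t = Pi\<^sub>M UNIV (\<lambda>_. beta1 t)"

text \<open>\<open>GEM t\<close> itself is the law of the independent fractions; the distribution
  usually given this name is its image under \<open>stick\<close>, over which this mean is
  taken.\<close>

definition GEM_mean :: "real \<Rightarrow> ((nat \<Rightarrow> real) \<Rightarrow> real) \<Rightarrow> real" where
  "GEM_mean t \<Phi> = (\<integral>B. \<Phi> (stick B) \<partial>GEM t)"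

lemma space_GEM [simp]: "space (GEM t) = UNIV"
  by (simp add: GEM_def space_PiM)

lemma measurable_stick [measurable]: "stick \<in> measurable (GEM t) (Pi\<^sub>M UNIV (\<lambda>_. borel))"
proof (rule measurable_PiM_single')
  have [measurable]: "(\<lambda>B. B n) \<in> borel_measurable (GEM t)" for n
    using measurable_component_singleton[of n UNIV "\<lambda>_. beta1 t"]
    unfolding GEM_def by (simp add: measurable_cong_sets[OF refl sets_beta1])
  show "(\<lambda>B. stick B n) \<in> borel_measurable (GEM t)" for n
    unfolding stick_def by measurable
qed simp_all

lemma stick_case_nat: "stick (case_nat x B) = stick_cons x (stick B)"
proof
  fix n
  show "stick (case_nat x B) n = stick_cons x (stick B) n"
    by (cases n) (simp_all add: stick_def prod.lessThan_Suc_shift mult_ac del: prod.lessThan_Suc)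
qed

lemma stick_subprob:
  assumes B: "\<And>n. 0 < B n \<and> B n < 1"
  shows "stick B \<in> subprob"
proof -
  have nn: "0 \<le> stick B n" for n
    unfolding stick_def using B by (intro mult_nonneg_nonneg prod_nonneg) (auto intro: less_imp_le)
  have "(\<Sum>n<m. stick B n) = 1 - (\<Prod>j<m. 1 - B j)" for m
    by (induction m) (auto simp: stick_def algebra_simps)
  moreover have "0 \<le> (\<Prod>j<m. 1 - B j)" for m using B by (intro prod_nonneg) (auto intro: less_imp_le)
  ultimately have le: "(\<Sum>n<m. stick B n) \<le> 1" for m by simp
  have "summable (stick B)" using nn le by (rule summableI_nonneg_bounded)
  then show ?thesis using nn le by (simp add: subprob_def suminf_le_const)
qed

context
  fixes t :: real
  assumes t: "0 < t"
begin

lemma sequence_space_beta1: "sequence_space (beta1 t)"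
  unfolding sequence_space_def using prob_space_beta1[OF t] by (intro product_prob_spaceI)

lemma prob_space_GEM: "prob_space (GEM t)"
  unfolding GEM_def by (intro prob_space_PiM prob_space_beta1 t)

lemma AE_stick_subprob: "AE B in GEM t. stick B \<in> subprob"
proof -
  have "AE B in GEM t. 0 < B n \<and> B n < 1" for n
    unfolding GEM_def
    by (rule AE_PiM_component[where P = "\<lambda>x. 0 < x \<and> x < 1"]) (rule prob_space_beta1[OF t] UNIV_I AE_beta1)+
  then have "AE B in GEM t. \<forall>n. 0 < B n \<and> B n < 1" by (simp add: AE_all_countable)
  then show ?thesis by eventually_elim (rule stick_subprob, blast)
qed

lemma integrable_stick:
  assumes \<Phi>: "\<Phi> \<in> borel_measurable (Pi\<^sub>M UNIV (\<lambda>_. borel))" and K: "\<And>y. y \<in> subprob \<Longrightarrow> \<bar>\<Phi> y\<bar> \<le> (K::real)"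
  shows "integrable (GEM t) (\<lambda>B. \<Phi> (stick B))"
proof -
  interpret prob_space "GEM t" by (rule prob_space_GEM)
  show ?thesis
  proof (rule integrable_const_bound)
    show "AE B in GEM t. norm (\<Phi> (stick B)) \<le> K"
      using AE_stick_subprob by eventually_elim (simp add: K)
    show "(\<lambda>B. \<Phi> (stick B)) \<in> borel_measurable (GEM t)"
      using measurable_stick \<Phi> by (rule measurable_compose)
  qed
qed

lemma GEM_mean_diff_le:
  assumes \<Phi>: "\<Phi> \<in> borel_measurable (Pi\<^sub>M UNIV (\<lambda>_. borel))" "\<And>y. y \<in> subprob \<Longrightarrow> \<bar>\<Phi> y\<bar> \<le> K1"
    and \<Psi>: "\<Psi> \<in> borel_measurable (Pi\<^sub>M UNIV (\<lambda>_. borel))" "\<And>y. y \<in> subprob \<Longrightarrow> \<bar>\<Psi> y\<bar> \<le> K2"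
    and le: "\<And>y. y \<in> subprob \<Longrightarrow> \<bar>\<Phi> y - \<Psi> y\<bar> \<le> K"
  shows "\<bar>GEM_mean t \<Phi> - GEM_mean t \<Psi>\<bar> \<le> K"
proof -
  interpret prob_space "GEM t" by (rule prob_space_GEM)
  note i = integrable_stick[OF \<Phi>] integrable_stick[OF \<Psi>]
  have "\<bar>GEM_mean t \<Phi> - GEM_mean t \<Psi>\<bar> = \<bar>\<integral>B. \<Phi> (stick B) - \<Psi> (stick B) \<partial>GEM t\<bar>"
    unfolding GEM_mean_def by (simp add: Bochner_Integration.integral_diff[OF i])
  also have "\<dots> \<le> (\<integral>B. \<bar>\<Phi> (stick B) - \<Psi> (stick B)\<bar> \<partial>GEM t)" by (rule integral_abs_bound)
  also have "\<dots> \<le> (\<integral>B. K \<partial>GEM t)"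
  proof (rule integral_mono_AE)
    show "AE B in GEM t. \<bar>\<Phi> (stick B) - \<Psi> (stick B)\<bar> \<le> K"
      using AE_stick_subprob by eventually_elim (rule le)
  qed (use i in auto)
  also have "\<dots> = K" using prob_space by simp
  finally show ?thesis .
qed

lemma GEM_mean_const: "GEM_mean t (\<lambda>_. c) = c"
proof -
  interpret prob_space "GEM t" by (rule prob_space_GEM)
  show ?thesis unfolding GEM_mean_def using prob_space by simp
qed

lemma lip_fun_abs_bound: "lip_fun L \<Phi> \<Longrightarrow> 0 \<le> L \<Longrightarrow> y \<in> subprob \<Longrightarrow> \<bar>\<Phi> y\<bar> \<le> \<bar>\<Phi> (\<lambda>_. 0)\<bar> + L"
  using lip_fun_bound[of L \<Phi> y] by linarith

lemma GEM_mean_bound: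
  assumes "lip_fun L \<Phi>" "0 \<le> L"
  shows "\<bar>GEM_mean t \<Phi> - \<Phi> (\<lambda>_. 0)\<bar> \<le> L"
  using GEM_mean_diff_le[of \<Phi> "\<bar>\<Phi> (\<lambda>_. 0)\<bar> + L" "\<lambda>_. \<Phi> (\<lambda>_. 0)" "\<bar>\<Phi> (\<lambda>_. 0)\<bar>" L] assms lip_fun_abs_bound[OF assms] lip_fun_bound[OF assms]
  by (simp add: GEM_mean_const lip_fun_def)

lemma measurable_stick_cons_stick: "(\<lambda>(x, B). stick_cons x (stick B)) \<in> measurable (beta1 t \<Otimes>\<^sub>M GEM t) (Pi\<^sub>M UNIV (\<lambda>_. borel))"
proof -
  have "fst \<in> borel_measurable (beta1 t \<Otimes>\<^sub>M GEM t)"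
    using measurable_fst[of "beta1 t" "GEM t"] measurable_cong_sets[OF refl sets_beta1] by blast
  moreover have "(\<lambda>p. stick (snd p)) \<in> measurable (beta1 t \<Otimes>\<^sub>M GEM t) (Pi\<^sub>M UNIV (\<lambda>_. borel))"
    by (rule measurable_compose[OF measurable_snd measurable_stick])
  ultimately have "(\<lambda>p. stick_cons (fst p) (stick (snd p))) \<in> measurable (beta1 t \<Otimes>\<^sub>M GEM t) (Pi\<^sub>M UNIV (\<lambda>_. borel))"
    by (rule measurable_stick_cons)
  then show ?thesis by (simp add: split_beta')
qed

text \<open>The counterpart of \<open>scaled_mean_rec\<close> in the limit: the first fraction of an
  independent sequence is split off, and Fubini's theorem applies.\<close>

lemma GEM_mean_first_pick:
  assumes \<Phi>: "lip_fun L \<Phi>" and L: "0 \<le> L"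
  shows "(\<lambda>x. GEM_mean t (\<lambda>y. \<Phi> (stick_cons x y))) \<in> borel_measurable borel"
    and "GEM_mean t \<Phi> = (\<integral>x. GEM_mean t (\<lambda>y. \<Phi> (stick_cons x y)) \<partial>beta1 t)"
proof -
  interpret sequence_space "beta1 t" by (rule sequence_space_beta1)
  interpret b: prob_space "beta1 t" by (rule prob_space_beta1[OF t])
  interpret G: prob_space "GEM t" by (rule prob_space_GEM)
  interpret P: pair_sigma_finite "beta1 t" "GEM t" ..
  have \<Phi>m: "\<Phi> \<in> borel_measurable (Pi\<^sub>M UNIV (\<lambda>_. borel))" using \<Phi> by (simp add: lip_fun_def)
  have m: "(\<lambda>(x, B). \<Phi> (stick_cons x (stick B))) \<in> borel_measurable (beta1 t \<Otimes>\<^sub>M GEM t)"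
    using measurable_compose[OF measurable_stick_cons_stick \<Phi>m] by (simp add: split_beta')
  have "(\<lambda>x. GEM_mean t (\<lambda>y. \<Phi> (stick_cons x y))) \<in> borel_measurable (beta1 t)"
    unfolding GEM_mean_def using m by (rule G.borel_measurable_lebesgue_integral)
  then show "(\<lambda>x. GEM_mean t (\<lambda>y. \<Phi> (stick_cons x y))) \<in> borel_measurable borel"
    by (simp add: measurable_cong_sets[OF sets_beta1 refl])
  have iter: "distr (beta1 t \<Otimes>\<^sub>M GEM t) (GEM t) (\<lambda>(x, B). case_nat x B) = GEM t"
    using PiM_iter unfolding GEM_def .
  have mc: "(\<lambda>(x, B). case_nat x B) \<in> measurable (beta1 t \<Otimes>\<^sub>M GEM t) (GEM t)"
    unfolding GEM_def by measurable
  have ms: "(\<lambda>B. \<Phi> (stick B)) \<in> borel_measurable (GEM t)"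
    using measurable_stick \<Phi>m by (rule measurable_compose)
  have eq: "\<Phi> (stick (case p of (x, B) \<Rightarrow> case_nat x B)) = (case p of (x, B) \<Rightarrow> \<Phi> (stick_cons x (stick B)))" for p
    by (cases p) (simp add: stick_case_nat)
  have "integrable (GEM t) (\<lambda>B. \<Phi> (stick B))"
    by (rule integrable_stick[OF \<Phi>m lip_fun_abs_bound[OF \<Phi> L]])
  then have "integrable (beta1 t \<Otimes>\<^sub>M GEM t) (\<lambda>p. \<Phi> (stick (case p of (x, B) \<Rightarrow> case_nat x B)))"
    using integrable_distr_eq[OF mc ms] unfolding iter by simp
  then have int: "integrable (beta1 t \<Otimes>\<^sub>M GEM t) (\<lambda>(x, B). \<Phi> (stick_cons x (stick B)))"
    unfolding eq .
  have "GEM_mean t \<Phi> = (\<integral>p. \<Phi> (stick (case p of (x, B) \<Rightarrow> case_nat x B)) \<partial>(beta1 t \<Otimes>\<^sub>M GEM t))"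
    unfolding GEM_mean_def using integral_distr[OF mc ms] unfolding iter by simp
  also have "\<dots> = (\<integral>(x, B). \<Phi> (stick_cons x (stick B)) \<partial>(beta1 t \<Otimes>\<^sub>M GEM t))" unfolding eq ..
  also have "\<dots> = (\<integral>x. GEM_mean t (\<lambda>y. \<Phi> (stick_cons x y)) \<partial>beta1 t)"
    unfolding GEM_mean_def using P.integral_fst'[OF int] by simp
  finally show "GEM_mean t \<Phi> = (\<integral>x. GEM_mean t (\<lambda>y. \<Phi> (stick_cons x y)) \<partial>beta1 t)" .
qed

text \<open>The contraction factor: the mean share that is left after the first break.\<close>

lemma integral_beta1_complement: "(\<integral>x. 1 - x \<partial>beta1 t) = t / (t + 1)"
proof -
  have "(\<integral>x. 1 - x \<partial>beta1 t) = (\<integral>x. t * (indicator {0<..<1} x * (1 - x) powr ((t + 1) - 1)) \<partial>lborel)"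
    unfolding integral_beta1[OF t, of "\<lambda>x. 1 - x", simplified]
  proof (intro Bochner_Integration.integral_cong refl)
    fix x :: real
    show "beta_density t x * (1 - x) = t * (indicator {0<..<1} x * (1 - x) powr ((t + 1) - 1))"
      by (cases "0 < x \<and> x < 1") (auto simp: beta_density_def powr_diff)
  qed
  also have "\<dots> = t * (1 / (t + 1))"
    using has_bochner_integral_powr_Ioo[of "t + 1"] t by (simp add: has_bochner_integral_iff)
  finally show ?thesis by simp
qed

end

section \<open>Contraction of the stick-breaking recursion\<close>

context log_weights
begin

text \<open>For large m, D bounds the Kantorovich distance, dual to Lipschitz functions, between the
  scaled cycle list and the stick sequence. The functions are quantified inside
  \<open>eventually\<close> because a step of the recursion replaces \<Phi> by functions that depend
  on m.\<close>

definition approx :: "real \<Rightarrow> bool" where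
  "approx D \<longleftrightarrow> 0 \<le> D \<and> eventually (\<lambda>m. \<forall>L \<Phi>. 0 \<le> L \<longrightarrow> lip_fun L \<Phi> \<longrightarrow> \<bar>scaled_mean v m \<Phi> - GEM_mean t \<Phi>\<bar> \<le> D * L) sequentially"

lemma eventually_q_pos: "eventually (\<lambda>m. 0 < q m) sequentially"
  using eventually_q_lower by (rule eventually_mono) simp

lemma scaled_mean_GEM_mean_le_2:
  assumes "0 < q m" "0 \<le> L" "lip_fun L \<Phi>"
  shows "\<bar>scaled_mean v m \<Phi> - GEM_mean t \<Phi>\<bar> \<le> 2 * L"
  using scaled_mean_bound[OF assms(3,2) v_nonneg assms(1)] GEM_mean_bound[OF t assms(3,2)] by linarith

lemma approx_2: "approx 2"
  unfolding approx_def using eventually_q_pos by (auto elim!: eventually_mono intro: scaled_mean_GEM_mean_le_2)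

lemma approx_mono:
  assumes D: "approx D" and le: "D \<le> D'"
  shows "approx D'"
  unfolding approx_def
proof
  show "0 \<le> D'" using assms by (simp add: approx_def)
  show "eventually (\<lambda>m. \<forall>L \<Phi>. 0 \<le> L \<longrightarrow> lip_fun L \<Phi> \<longrightarrow> \<bar>scaled_mean v m \<Phi> - GEM_mean t \<Phi>\<bar> \<le> D' * L) sequentially"
    using D[unfolded approx_def, THEN conjunct2]
  proof eventually_elim
    case (elim m)
    show ?case
    proof (intro allI impI)
      fix L \<Phi> assume L: "(0::real) \<le> L" and \<Phi>: "lip_fun L \<Phi>"
      have "\<bar>scaled_mean v m \<Phi> - GEM_mean t \<Phi>\<bar> \<le> D * L" using elim L \<Phi> by simp
      also have "\<dots> \<le> D' * L" using le L by (rule mult_right_mono)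
      finally show "\<bar>scaled_mean v m \<Phi> - GEM_mean t \<Phi>\<bar> \<le> D' * L" .
    qed
  qed
qed

text \<open>Exposing the first size-biased cycle, of relative size \<open>x\<close>, multiplies the Lipschitz constant by \<open>1 - x\<close>,
  whose limiting mean is \<open>t / (t + 1) < 1\<close>.\<close>
lemma approx_step:
  assumes D: "approx D" and e: "0 < e"
  shows "approx (t / (t + 1) * D + e)"
proof -
  have D0: "0 \<le> D" using D by (simp add: approx_def)
  obtain m0 where m0: "\<And>m L \<Phi>. m \<ge> m0 \<Longrightarrow> 0 \<le> L \<Longrightarrow> lip_fun L \<Phi> \<Longrightarrow> \<bar>scaled_mean v m \<Phi> - GEM_mean t \<Phi>\<bar> \<le> D * L"
    using D unfolding approx_def eventually_sequentially by blast
  \<comment> \<open>All error terms of the step together: \<open>err m\<close> once from the law of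
    the first cycle and D times from its mean remaining share, and the last term from cycles that
    leave fewer than \<open>m0\<close> points.\<close>
  have "(\<lambda>m. err m * (D + 1) + 2 * real m0 / real m) \<longlonglongrightarrow> 0 * (D + 1) + 0"
    by (intro tendsto_intros err_tendsto lim_const_over_n)
  then have "eventually (\<lambda>m. err m * (D + 1) + 2 * real m0 / real m < e) sequentially"
    using e by (intro order_tendstoD(2)) auto
  then have "eventually (\<lambda>m. \<forall>L \<Phi>. 0 \<le> L \<longrightarrow> lip_fun L \<Phi> \<longrightarrow> \<bar>scaled_mean v m \<Phi> - GEM_mean t \<Phi>\<bar> \<le> (t / (t + 1) * D + e) * L) sequentially"
    using eventually_q_pos eventually_gt_at_top[of 0]
  proof eventually_elim
    case (elim m)
    have sW: "(\<Sum>j\<in>{1..m}. W m j) = 1" by (rule sum_W) fact+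
    show ?case
    proof (intro allI impI)
      fix L \<Phi> assume L: "(0::real) \<le> L" and \<Phi>: "lip_fun L \<Phi>"
      define \<psi> where "\<psi> = (\<lambda>x. GEM_mean t (\<lambda>y. \<Phi> (stick_cons x y)))"
      let ?c = "\<Phi> (\<lambda>_. 0)"
      have lipx: "lip_fun (L * (1 - x)) (\<lambda>y. \<Phi> (stick_cons x y))" if "0 \<le> x" "x \<le> 1" for x
        by (rule lip_fun_stick_cons[OF \<Phi> that])
      have bx: "\<bar>\<Phi> (stick_cons x y)\<bar> \<le> \<bar>?c\<bar> + L" if "0 \<le> x" "x \<le> 1" "y \<in> subprob" for x y
        using lip_fun_abs_bound[OF t \<Phi> L subprob_stick_cons[OF that]] .
      have \<psi>m: "\<psi> \<in> borel_measurable borel" unfolding \<psi>_def by (rule GEM_mean_first_pick(1)[OF t \<Phi> L])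
      have \<psi>b: "\<bar>\<psi> x - ?c\<bar> \<le> L" if x: "0 \<le> x" "x \<le> 1" for x
      proof -
        have "\<bar>\<psi> x - GEM_mean t (\<lambda>_. ?c)\<bar> \<le> L"
          unfolding \<psi>_def
        proof (rule GEM_mean_diff_le[OF t])
          show "(\<lambda>y. \<Phi> (stick_cons x y)) \<in> borel_measurable (Pi\<^sub>M UNIV (\<lambda>_. borel))"
            using lipx[OF x] by (simp add: lip_fun_def)
          show "\<bar>\<Phi> (stick_cons x y) - ?c\<bar> \<le> L" if "y \<in> subprob" for y
            by (rule lip_fun_bound[OF \<Phi> L subprob_stick_cons[OF x that]])
        qed (use bx[OF x] in auto)
        then show ?thesis by (simp add: GEM_mean_const[OF t])
      qed
      have \<psi>l: "\<bar>\<psi> x - \<psi> x'\<bar> \<le> 2 * L * \<bar>x - x'\<bar>" if x: "0 \<le> x" "x \<le> 1" and x': "0 \<le> x'" "x' \<le> 1" for x x'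
        unfolding \<psi>_def
      proof (rule GEM_mean_diff_le[OF t])
        show "(\<lambda>y. \<Phi> (stick_cons x y)) \<in> borel_measurable (Pi\<^sub>M UNIV (\<lambda>_. borel))"
          using lipx[OF x] by (simp add: lip_fun_def)
        show "(\<lambda>y. \<Phi> (stick_cons x' y)) \<in> borel_measurable (Pi\<^sub>M UNIV (\<lambda>_. borel))"
          using lipx[OF x'] by (simp add: lip_fun_def)
        fix y assume y: "y \<in> subprob"
        show "\<bar>\<Phi> (stick_cons x y) - \<Phi> (stick_cons x' y)\<bar> \<le> 2 * L * \<bar>x - x'\<bar>"
          using lip_funD[OF \<Phi> subprob_stick_cons[OF x y] subprob_stick_cons[OF x' y]] mult_left_mono[OF l1_dist_stick_cons_arg[OF y, of x x'] L] by simp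
      qed (use bx[OF x] bx[OF x'] in auto)
      have second: "\<bar>(\<Sum>j\<in>{1..m}. W m j * \<psi> (real j / real m)) - GEM_mean t \<Phi>\<bar> \<le> err m * L"
      proof -
        interpret b: prob_space "beta1 t" by (rule prob_space_beta1[OF t])
        have "integrable (beta1 t) \<psi>"
        proof (rule b.integrable_const_bound)
          show "AE x in beta1 t. norm (\<psi> x) \<le> \<bar>?c\<bar> + L"
            using AE_beta1
          proof eventually_elim
            case (elim x)
            then show ?case using \<psi>b[of x] by simp
          qed
          show "\<psi> \<in> borel_measurable (beta1 t)" using \<psi>m by (simp add: measurable_cong_sets[OF sets_beta1 refl])
        qed
        then have "(\<integral>x. \<psi> x - ?c \<partial>beta1 t) = GEM_mean t \<Phi> - ?c"
          using GEM_mean_first_pick(2)[OF t \<Phi> L] b.prob_space by (simp add: \<psi>_def)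
        moreover have "(\<Sum>j\<in>{1..m}. W m j * (\<psi> (real j / real m) - ?c)) = (\<Sum>j\<in>{1..m}. W m j * \<psi> (real j / real m)) - ?c"
          using sW by (simp add: right_diff_distrib sum_subtractf flip: sum_distrib_right)
        moreover have "\<bar>(\<Sum>j\<in>{1..m}. W m j * (\<psi> (real j / real m) - ?c)) - (\<integral>x. \<psi> x - ?c \<partial>beta1 t)\<bar> \<le> err m * L"
          using \<psi>m \<psi>b \<psi>l by (intro first_pick elim(3) L) auto
        ultimately show ?thesis by simp
      qed
      \<comment> \<open>\<open>first_pick\<close> applied to the function 1 - x evaluates the mean
        factor by which the Lipschitz constant shrinks.\<close>
      have third: "(\<Sum>j\<in>{1..m}. W m j * (1 - real j / real m)) \<le> t / (t + 1) + err m"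
      proof -
        have "\<bar>(\<Sum>j\<in>{1..m}. W m j * (1 - real j / real m)) - (\<integral>x. 1 - x \<partial>beta1 t)\<bar> \<le> err m * 1"
          by (intro first_pick elim(3)) (auto simp: abs_if)
        then show ?thesis unfolding integral_beta1_complement[OF t] by linarith
      qed
      have first: "\<bar>scaled_mean v m \<Phi> - (\<Sum>j\<in>{1..m}. W m j * \<psi> (real j / real m))\<bar> \<le> (D * (t / (t + 1) + err m) + 2 * real m0 / real m) * L"
      proof -
        have "scaled_mean v m \<Phi> = (\<Sum>j\<in>{1..m}. W m j * scaled_mean v (m - j) (\<lambda>y. \<Phi> (stick_cons (real j / real m) y)))"
          unfolding W_def by (rule scaled_mean_rec[OF \<Phi> L v_nonneg elim(3,2)])
        then have "\<bar>scaled_mean v m \<Phi> - (\<Sum>j\<in>{1..m}. W m j * \<psi> (real j / real m))\<bar>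
          = \<bar>\<Sum>j\<in>{1..m}. W m j * (scaled_mean v (m - j) (\<lambda>y. \<Phi> (stick_cons (real j / real m) y)) - \<psi> (real j / real m))\<bar>"
          by (simp add: right_diff_distrib sum_subtractf)
        also have "\<dots> \<le> (\<Sum>j\<in>{1..m}. W m j * (D * L * (1 - real j / real m) + 2 * L * real m0 / real m))"
        proof (rule order_trans[OF sum_abs], rule sum_mono)
          fix j assume j: "j \<in> {1..m}"
          let ?x = "real j / real m"
          have x: "0 \<le> ?x" "?x \<le> 1" using j elim(3) by auto
          have Lx: "0 \<le> L * (1 - ?x)" using L x by simp
          have r: "0 \<le> D * L * (1 - ?x)" "0 \<le> 2 * L * real m0 / real m" using D0 L x by auto
          show "\<bar>W m j * (scaled_mean v (m - j) (\<lambda>y. \<Phi> (stick_cons ?x y)) - \<psi> ?x)\<bar> \<le> W m j * (D * L * (1 - ?x) + 2 * L * real m0 / real m)"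
          proof (cases "q (m - j) = 0")
            case True
            then have "W m j = 0" by (simp add: W_def)
            then show ?thesis by simp
          next
            case False
            then have qp: "0 < q (m - j)" using q_nonneg[of "m - j"] by simp
            have "\<bar>scaled_mean v (m - j) (\<lambda>y. \<Phi> (stick_cons ?x y)) - \<psi> ?x\<bar> \<le> D * L * (1 - ?x) + 2 * L * real m0 / real m"
            proof (cases "m0 \<le> m - j")
              case True
              then show ?thesis unfolding \<psi>_def using m0[OF True Lx lipx[OF x]] r by (simp add: mult.assoc)
            next
              case False
              have "1 - ?x = real (m - j) / real m" using j elim(3) by (simp add: of_nat_diff field_simps)
              also have "\<dots> \<le> real m0 / real m" using False by (intro divide_right_mono) auto
              finally have "2 * (L * (1 - ?x)) \<le> 2 * (L * (real m0 / real m))" using L by (intro mult_left_mono) auto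
              then show ?thesis unfolding \<psi>_def using scaled_mean_GEM_mean_le_2[OF qp Lx lipx[OF x]] r by simp
            qed
            then show ?thesis using W_nonneg[of m j] by (simp add: abs_mult mult_left_mono)
          qed
        qed
        also have "\<dots> = D * L * (\<Sum>j\<in>{1..m}. W m j * (1 - real j / real m)) + 2 * L * real m0 / real m * (\<Sum>j\<in>{1..m}. W m j)"
          unfolding sum_distrib_left sum.distrib[symmetric] by (intro sum.cong refl) (simp add: algebra_simps)
        also have "\<dots> \<le> D * L * (t / (t + 1) + err m) + 2 * L * real m0 / real m * 1"
          using third D0 L unfolding sW by (intro add_mono mult_left_mono) auto
        finally show ?thesis by (simp add: algebra_simps)
      qed
      have "\<bar>scaled_mean v m \<Phi> - GEM_mean t \<Phi>\<bar> \<le> (D * (t / (t + 1) + err m) + 2 * real m0 / real m) * L + err m * L"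
        using first second by linarith
      also have "\<dots> = (t / (t + 1) * D + (err m * (D + 1) + 2 * real m0 / real m)) * L" by (simp add: algebra_simps)
      also have "\<dots> \<le> (t / (t + 1) * D + e) * L" using elim(1) L by (intro mult_right_mono) auto
      finally show "\<bar>scaled_mean v m \<Phi> - GEM_mean t \<Phi>\<bar> \<le> (t / (t + 1) * D + e) * L" .
    qed
  qed
  then show ?thesis using D0 e t by (simp add: approx_def)
qed

lemma approx_all:
  assumes r: "0 < r"
  shows "approx r"
proof -
  define l where "l = t / (t + 1)"
  have l: "0 \<le> l" "l < 1" using t by (auto simp: l_def)
  \<comment> \<open>With this value r / 2 is the fixed point of the map sending D to l D + e, and it
    is approached geometrically.\<close>
  define e where "e = r * (1 - l) / 2"
  have e: "0 < e" using r l by (simp add: e_def)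
  have "approx (l ^ n * 2 + r / 2)" for n
  proof (induction n)
    case 0
    show ?case by (rule approx_mono[OF approx_2]) (use r in simp)
  next
    case (Suc n)
    have "l * (l ^ n * 2 + r / 2) + e = l ^ Suc n * 2 + r / 2" by (simp add: e_def field_simps)
    then show ?case using approx_step[OF Suc e] unfolding l_def by simp
  qed
  moreover have "\<exists>n. l ^ n < r / 4" using l r by (intro real_arch_pow_inv) auto
  ultimately obtain n where n: "approx (l ^ n * 2 + r / 2)" "l ^ n < r / 4" by blast
  from n(1) show ?thesis by (rule approx_mono) (use n(2) in simp)
qed

end

section \<open>The condensation limit\<close>

lemma dec_rearr_bounds:
  assumes Y: "\<And>n. Y n \<le> b" and b: "0 \<le> b"
  shows "0 \<le> dec_rearr Y i" "dec_rearr Y i \<le> b"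
proof -
  have ne: "rearr_levels Y i \<noteq> {}" by (rule rearr_levels_nonempty, rule bdd_aboveI2, rule Y)
  have "dec_rearr Y i \<in> rearr_levels Y i" using dec_rearr_le_iff[OF ne, of "dec_rearr Y i"] by simp
  then show "0 \<le> dec_rearr Y i" by (simp add: rearr_levels_def)
  have "b \<in> rearr_levels Y i"
    unfolding rearr_levels_def
  proof (intro CollectI conjI ballI b)
    fix F :: "nat set" assume "F \<in> {F. finite F \<and> card F = Suc i}"
    then have "F \<noteq> {}" by auto
    then show "\<exists>n\<in>F. Y n \<le> b" using Y by auto
  qed
  then show "dec_rearr Y i \<le> b" using dec_rearr_le_iff[OF ne] by simp
qed

lemma dec_rearr_l1_dist:
  assumes y: "y \<in> subprob" "y' \<in> subprob"
  shows "\<bar>dec_rearr y i - dec_rearr y' i\<bar> \<le> l1_dist y y'"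
proof (rule dec_rearr_lipschitz)
  have le1: "y n \<le> 1" if "y \<in> subprob" for y n
    using that sum_le_suminf[of y "{n}"] by (auto simp: subprob_def intro: order_trans)
  show "bdd_above (range y)" "bdd_above (range y')" using y by (auto intro!: bdd_aboveI2 le1)
  show "\<bar>y n - y' n\<bar> \<le> l1_dist y y'" for n
    unfolding l1_dist_def using sum_le_suminf[OF subprob_summable_diff[OF y], of "{n}"] by simp
qed

section \<open>Lipschitz functions of finitely many coordinates\<close>

definition coord_lip :: "nat \<Rightarrow> real \<Rightarrow> ((nat \<Rightarrow> real) \<Rightarrow> real) \<Rightarrow> bool" where
  "coord_lip k L h \<longleftrightarrow> (\<forall>u u'. \<bar>h u - h u'\<bar> \<le> L * (\<Sum>i<k. \<bar>u i - u' i\<bar>))"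

lemma coord_lip_measurable:
  assumes h: "coord_lip k L h"
  shows "h \<in> borel_measurable (Pi\<^sub>M UNIV (\<lambda>_. borel))"
proof -
  have "continuous_on UNIV h"
    unfolding continuous_on_def
  proof
    fix x :: "nat \<Rightarrow> real"
    have c: "((\<lambda>u. u i) \<longlongrightarrow> x i) (at x within UNIV)" for i
      using continuous_on_product_coordinates[of i] unfolding continuous_on_def by blast
    have "((\<lambda>u. L * (\<Sum>i<k. \<bar>u i - x i\<bar>)) \<longlongrightarrow> L * (\<Sum>i<k. \<bar>x i - x i\<bar>)) (at x within UNIV)"
      by (intro tendsto_mult tendsto_const tendsto_sum tendsto_rabs tendsto_diff c)
    then have "((\<lambda>u. h u - h x) \<longlongrightarrow> 0) (at x within UNIV)"
      using h by (intro Lim_null_comparison[of "\<lambda>u. h u - h x" "\<lambda>u. L * (\<Sum>i<k. \<bar>u i - x i\<bar>)"])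
        (auto simp: coord_lip_def)
    then show "(h \<longlongrightarrow> h x) (at x within UNIV)" by (simp add: LIM_zero_iff)
  qed
  then show ?thesis
    using borel_measurable_continuous_onI measurable_cong_sets[OF sets_PiM_equal_borel refl] by blast
qed

lemma measurable_dec_rearr_seq: "dec_rearr \<in> measurable (Pi\<^sub>M UNIV (\<lambda>_. borel)) (Pi\<^sub>M UNIV (\<lambda>_. borel))"
  by (rule measurable_PiM_single') simp_all

text \<open>Each of the k ordered coordinates moves by at most \<open>l1_dist\<close>; this is what
  carries the limit from size-biased to decreasing order.\<close>

lemma lip_fun_dec_rearr:
  assumes h: "coord_lip k L h" and L: "0 \<le> L"
  shows "lip_fun (L * real k) (\<lambda>y. h (dec_rearr y))"
  unfolding lip_fun_def
proof (intro conjI ballI)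
  show "(\<lambda>y. h (dec_rearr y)) \<in> borel_measurable (Pi\<^sub>M UNIV (\<lambda>_. borel))"
    using measurable_dec_rearr_seq coord_lip_measurable[OF h] by (rule measurable_compose)
  fix y y' assume y: "y \<in> subprob" "y' \<in> subprob"
  have "\<bar>h (dec_rearr y) - h (dec_rearr y')\<bar> \<le> L * (\<Sum>i<k. \<bar>dec_rearr y i - dec_rearr y' i\<bar>)"
    using h by (simp add: coord_lip_def)
  also have "\<dots> \<le> L * (\<Sum>i<k. l1_dist y y')" using L by (intro mult_left_mono sum_mono dec_rearr_l1_dist y)
  finally show "\<bar>h (dec_rearr y) - h (dec_rearr y')\<bar> \<le> L * real k * l1_dist y y'" by simp
qed

definition coord_box :: "nat \<Rightarrow> real \<Rightarrow> (nat \<Rightarrow> real) set" where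
  "coord_box k b = {u. \<forall>i. if i < k then 0 \<le> u i \<and> u i \<le> b else u i = 0}"

lemma compact_coord_box: "compact (coord_box k b)"
proof -
  have "coord_box k b = PiE UNIV (\<lambda>i. if i < k then {0..b} else {0})"
    by (auto simp: coord_box_def PiE_UNIV_domain Pi_def)
  moreover have "compactin (product_topology (\<lambda>_. euclidean) UNIV) (PiE UNIV (\<lambda>i. if i < k then {0..b} else {0::real}))"
    unfolding compactin_PiE by auto
  ultimately show ?thesis by (simp add: euclidean_product_topology)
qed

text \<open>Inf-convolution of g with a metric of slope L over the compact box. Points closer than d
  change g by less than e; for farther ones the penalty is at least L d = 2 M, which outweighs any
  gain because |g| \<le> M.\<close>

lemma lipschitz_approximation:
  fixes g :: "(nat \<Rightarrow> real) \<Rightarrow> real"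
  assumes g: "continuous_on UNIV g" and M: "\<And>y. \<bar>g y\<bar> \<le> M" and b: "0 \<le> b" and e: "0 < e"
  obtains L h where "0 \<le> L" "coord_lip k L h" "\<And>u. u \<in> coord_box k b \<Longrightarrow> \<bar>h u - g u\<bar> \<le> e"
proof -
  let ?d = "\<lambda>u z. \<Sum>i<k. \<bar>u i - z i\<bar> :: real"
  have M0: "0 \<le> M" using order_trans[OF abs_ge_zero M] .
  have "uniformly_continuous_on (coord_box k b) g"
    using compact_coord_box g by (intro compact_uniformly_continuous continuous_on_subset[OF g]) auto
  then obtain d1 where d1: "0 < d1" "\<And>x y. x \<in> coord_box k b \<Longrightarrow> y \<in> coord_box k b \<Longrightarrow> dist x y < d1 \<Longrightarrow> dist (g x) (g y) < e"
    using e unfolding uniformly_continuous_on_def by (metis dist_commute)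
  \<comment> \<open>The metric of the product space is at most twice the largest of the first
    coordinate distances plus (1/2)^m. With coordinate distances at most d = d1 / 4 this stays below
    \<open>d1\<close>.\<close>
  obtain m :: nat where m: "(1/2) ^ m < d1 / 2" using real_arch_pow_inv[of "d1 / 2" "1/2"] d1 by auto
  define d where "d = d1 / 4"
  have d: "0 < d" using d1 by (simp add: d_def)
  have unif: "\<bar>g x - g y\<bar> < e" if xy: "x \<in> coord_box k b" "y \<in> coord_box k b" and le: "?d x y < d" for x y
  proof -
    have coord: "dist (x i) (y i) \<le> d" for i
    proof (cases "i < k")
      case True
      then have "\<bar>x i - y i\<bar> \<le> ?d x y" by (intro member_le_sum) auto
      then show ?thesis using le by (simp add: dist_real_def)
    next
      case False
      then have "x i = 0" "y i = 0" using xy by (auto simp: coord_box_def)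
      then show ?thesis using d by simp
    qed
    have "{dist (x (from_nat n)) (y (from_nat n)) |n. n \<le> m} = (\<lambda>n. dist (x (from_nat n)) (y (from_nat n))) ` {..m}" by auto
    then have "Max {dist (x (from_nat n)) (y (from_nat n)) |n. n \<le> m} \<le> d"
      using coord by (subst Max_le_iff) auto
    then have "dist x y \<le> 2 * d + (1/2) ^ m"
      using dist_fun_le_dist_first_terms[of x y m] by linarith
    then have "dist x y < d1" using m by (simp add: d_def)
    then show ?thesis using d1(2)[OF xy] by (simp add: dist_real_def)
  qed
  define L where "L = 2 * M / d"
  have L: "0 \<le> L" using M0 d by (simp add: L_def)
  define h where "h = (\<lambda>u. INF z\<in>coord_box k b. g z + L * ?d u z)"
  have ne: "coord_box k b \<noteq> {}" using b by (auto simp: coord_box_def intro!: exI[of _ "\<lambda>_. 0"])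
  have bdd: "bdd_below ((\<lambda>z. g z + L * ?d u z) ` coord_box k b)" for u
  proof (rule bdd_belowI2)
    fix z
    have "- M \<le> g z" using M[of z] by (simp add: abs_le_iff)
    moreover have "0 \<le> L * ?d u z" using L by (intro mult_nonneg_nonneg sum_nonneg) auto
    ultimately show "- M \<le> g z + L * ?d u z" by linarith
  qed
  have h_le: "h u \<le> h u' + L * ?d u u'" for u u'
  proof -
    have "h u - L * ?d u u' \<le> h u'"
      unfolding h_def
    proof (rule cINF_greatest[OF ne])
      fix z assume z: "z \<in> coord_box k b"
      have "h u \<le> g z + L * ?d u z" unfolding h_def by (rule cINF_lower[OF bdd z])
      also have "?d u z \<le> ?d u u' + ?d u' z"
        unfolding sum.distrib[symmetric] by (intro sum_mono) linarith
      finally have "h u \<le> g z + L * (?d u u' + ?d u' z)" using L by (simp add: mult_left_mono)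
      then show "(INF z\<in>coord_box k b. g z + L * ?d u z) - L * ?d u u' \<le> g z + L * ?d u' z"
        unfolding h_def by (simp add: distrib_left)
    qed
    then show ?thesis by simp
  qed
  have "coord_lip k L h"
    unfolding coord_lip_def
  proof (intro allI)
    fix u u' :: "nat \<Rightarrow> real"
    have "?d u' u = ?d u u'" by (intro sum.cong refl) (simp add: abs_minus_commute)
    then show "\<bar>h u - h u'\<bar> \<le> L * ?d u u'" using h_le[of u u'] h_le[of u' u] by (simp add: abs_le_iff)
  qed
  moreover have "\<bar>h u - g u\<bar> \<le> e" if u: "u \<in> coord_box k b" for u
  proof -
    have "h u \<le> g u + L * ?d u u" unfolding h_def by (rule cINF_lower[OF bdd u])
    moreover have "g u - e \<le> h u"
      unfolding h_def
    proof (rule cINF_greatest[OF ne])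
      fix z assume z: "z \<in> coord_box k b"
      have dnn: "0 \<le> ?d u z" by (intro sum_nonneg) auto
      show "g u - e \<le> g z + L * ?d u z"
      proof (cases "?d u z < d")
        case True
        have "\<bar>g u - g z\<bar> < e" by (rule unif[OF u z True])
        moreover have "0 \<le> L * ?d u z" using L dnn by simp
        ultimately show ?thesis by linarith
      next
        case False
        have "2 * M = L * d" using d by (simp add: L_def)
        also have "\<dots> \<le> L * ?d u z" using False L by (intro mult_left_mono) auto
        finally show ?thesis using M[of u] M[of z] e by (simp add: abs_le_iff)
      qed
    qed
    ultimately show ?thesis by (simp add: abs_le_iff)
  qed
  ultimately show ?thesis using that L by blast
qed

section \<open>Transfer from the \<theta>-cycles to all cycles\<close>

locale condensation = cw: cond_weights w C \<mu> + lw: log_weights v t A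
  for w :: "nat \<Rightarrow> real" and C \<mu> :: real and v :: "nat \<Rightarrow> real" and t A :: real +
  assumes mu_less: "\<mu> < 1" and w_null: "(\<lambda>j. real j * w j) \<longlonglongrightarrow> 0"
begin

sublocale mixed_weights w C \<mu> "cyc_total v" t A
  by unfold_locales (use lw.t lw.A lw.q_nonneg lw.q_asymp mu_less w_null in auto)

definition rescaled :: "nat \<Rightarrow> nat list \<Rightarrow> nat \<Rightarrow> real" where
  "rescaled N xs = pad (map (\<lambda>x. real x / (real N * (1 - \<mu>))) xs)"

lemma rescaled_bounds:
  assumes "sum_list xs \<le> N" "0 < N"
  shows "0 \<le> rescaled N xs n" "rescaled N xs n \<le> 1 / (1 - \<mu>)"
proof -
  show "0 \<le> rescaled N xs n" using mu_less by (simp add: rescaled_def pad_def)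
  show "rescaled N xs n \<le> 1 / (1 - \<mu>)"
  proof (cases "n < length xs")
    case True
    then have "xs ! n \<le> N" using assms elem_le_sum_list order_trans by blast
    then have "real (xs ! n) / real N / (1 - \<mu>) \<le> 1 / (1 - \<mu>)"
      using assms mu_less by (intro divide_right_mono) auto
    then show ?thesis using True by (simp add: rescaled_def pad_def)
  qed (use mu_less in \<open>simp add: rescaled_def pad_def\<close>)
qed

text \<open>Exchanges the deterministic scale N (1 - \<mu>) for the actual number m of points in
  \<theta>-cycles. For m = 0 all entries are zero under both scalings.\<close>

lemma rescaled_scaled_diff:
  assumes ys: "sum_list ys = m" and N: "0 < N" and e: "\<bar>real m / real N - (1 - \<mu>)\<bar> \<le> e"
  shows "\<bar>rescaled N ys n - scaled m ys n\<bar> \<le> e / (1 - \<mu>)"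
proof (cases "n < length ys \<and> 0 < m")
  case True
  have y: "real (ys ! n) / real m \<le> 1" using True ys elem_le_sum_list[of n ys] by simp
  have "real (ys ! n) / (real N * (1 - \<mu>)) - real (ys ! n) / real m = (real (ys ! n) / real m) * ((real m / real N - (1 - \<mu>)) / (1 - \<mu>))"
    using True N mu_less by (simp add: field_simps)
  also have "\<bar>\<dots>\<bar> = (real (ys ! n) / real m) * (\<bar>real m / real N - (1 - \<mu>)\<bar> / (1 - \<mu>))"
    using mu_less by (simp add: abs_mult)
  also have "\<dots> \<le> 1 * (e / (1 - \<mu>))"
    using y e mu_less by (intro mult_mono divide_right_mono) auto
  finally show ?thesis using True by (simp add: rescaled_def scaled_def pad_def)
next
  case False
  have e0: "0 \<le> e / (1 - \<mu>)" using e mu_less by (simp add: order_trans[OF abs_ge_zero e])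
  have "n < length ys \<Longrightarrow> ys ! n = 0" using False ys elem_le_sum_list[of n ys] by auto
  then show ?thesis using e0 by (auto simp: rescaled_def scaled_def pad_def)
qed

text \<open>In the typical case, dropping the \<kappa>-cycles and changing the scale each cost e /
  (1 - \<mu>) per coordinate. Otherwise the trivial bound 2 M is charged to the deviation of l or to
  a \<kappa>-cycle longer than e N.\<close>

lemma pointwise_estimate:
  assumes h: "coord_lip k L h" and L: "0 \<le> L" and N: "0 < N" and e: "0 < e"
    and xs: "sum_list xs = l" and l: "l \<le> N" and ys: "sum_list ys = N - l"
    and M: "M = \<bar>h (\<lambda>_. 0)\<bar> + L * real k / (1 - \<mu>)"
  shows "\<bar>h (dec_rearr (rescaled N (ys @ xs))) - h (dec_rearr (scaled (N - l) ys))\<bar>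
     \<le> 2 * L * real k * e / (1 - \<mu>) + 2 * M * of_bool (e < \<bar>real l / real N - \<mu>\<bar>)
       + 2 * M * sum_list (map (\<lambda>x. of_bool (e * real N < real x)) xs)"
proof -
  let ?cnt = "sum_list (map (\<lambda>x. of_bool (e * real N < real x)) xs) :: real"
  have nu: "0 < 1 - \<mu>" "1 - \<mu> \<le> 1" using mu_less cw.mu_nonneg by auto
  have a0: "0 \<le> 2 * L * real k * e / (1 - \<mu>)" using L e nu by simp
  have M0: "0 \<le> M" unfolding M using L nu by simp
  have cnt0: "0 \<le> ?cnt" by (intro sum_list_nonneg) auto
  have bound: "\<bar>h u\<bar> \<le> M" if "\<And>i. 0 \<le> u i \<and> u i \<le> 1 / (1 - \<mu>)" for u
  proof -
    have "\<bar>h u - h (\<lambda>_. 0)\<bar> \<le> L * (\<Sum>i<k. \<bar>u i - 0\<bar>)" using h unfolding coord_lip_def by blast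
    also have "\<dots> \<le> L * (\<Sum>i<k. 1 / (1 - \<mu>))" using L that by (intro mult_left_mono sum_mono) auto
    finally show ?thesis unfolding M by simp
  qed
  have b1: "\<bar>h (dec_rearr (rescaled N (ys @ xs)))\<bar> \<le> M"
  proof (rule bound)
    have "sum_list (ys @ xs) \<le> N" using xs ys l by simp
    from rescaled_bounds(2)[OF this N] show "0 \<le> dec_rearr (rescaled N (ys @ xs)) i \<and> dec_rearr (rescaled N (ys @ xs)) i \<le> 1 / (1 - \<mu>)" for i
      using nu dec_rearr_bounds[of "rescaled N (ys @ xs)" "1 / (1 - \<mu>)"] by auto
  qed
  have b2: "\<bar>h (dec_rearr (scaled (N - l) ys))\<bar> \<le> M"
  proof (rule bound)
    have "scaled (N - l) ys n \<le> 1" for n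
      using scaled_subprob[OF ys] sum_le_suminf[of "scaled (N - l) ys" "{n}"] by (auto simp: subprob_def intro: order_trans)
    also have "1 \<le> 1 / (1 - \<mu>)" using nu by simp
    finally show "0 \<le> dec_rearr (scaled (N - l) ys) i \<and> dec_rearr (scaled (N - l) ys) i \<le> 1 / (1 - \<mu>)" for i
      using nu dec_rearr_bounds[of "scaled (N - l) ys" "1 / (1 - \<mu>)"] by auto
  qed
  show ?thesis
  proof (cases "e < \<bar>real l / real N - \<mu>\<bar> \<or> (\<exists>x\<in>set xs. e * real N < real x)")
    case True
    have "1 \<le> of_bool (e < \<bar>real l / real N - \<mu>\<bar>) + ?cnt"
    proof (cases "e < \<bar>real l / real N - \<mu>\<bar>")
      case True then show ?thesis using cnt0 by simp
    next
      case False
      then obtain x where x: "x \<in> set xs" "e * real N < real x" using True by auto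
      then obtain p r where pr: "xs = p @ x # r" by (meson split_list)
      have "(0::real) \<le> sum_list (map (\<lambda>x. of_bool (e * real N < real x)) zs)" for zs
        by (intro sum_list_nonneg) auto
      from this[of p] this[of r] show ?thesis using x(2) unfolding pr by simp
    qed
    then have "2 * M * 1 \<le> 2 * M * (of_bool (e < \<bar>real l / real N - \<mu>\<bar>) + ?cnt)" using M0 by (intro mult_left_mono) auto
    then show ?thesis using b1 b2 a0 by (simp add: distrib_left)
  next
    case False
    let ?d = "e / (1 - \<mu>)"
    have small: "real x / (real N * (1 - \<mu>)) \<le> ?d" if "x \<in> set xs" for x
    proof -
      have "real x \<le> e * real N" using False that by (auto simp: not_less)
      then have "real x / real N \<le> e" using N by (simp add: divide_le_eq)
      then have "real x / real N / (1 - \<mu>) \<le> e / (1 - \<mu>)" using nu by (intro divide_right_mono) auto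
      then show ?thesis by simp
    qed
    have d0: "0 \<le> ?d" using e nu by simp
    have 1: "\<bar>dec_rearr (rescaled N (ys @ xs)) i - dec_rearr (rescaled N ys) i\<bar> \<le> ?d" for i
      unfolding rescaled_def map_append using small nu d0 by (intro dec_rearr_append_small) auto
    have "\<bar>real (N - l) / real N - (1 - \<mu>)\<bar> \<le> e"
    proof -
      have "real (N - l) / real N = 1 - real l / real N" using l N by (simp add: of_nat_diff diff_divide_distrib)
      then show ?thesis using False by auto
    qed
    then have 2: "\<bar>dec_rearr (rescaled N ys) i - dec_rearr (scaled (N - l) ys) i\<bar> \<le> ?d" for i
      by (intro dec_rearr_lipschitz rescaled_scaled_diff ys N) (auto simp: rescaled_def scaled_def bdd_above_pad)
    have "\<bar>h (dec_rearr (rescaled N (ys @ xs))) - h (dec_rearr (scaled (N - l) ys))\<bar>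
      \<le> L * (\<Sum>i<k. \<bar>dec_rearr (rescaled N (ys @ xs)) i - dec_rearr (scaled (N - l) ys) i\<bar>)"
      using h by (simp add: coord_lip_def)
    also have "\<dots> \<le> L * (\<Sum>i<k. 2 * ?d)"
    proof (intro mult_left_mono sum_mono L)
      fix i
      show "\<bar>dec_rearr (rescaled N (ys @ xs)) i - dec_rearr (scaled (N - l) ys) i\<bar> \<le> 2 * ?d"
        using 1[of i] 2[of i] by linarith
    qed
    also have "\<dots> = 2 * L * real k * e / (1 - \<mu>)" by simp
    finally have "\<bar>h (dec_rearr (rescaled N (ys @ xs))) - h (dec_rearr (scaled (N - l) ys))\<bar> \<le> 2 * L * real k * e / (1 - \<mu>)" .
    moreover have "0 \<le> 2 * M * of_bool (e < \<bar>real l / real N - \<mu>\<bar>)" "0 \<le> 2 * M * ?cnt"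
      using M0 cnt0 by (auto intro: mult_nonneg_nonneg)
    ultimately show ?thesis by linarith
  qed
qed

abbreviation mixed :: "nat \<Rightarrow> nat \<Rightarrow> real" where
  "mixed N \<equiv> (\<lambda>j. v j + real N * w j)"

text \<open>A count in place of the indicator that some part is large, so that its mean follows from
  \<open>cyc_sum_sum_list\<close>.\<close>

definition large_count :: "real \<Rightarrow> nat \<Rightarrow> nat list \<Rightarrow> real" where
  "large_count e N xs = sum_list (map (\<lambda>x. of_bool (e * real N < real x)) xs)"

lemma mixed_colouring:
  "cyc_sum (mixed N) N (\<lambda>xs. F (mset xs)) =
   (\<Sum>l\<le>N. cyc_sum (\<lambda>j. real N * w j) l (\<lambda>xs. cyc_sum v (N - l) (\<lambda>ys. F (mset xs + mset ys))))"
  unfolding cyc_sum_plus[symmetric] by (simp add: add.commute)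

lemma mixed_total:
  "cyc_total (mixed N) N * exp (- real N * (\<Sum>j. w j / real j)) = Z N N"
proof -
  have "cyc_total (mixed N) N = (\<Sum>l\<le>N. cyc_total (\<lambda>j. real N * w j) l * cyc_total v (N - l))"
    unfolding cyc_total_plus[symmetric] by (simp add: add.commute)
  then show ?thesis unfolding Z_def mass_law_def by (simp only: sum_distrib_right) (intro sum.cong refl, simp)
qed

text \<open>Removal of a large \<kappa>-cycle of length j leaves a coloured configuration on N - j
  points, whence the factor \<open>Z N (N - j)\<close>.\<close>

lemma large_count_mean:
  "(\<Sum>l\<le>N. cyc_sum (\<lambda>j. real N * w j) l (large_count e N) * exp (- real N * (\<Sum>j. w j / real j)) * lw.q (N - l)) =
   (\<Sum>j\<in>{1..N}. of_bool (e * real N < real j) * (real N * w j) / real j * Z N (N - j))"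
proof -
  let ?c = "\<lambda>j. of_bool (e * real N < real j) * (real N * w j) / real j"
  have "cyc_sum (\<lambda>j. real N * w j) l (large_count e N) * exp (- real N * (\<Sum>j. w j / real j)) * lw.q (N - l)
     = (\<Sum>j\<in>{1..l}. ?c j * (mass_law w N (l - j) * lw.q (N - l)))" for l
    unfolding large_count_def cyc_sum_sum_list mass_law_def sum_distrib_right by (intro sum.cong refl) simp
  then have "(\<Sum>l\<le>N. cyc_sum (\<lambda>j. real N * w j) l (large_count e N) * exp (- real N * (\<Sum>j. w j / real j)) * lw.q (N - l))
    = (\<Sum>l\<le>N. \<Sum>j\<in>{1..l}. ?c j * (mass_law w N (l - j) * lw.q (N - l)))" by simp
  also have "\<dots> = (\<Sum>j\<in>{1..N}. \<Sum>l\<le>N - j. ?c j * (mass_law w N l * lw.q (N - j - l)))"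
    by (rule sum_triangle_reindex[where T = "\<lambda>j a b. ?c j * (mass_law w N a * lw.q b)"])
  also have "\<dots> = (\<Sum>j\<in>{1..N}. ?c j * Z N (N - j))"
    by (simp only: Z_def sum_distrib_left)
  finally show ?thesis .
qed

text \<open>The sum is split by the total length l of the \<kappa>-cycles. The three terms are the
  error for typical l, the conditioned weight of atypical l, and the mean number of large
  \<kappa>-cycles.\<close>

lemma lipschitz_estimate:
  assumes h: "coord_lip k L h" and L: "0 \<le> L" and N: "0 < N" and e: "0 < e"
    and M: "M = \<bar>h (\<lambda>_. 0)\<bar> + L * real k / (1 - \<mu>)"
    and r: "0 \<le> r"
    and scaled_mean: "\<And>l. l \<le> N \<Longrightarrow> \<bar>real l / real N - \<mu>\<bar> \<le> e \<Longrightarrow>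
        0 < lw.q (N - l) \<and> \<bar>scaled_mean v (N - l) (\<lambda>y. h (dec_rearr y)) - GEM_mean t (\<lambda>y. h (dec_rearr y))\<bar> \<le> r"
    and Z: "0 < Z N N"
  shows "\<bar>cyc_sum (mixed N) N (\<lambda>xs. h (dec_rearr (rescaled N xs))) / cyc_total (mixed N) N - GEM_mean t (\<lambda>y. h (dec_rearr y))\<bar>
    \<le> (2 * L * real k * e / (1 - \<mu>) + r)
      + (2 * M + 2 * (L * real k)) * ((\<Sum>l\<le>N. mass_law w N l * lw.q (N - l) * of_bool (e < \<bar>real l / real N - \<mu>\<bar>)) / Z N N)
      + 2 * M * ((\<Sum>j\<in>{1..N}. of_bool (e * real N < real j) * (real N * w j) / real j * Z N (N - j)) / Z N N)"
proof -
  define E where "E = exp (- real N * (\<Sum>j. w j / real j))"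
  have E: "0 < E" by (simp add: E_def)
  define \<Phi> where "\<Phi> = (\<lambda>y. h (dec_rearr y))"
  define c where "c = GEM_mean t \<Phi>"
  define a where "a = 2 * L * real k * e / (1 - \<mu>)"
  define bad where "bad = (\<lambda>l. of_bool (e < \<bar>real l / real N - \<mu>\<bar>) :: real)"
  \<comment> \<open>The colouring identity needs functions of a multiset; sorting picks a
    representative, and the ordered values do not depend on it.\<close>
  define F where "F = (\<lambda>X. h (dec_rearr (rescaled N (sorted_list_of_multiset X))))"
  let ?U = "cyc_sum (\<lambda>j. real N * w j)"
  let ?T = "cyc_total (\<lambda>j. real N * w j)"
  let ?l = "large_count e N"
  have nu: "0 < 1 - \<mu>" using mu_less by simp
  have M0: "0 \<le> M" unfolding M using L nu by simp
  have wN: "0 \<le> real N * w j" for j using cw.w_nonneg by simp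
  have T0: "0 \<le> ?T l" for l by (rule cyc_total_nonneg) (rule wN)
  have F_mset: "F (mset zs) = h (dec_rearr (rescaled N zs))" for zs
  proof -
    have "mset (map (\<lambda>x. real x / (real N * (1 - \<mu>))) (sorted_list_of_multiset (mset zs))) = mset (map (\<lambda>x. real x / (real N * (1 - \<mu>))) zs)"
      by (simp only: mset_map mset_sorted_list_of_multiset)
    from dec_rearr_pad_cong[OF this] show ?thesis unfolding F_def rescaled_def by (rule arg_cong)
  qed
  have lip: "lip_fun (L * real k) \<Phi>" unfolding \<Phi>_def by (rule lip_fun_dec_rearr[OF h L])
  have Lk: "0 \<le> L * real k" using L by simp
  \<comment> \<open>\<open>?D1\<close> drops the \<kappa>-cycles and changes the scale to N - l;
    \<open>?D2\<close> replaces the mean over the \<theta>-cycles by its limit.\<close>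
  let ?D = "\<lambda>l. ?U l (\<lambda>xs. cyc_sum v (N - l) (\<lambda>ys. F (mset xs + mset ys) - c))"
  let ?D1 = "\<lambda>l. ?U l (\<lambda>xs. cyc_sum v (N - l) (\<lambda>ys. F (mset xs + mset ys) - \<Phi> (scaled (N - l) ys)))"
  let ?D2 = "\<lambda>l. ?U l (\<lambda>xs. cyc_sum v (N - l) (\<lambda>ys. \<Phi> (scaled (N - l) ys) - c))"
  have split: "?D l = ?D1 l + ?D2 l" for l
    by (simp flip: cyc_sum_add)
  have D1: "\<bar>?D1 l\<bar> \<le> ((a + 2 * M * bad l) * ?T l + 2 * M * ?U l ?l) * lw.q (N - l)" if l: "l \<le> N" for l
  proof -
    have "\<bar>?D1 l\<bar> \<le> ?U l (\<lambda>xs. cyc_sum v (N - l) (\<lambda>ys. (a + 2 * M * bad l) + 2 * M * ?l xs))"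
    proof (rule cyc_sum_abs_le)
      fix xs assume xs: "sum_list xs = l"
      show "\<bar>cyc_sum v (N - l) (\<lambda>ys. F (mset xs + mset ys) - \<Phi> (scaled (N - l) ys))\<bar>
        \<le> cyc_sum v (N - l) (\<lambda>ys. (a + 2 * M * bad l) + 2 * M * ?l xs)"
      proof (rule cyc_sum_abs_le)
        fix ys assume ys: "sum_list ys = N - l"
        have "F (mset xs + mset ys) = h (dec_rearr (rescaled N (ys @ xs)))"
          using F_mset[of "ys @ xs"] by (simp add: add.commute)
        then show "\<bar>F (mset xs + mset ys) - \<Phi> (scaled (N - l) ys)\<bar> \<le> (a + 2 * M * bad l) + 2 * M * ?l xs"
          using pointwise_estimate[OF h L N e xs l ys M]
          unfolding \<Phi>_def a_def bad_def large_count_def by simp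
      qed (use lw.v_nonneg in simp)
    qed (use wN in simp)
    also have "\<dots> = ?U l (\<lambda>xs. lw.q (N - l) * (a + 2 * M * bad l) + (lw.q (N - l) * 2 * M) * ?l xs)"
      by (rule cyc_sum_cong) (subst cyc_sum_const, simp_all add: algebra_simps)
    also have "\<dots> = lw.q (N - l) * (a + 2 * M * bad l) * ?T l + (lw.q (N - l) * 2 * M) * ?U l ?l"
      by (subst cyc_sum_add, subst cyc_sum_const, subst cyc_sum_cmult, rule refl)
    finally show ?thesis by (simp add: algebra_simps)
  qed
  have D2: "\<bar>?D2 l\<bar> \<le> (r + 2 * (L * real k) * bad l) * ?T l * lw.q (N - l)" if l: "l \<le> N" for l
  proof -
    let ?G = "cyc_sum v (N - l) (\<lambda>ys. \<Phi> (scaled (N - l) ys) - c)"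
    have "\<bar>?G\<bar> \<le> (r + 2 * (L * real k) * bad l) * lw.q (N - l)"
    proof (cases "e < \<bar>real l / real N - \<mu>\<bar>")
      case True
      have "\<bar>\<Phi> y - c\<bar> \<le> 2 * (L * real k)" if "y \<in> subprob" for y
        using lip_fun_bound[OF lip Lk that] GEM_mean_bound[OF lw.t lip Lk] unfolding c_def by linarith
      then have "\<bar>?G\<bar> \<le> cyc_sum v (N - l) (\<lambda>_. 2 * (L * real k))"
        using lw.v_nonneg by (intro cyc_sum_abs_le) (auto intro: scaled_subprob)
      also have "\<dots> = 2 * (L * real k) * lw.q (N - l)" by (rule cyc_sum_const)
      also have "\<dots> \<le> (r + 2 * (L * real k) * bad l) * lw.q (N - l)"
        using True r lw.q_nonneg by (intro mult_right_mono) (auto simp: bad_def)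
      finally show ?thesis .
    next
      case False
      then have *: "0 < lw.q (N - l)" "\<bar>scaled_mean v (N - l) \<Phi> - c\<bar> \<le> r" using scaled_mean[OF l] unfolding c_def \<Phi>_def by auto
      have "?G = (scaled_mean v (N - l) \<Phi> - c) * lw.q (N - l)"
        using *(1) by (simp add: cyc_sum_diff cyc_sum_const[of _ _ c] scaled_mean_def algebra_simps)
      then have "\<bar>?G\<bar> = \<bar>scaled_mean v (N - l) \<Phi> - c\<bar> * lw.q (N - l)" using *(1) by (simp add: abs_mult)
      also have "\<dots> \<le> r * lw.q (N - l)" using * by (intro mult_right_mono) auto
      finally show ?thesis using False by (simp add: bad_def)
    qed
    then have "\<bar>?G\<bar> * ?T l \<le> (r + 2 * (L * real k) * bad l) * lw.q (N - l) * ?T l" using T0 by (rule mult_right_mono)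
    then show ?thesis by (simp add: cyc_sum_const[of _ _ ?G] abs_mult abs_of_nonneg[OF T0] mult_ac)
  qed
  have num: "cyc_sum (mixed N) N (\<lambda>xs. h (dec_rearr (rescaled N xs))) - c * cyc_total (mixed N) N = (\<Sum>l\<le>N. ?D l)"
  proof -
    have "cyc_sum (mixed N) N (\<lambda>xs. h (dec_rearr (rescaled N xs))) - c * cyc_total (mixed N) N = cyc_sum (mixed N) N (\<lambda>xs. F (mset xs) - c)"
      unfolding F_mset by (simp add: cyc_sum_diff cyc_sum_const[of _ _ c])
    then show ?thesis using mixed_colouring[of N "\<lambda>X. F X - c"] by simp
  qed
  have tot: "cyc_total (mixed N) N * E = Z N N" unfolding E_def by (rule mixed_total)
  have tot0: "0 < cyc_total (mixed N) N" using Z tot E by (metis zero_less_mult_pos2)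
  have "cyc_sum (mixed N) N (\<lambda>xs. h (dec_rearr (rescaled N xs))) / cyc_total (mixed N) N - c = (\<Sum>l\<le>N. ?D l) / cyc_total (mixed N) N"
    using tot0 by (simp add: num[symmetric] diff_divide_distrib)
  also have "\<dots> = E * (\<Sum>l\<le>N. ?D l) / Z N N" using E tot0 unfolding tot[symmetric] by simp
  finally have "\<bar>cyc_sum (mixed N) N (\<lambda>xs. h (dec_rearr (rescaled N xs))) / cyc_total (mixed N) N - c\<bar> = E * \<bar>\<Sum>l\<le>N. ?D l\<bar> / Z N N"
    using E Z by (simp add: abs_mult)
  also have "\<dots> \<le> ((a + r) * Z N N + (2 * M + 2 * (L * real k)) * (\<Sum>l\<le>N. mass_law w N l * lw.q (N - l) * bad l)
      + 2 * M * (\<Sum>j\<in>{1..N}. of_bool (e * real N < real j) * (real N * w j) / real j * Z N (N - j))) / Z N N"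
  proof (rule divide_right_mono)
    have "\<bar>\<Sum>l\<le>N. ?D l\<bar> \<le> (\<Sum>l\<le>N. ((a + 2 * M * bad l) * ?T l + 2 * M * ?U l ?l) * lw.q (N - l) + (r + 2 * (L * real k) * bad l) * ?T l * lw.q (N - l))"
      unfolding split
    proof (rule order_trans[OF sum_abs], rule sum_mono)
      fix l assume "l \<in> {..N}"
      then show "\<bar>?D1 l + ?D2 l\<bar> \<le> ((a + 2 * M * bad l) * ?T l + 2 * M * ?U l ?l) * lw.q (N - l) + (r + 2 * (L * real k) * bad l) * ?T l * lw.q (N - l)"
        by (intro order_trans[OF abs_triangle_ineq add_mono] D1 D2) auto
    qed
    then have "E * \<bar>\<Sum>l\<le>N. ?D l\<bar> \<le> E * (\<Sum>l\<le>N. ((a + 2 * M * bad l) * ?T l + 2 * M * ?U l ?l) * lw.q (N - l) + (r + 2 * (L * real k) * bad l) * ?T l * lw.q (N - l))"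
      using E by (intro mult_left_mono) auto
    also have "\<dots> = (\<Sum>l\<le>N. (a + r) * (mass_law w N l * lw.q (N - l)) + (2 * M + 2 * (L * real k)) * (mass_law w N l * lw.q (N - l) * bad l)
        + 2 * M * (?U l ?l * E * lw.q (N - l)))"
      unfolding sum_distrib_left mass_law_def E_def[symmetric] by (intro sum.cong refl) (simp add: algebra_simps)
    also have "\<dots> = (a + r) * Z N N + (2 * M + 2 * (L * real k)) * (\<Sum>l\<le>N. mass_law w N l * lw.q (N - l) * bad l)
        + 2 * M * (\<Sum>l\<le>N. ?U l ?l * E * lw.q (N - l))"
      by (simp only: sum.distrib sum_distrib_left[symmetric] Z_def)
    also have "(\<Sum>l\<le>N. ?U l ?l * E * lw.q (N - l)) = (\<Sum>j\<in>{1..N}. of_bool (e * real N < real j) * (real N * w j) / real j * Z N (N - j))"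
      unfolding E_def by (rule large_count_mean)
    finally show "E * \<bar>\<Sum>l\<le>N. ?D l\<bar> \<le> (a + r) * Z N N + (2 * M + 2 * (L * real k)) * (\<Sum>l\<le>N. mass_law w N l * lw.q (N - l) * bad l)
      + 2 * M * (\<Sum>j\<in>{1..N}. of_bool (e * real N < real j) * (real N * w j) / real j * Z N (N - j))" .
  qed (use Z in simp)
  also have "\<dots> = (a + r) + (2 * M + 2 * (L * real k)) * ((\<Sum>l\<le>N. mass_law w N l * lw.q (N - l) * bad l) / Z N N)
      + 2 * M * ((\<Sum>j\<in>{1..N}. of_bool (e * real N < real j) * (real N * w j) / real j * Z N (N - j)) / Z N N)"
    using Z by (simp add: add_divide_distrib)
  finally show ?thesis unfolding a_def bad_def c_def \<Phi>_def .
qed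

lemma lipschitz_limit:
  assumes h: "coord_lip k L h" and L: "0 \<le> L"
  shows "(\<lambda>N. cyc_sum (mixed N) N (\<lambda>xs. h (dec_rearr (rescaled N xs))) / cyc_total (mixed N) N) \<longlonglongrightarrow> GEM_mean t (\<lambda>y. h (dec_rearr y))"
proof (rule tendstoI)
  fix \<epsilon> :: real assume \<epsilon>: "0 < \<epsilon>"
  have nu: "0 < 1 - \<mu>" using mu_less by simp
  \<comment> \<open>The summand 1 permits division by \<open>K\<close> when L k = 0.\<close>
  define K where "K = L * real k + 1"
  have K: "0 < K" using L by (simp add: K_def add_nonneg_pos)
  \<comment> \<open>The first entry leaves at least (1 - \<mu>) N / 2 points to the \<theta>-cycles,
    eventually more than \<open>m0\<close>; the second makes the deterministic error at most
    \<epsilon> / 4.\<close>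
  define e where "e = min ((1 - \<mu>) / 2) (\<epsilon> * (1 - \<mu>) / (8 * K))"
  have "0 < e" using \<epsilon> K nu by (simp add: e_def)
  moreover have "e \<le> (1 - \<mu>) / 2" unfolding e_def by (rule min.cobounded1)
  moreover have "e \<le> \<epsilon> * (1 - \<mu>) / (8 * K)" unfolding e_def by (rule min.cobounded2)
  ultimately have e: "0 < e" "e \<le> (1 - \<mu>) / 2" "e \<le> \<epsilon> * (1 - \<mu>) / (8 * K)" by blast+
  define r where "r = \<epsilon> / (4 * K)"
  have r: "0 < r" using \<epsilon> K by (simp add: r_def)
  define M where "M = \<bar>h (\<lambda>_. 0)\<bar> + L * real k / (1 - \<mu>)"
  have lip: "lip_fun (L * real k) (\<lambda>y. h (dec_rearr y))" by (rule lip_fun_dec_rearr[OF h L])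
  have small: "2 * L * real k * e / (1 - \<mu>) + r * (L * real k) \<le> \<epsilon> / 2"
  proof -
    have "2 * L * real k * e / (1 - \<mu>) \<le> 2 * K * e / (1 - \<mu>)"
      using e nu by (intro divide_right_mono mult_right_mono) (auto simp: K_def)
    also have "\<dots> \<le> 2 * K * (\<epsilon> * (1 - \<mu>) / (8 * K)) / (1 - \<mu>)"
      using e nu K by (intro divide_right_mono mult_left_mono) auto
    also have "\<dots> = \<epsilon> / 4"
    proof -
      have *: "2 * K * (\<epsilon> * n / (8 * K)) / n = \<epsilon> / 4" if "n \<noteq> 0" for n :: real using that K by simp
      have "1 - \<mu> \<noteq> 0" using nu by simp
      from *[OF this] show ?thesis .
    qed
    finally have 1: "2 * L * real k * e / (1 - \<mu>) \<le> \<epsilon> / 4" .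
    have "r * (L * real k) \<le> r * K" using r by (intro mult_left_mono) (auto simp: K_def)
    also have "\<dots> = \<epsilon> / 4" using K by (simp add: r_def)
    finally show ?thesis using 1 by linarith
  qed
  have "eventually (\<lambda>m. 0 < lw.q m \<and> \<bar>scaled_mean v m (\<lambda>y. h (dec_rearr y)) - GEM_mean t (\<lambda>y. h (dec_rearr y))\<bar> \<le> r * (L * real k)) sequentially"
    using lw.approx_all[OF r, unfolded lw.approx_def, THEN conjunct2] lw.eventually_q_pos
    by eventually_elim (use lip L in auto)
  then obtain m0 where m0: "\<And>m. m \<ge> m0 \<Longrightarrow> 0 < lw.q m \<and> \<bar>scaled_mean v m (\<lambda>y. h (dec_rearr y)) - GEM_mean t (\<lambda>y. h (dec_rearr y))\<bar> \<le> r * (L * real k)"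
    unfolding eventually_sequentially by blast
  let ?B = "\<lambda>N. (2 * M + 2 * (L * real k)) * ((\<Sum>l\<le>N. mass_law w N l * lw.q (N - l) * of_bool (e < \<bar>real l / real N - \<mu>\<bar>)) / Z N N)"
  let ?C = "\<lambda>N. 2 * M * ((\<Sum>j\<in>{1..N}. of_bool (e * real N < real j) * (real N * w j) / real j * Z N (N - j)) / Z N N)"
  have "(\<lambda>N. ?B N + ?C N) \<longlonglongrightarrow> (2 * M + 2 * (L * real k)) * 0 + 2 * M * 0"
    by (intro tendsto_add tendsto_mult tendsto_const Z_concentration large_cycles_negligible e)
  then have "eventually (\<lambda>N. ?B N + ?C N < \<epsilon> / 2) sequentially"
    using \<epsilon> by (intro order_tendstoD(2)) auto
  moreover have "eventually (\<lambda>N. real m0 \<le> (1 - \<mu>) / 2 * real N) sequentially" using nu by real_asymp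
  ultimately show "eventually (\<lambda>N. dist (cyc_sum (mixed N) N (\<lambda>xs. h (dec_rearr (rescaled N xs))) / cyc_total (mixed N) N) (GEM_mean t (\<lambda>y. h (dec_rearr y))) < \<epsilon>) sequentially"
    using eventually_Z_pos eventually_gt_at_top[of 0]
  proof eventually_elim
    case (elim N)
    have "\<bar>cyc_sum (mixed N) N (\<lambda>xs. h (dec_rearr (rescaled N xs))) / cyc_total (mixed N) N - GEM_mean t (\<lambda>y. h (dec_rearr y))\<bar>
      \<le> (2 * L * real k * e / (1 - \<mu>) + r * (L * real k)) + ?B N + ?C N"
    proof (rule lipschitz_estimate[OF h L elim(4) e(1) M_def _ _ elim(3)])
      show "0 \<le> r * (L * real k)" using r L by simp
      fix l assume l: "l \<le> N" "\<bar>real l / real N - \<mu>\<bar> \<le> e"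
      have "real l / real N \<le> \<mu> + (1 - \<mu>) / 2" using l(2) e(2) by linarith
      then have "real l \<le> (\<mu> + (1 - \<mu>) / 2) * real N" using elim(4) by (simp add: divide_le_eq)
      then have "(1 - \<mu>) / 2 * real N \<le> real (N - l)" using l(1) by (simp add: of_nat_diff field_simps)
      then have "m0 \<le> N - l" using elim(2) by linarith
      then show "0 < lw.q (N - l) \<and> \<bar>scaled_mean v (N - l) (\<lambda>y. h (dec_rearr y)) - GEM_mean t (\<lambda>y. h (dec_rearr y))\<bar> \<le> r * (L * real k)"
        by (rule m0)
    qed
    then show ?case using small elim(1) unfolding dist_real_def by linarith
  qed
qed

theorem continuous_limit:
  fixes g :: "(nat \<Rightarrow> real) \<Rightarrow> real"
  assumes g: "continuous_on UNIV g" and bdd: "bounded (range g)"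
  shows "(\<lambda>N. cyc_sum (mixed N) N (\<lambda>xs. g (fdd_trunc k (dec_rearr (rescaled N xs)))) / cyc_total (mixed N) N)
    \<longlonglongrightarrow> (\<integral>y. g (fdd_trunc k y) \<partial>PD t)"
proof -
  obtain M where M: "\<And>y. \<bar>g y\<bar> \<le> M" using bdd unfolding bounded_iff by auto
  \<comment> \<open>Before the limit a rescaled cycle length is only known to be at most 1 / (1 -
    \<mu>), so the box has to be this large.\<close>
  define b where "b = 1 / (1 - \<mu>)"
  have nu: "0 < 1 - \<mu>" "1 - \<mu> \<le> 1" using mu_less cw.mu_nonneg by auto
  have b: "0 \<le> b" "1 \<le> b" using nu by (auto simp: b_def)
  define G where "G = (\<lambda>y. g (fdd_trunc k y))"
  have Gm: "G \<in> borel_measurable (Pi\<^sub>M UNIV (\<lambda>_. borel))"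
  proof -
    have "continuous_on UNIV (\<lambda>y. fdd_trunc k y i)" for i
      unfolding fdd_trunc_def by (cases "i < k") auto
    then have "continuous_on UNIV (fdd_trunc k)" by (rule continuous_on_coordinatewise_then_product)
    then have "continuous_on UNIV G" unfolding G_def
      using g continuous_on_compose2[of UNIV g UNIV "fdd_trunc k"] by auto
    then show ?thesis
      using borel_measurable_continuous_onI measurable_cong_sets[OF sets_PiM_equal_borel refl] by blast
  qed
  have PD: "(\<integral>y. g (fdd_trunc k y) \<partial>PD t) = GEM_mean t (\<lambda>y. G (dec_rearr y))"
  proof -
    have "(\<lambda>B. dec_rearr (stick B)) \<in> measurable (GEM t) (Pi\<^sub>M UNIV (\<lambda>_. borel))"
      using measurable_stick measurable_dec_rearr_seq by (rule measurable_compose)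
    from integral_distr[OF this Gm] show ?thesis
      unfolding PD_def GEM_def[symmetric] GEM_mean_def G_def .
  qed
  have approx: "\<exists>h L. 0 \<le> L \<and> coord_lip k L h \<and> (\<forall>u. (\<forall>i. 0 \<le> u i \<and> u i \<le> b) \<longrightarrow> \<bar>h u - G u\<bar> \<le> \<epsilon>)" if \<epsilon>: "0 < \<epsilon>" for \<epsilon>
  proof -
    obtain L h where L: "0 \<le> L" and h: "coord_lip k L h" and hg: "\<And>u. u \<in> coord_box k b \<Longrightarrow> \<bar>h u - g u\<bar> \<le> \<epsilon>"
      using lipschitz_approximation[OF g M b(1) \<epsilon>] by metis
    have "\<bar>h u - G u\<bar> \<le> \<epsilon>" if u: "\<forall>i. 0 \<le> u i \<and> u i \<le> b" for u
    proof -
      have "\<bar>h u - h (fdd_trunc k u)\<bar> \<le> L * (\<Sum>i<k. \<bar>u i - fdd_trunc k u i\<bar>)" using h unfolding coord_lip_def by blast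
      also have "\<dots> = 0" by (simp add: fdd_trunc_def)
      finally have "h u = h (fdd_trunc k u)" by simp
      moreover have "fdd_trunc k u \<in> coord_box k b" using u by (simp add: coord_box_def fdd_trunc_def)
      ultimately show ?thesis using hg[of "fdd_trunc k u"] by (simp add: G_def)
    qed
    then show ?thesis using L h by blast
  qed
  have "(\<lambda>N. cyc_sum (mixed N) N (\<lambda>xs. G (dec_rearr (rescaled N xs))) / cyc_total (mixed N) N) \<longlonglongrightarrow> GEM_mean t (\<lambda>y. G (dec_rearr y))"
  proof (rule tendstoI)
    fix \<epsilon> :: real assume \<epsilon>: "0 < \<epsilon>"
    then obtain h L where L: "0 \<le> L" and h: "coord_lip k L h"
      and hG: "\<And>u. (\<And>i. 0 \<le> u i \<and> u i \<le> b) \<Longrightarrow> \<bar>h u - G u\<bar> \<le> \<epsilon> / 4"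
      using approx[of "\<epsilon> / 4"] by auto
    have subprob_b: "0 \<le> dec_rearr y i \<and> dec_rearr y i \<le> b" if "y \<in> subprob" for y i
    proof -
      have "y n \<le> b" for n
        using that sum_le_suminf[of y "{n}"] b by (auto simp: subprob_def intro: order_trans)
      then show ?thesis using dec_rearr_bounds[of y b i] b by simp
    qed
    have lip: "lip_fun (L * real k) (\<lambda>y. h (dec_rearr y))" by (rule lip_fun_dec_rearr[OF h L])
    have E: "\<bar>GEM_mean t (\<lambda>y. h (dec_rearr y)) - GEM_mean t (\<lambda>y. G (dec_rearr y))\<bar> \<le> \<epsilon> / 4"
    proof (rule GEM_mean_diff_le[OF lw.t])
      show "(\<lambda>y. h (dec_rearr y)) \<in> borel_measurable (Pi\<^sub>M UNIV (\<lambda>_. borel))" using lip by (simp add: lip_fun_def)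
      show "\<bar>h (dec_rearr y)\<bar> \<le> \<bar>h (dec_rearr (\<lambda>_. 0))\<bar> + L * real k" if "y \<in> subprob" for y
        using lip_fun_abs_bound[OF lw.t lip _ that] L by simp
      show "(\<lambda>y. G (dec_rearr y)) \<in> borel_measurable (Pi\<^sub>M UNIV (\<lambda>_. borel))"
        using measurable_dec_rearr_seq Gm by (rule measurable_compose)
      show "\<bar>G (dec_rearr y)\<bar> \<le> M" for y by (simp add: G_def M)
      show "\<bar>h (dec_rearr y) - G (dec_rearr y)\<bar> \<le> \<epsilon> / 4" if "y \<in> subprob" for y by (intro hG subprob_b that)
    qed
    have "eventually (\<lambda>N. dist (cyc_sum (mixed N) N (\<lambda>xs. h (dec_rearr (rescaled N xs))) / cyc_total (mixed N) N) (GEM_mean t (\<lambda>y. h (dec_rearr y))) < \<epsilon> / 4) sequentially"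
      using \<epsilon> by (intro tendstoD[OF lipschitz_limit[OF h L]]) auto
    then show "eventually (\<lambda>N. dist (cyc_sum (mixed N) N (\<lambda>xs. G (dec_rearr (rescaled N xs))) / cyc_total (mixed N) N) (GEM_mean t (\<lambda>y. G (dec_rearr y))) < \<epsilon>) sequentially"
      using eventually_Z_pos eventually_gt_at_top[of 0]
    proof eventually_elim
      case (elim N)
      have tot: "0 < cyc_total (mixed N) N" using elim(2) mixed_total[of N] by (metis exp_gt_zero zero_less_mult_pos2)
      have wN: "0 \<le> mixed N j" for j using lw.v_nonneg cw.w_nonneg by simp
      have "\<bar>cyc_sum (mixed N) N (\<lambda>xs. h (dec_rearr (rescaled N xs)) - G (dec_rearr (rescaled N xs)))\<bar> \<le> cyc_sum (mixed N) N (\<lambda>_. \<epsilon> / 4)"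
      proof (rule cyc_sum_abs_le)
        fix xs assume "sum_list xs = N"
        then have "rescaled N xs n \<le> b" for n unfolding b_def using elim(3) by (intro rescaled_bounds) auto
        then have "0 \<le> dec_rearr (rescaled N xs) i \<and> dec_rearr (rescaled N xs) i \<le> b" for i
          using dec_rearr_bounds[of "rescaled N xs" b i] b by simp
        then show "\<bar>h (dec_rearr (rescaled N xs)) - G (dec_rearr (rescaled N xs))\<bar> \<le> \<epsilon> / 4" by (intro hG)
      qed (use wN in simp)
      also have "\<dots> = \<epsilon> / 4 * cyc_total (mixed N) N" by (rule cyc_sum_const)
      finally have "\<bar>cyc_sum (mixed N) N (\<lambda>xs. h (dec_rearr (rescaled N xs))) - cyc_sum (mixed N) N (\<lambda>xs. G (dec_rearr (rescaled N xs)))\<bar> / cyc_total (mixed N) N \<le> \<epsilon> / 4"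
        using tot by (simp add: cyc_sum_diff divide_le_eq)
      then have "\<bar>cyc_sum (mixed N) N (\<lambda>xs. h (dec_rearr (rescaled N xs))) / cyc_total (mixed N) N - cyc_sum (mixed N) N (\<lambda>xs. G (dec_rearr (rescaled N xs))) / cyc_total (mixed N) N\<bar> \<le> \<epsilon> / 4"
        using tot by (simp add: abs_divide flip: diff_divide_distrib)
      then show ?case using elim(1) E \<epsilon> unfolding dist_real_def by linarith
    qed
  qed
  then show ?thesis unfolding PD G_def .
qed

end

section \<open>Coefficients from singularities\<close>

lemma cmod_one_minus_ge: "r \<ge> 0 \<Longrightarrow> cmod z \<le> r \<Longrightarrow> 1 - r \<le> cmod (1 - z)"
  using norm_triangle_ineq2[of 1 z] by simp

text \<open>On the circle \<open>|u| = r\<close> the conjugate of \<open>u\<close> is \<open>r\<^sup>2 / u\<close>, which makes \<open>1 / |1 - u|\<^sup>2\<close> a rational function of \<open>u\<close>.\<close>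
lemma circle_kernel:
  assumes r: "0 < r" "r < 1"
  shows "((\<lambda>x. 1 / (cmod (1 - circlepath 0 r x))\<^sup>2) has_integral 1 / (1 - r\<^sup>2)) {0..1}"
proof -
  let ?f = "\<lambda>u. 1 / (1 - u) :: complex"
  let ?w = "complex_of_real (r\<^sup>2)"
  have "r * r < r * 1" using r by (intro mult_strict_left_mono) auto
  then have r2: "r\<^sup>2 < r" "r\<^sup>2 < 1" unfolding power2_eq_square using r by linarith+
  have nz: "1 - u \<noteq> 0" if "cmod u \<le> r" for u using that r by auto
  have "?f holomorphic_on cball 0 r" using nz by (intro holomorphic_intros) auto
  \<comment> \<open>Cauchy's formula for 1 / (1 - u) at the interior point r^2. On the circle the
    denominator u - r^2 equals u (1 - \<open>cnj u\<close>), which supplies the second factor of the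
    squared modulus.\<close>
  then have "((\<lambda>u. ?f u / (u - ?w)) has_contour_integral (2 * of_real pi * \<i> * ?f ?w)) (circlepath 0 r)"
    using r2 r by (intro Cauchy_integral_circlepath_simple) (auto simp: norm_power)
  then have "((\<lambda>x. ?f (circlepath 0 r x) / (circlepath 0 r x - ?w) * vector_derivative (circlepath 0 r) (at x within {0..1})) has_integral (2 * of_real pi * \<i> * ?f ?w)) {0..1}"
    by (simp add: has_contour_integral_def)
  then have "((\<lambda>x. (2 * of_real pi * \<i>) * complex_of_real (1 / (cmod (1 - circlepath 0 r x))\<^sup>2)) has_integral (2 * of_real pi * \<i> * ?f ?w)) {0..1}"
  proof (rule has_integral_eq[rotated])
    fix x :: real assume x: "x \<in> {0..1}"
    let ?u = "circlepath 0 r x"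
    have u: "?u = r * exp (2 * of_real pi * \<i> * x)" by (simp add: circlepath)
    have cu: "cmod ?u = r" using r unfolding u by (simp add: norm_mult)
    have u0: "?u \<noteq> 0" using cu r by auto
    have uc: "?u * cnj ?u = ?w" using cu by (simp add: complex_norm_square[symmetric])
    have fact: "?u - ?w = ?u * (1 - cnj ?u)" unfolding uc[symmetric] by (simp add: algebra_simps)
    have alg: "1 / p / (y * q) * (k * y) = k * (1 / (p * q))" if "y \<noteq> 0" for y p q k :: complex
      using that by (cases "p = 0"; cases "q = 0") (simp_all add: field_simps)
    have "?f ?u / (?u - ?w) * (2 * of_real pi * \<i> * ?u) = (2 * of_real pi * \<i>) * (1 / ((1 - ?u) * (1 - cnj ?u)))"
      unfolding fact by (rule alg[OF u0])
    also have "(1 - ?u) * (1 - cnj ?u) = complex_of_real ((cmod (1 - ?u))\<^sup>2)"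
      unfolding complex_norm_square by simp
    finally have "?f ?u / (?u - ?w) * (2 * of_real pi * \<i> * ?u) = (2 * of_real pi * \<i>) * complex_of_real (1 / (cmod (1 - ?u))\<^sup>2)" by simp
    moreover have "vector_derivative (circlepath 0 r) (at x within {0..1}) = 2 * of_real pi * \<i> * ?u"
      using x by (simp add: vector_derivative_circlepath01 u)
    ultimately show "?f ?u / (?u - ?w) * vector_derivative (circlepath 0 r) (at x within {0..1}) = (2 * of_real pi * \<i>) * complex_of_real (1 / (cmod (1 - ?u))\<^sup>2)" by simp
  qed
  from has_integral_divide[OF this, of "2 * of_real pi * \<i>"]
  have "((\<lambda>x. complex_of_real (1 / (cmod (1 - circlepath 0 r x))\<^sup>2)) has_integral ((2 * of_real pi * \<i> * ?f ?w) / (2 * of_real pi * \<i>))) {0..1}"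
    by (rule has_integral_eq[rotated]) simp
  also have "(2 * of_real pi * \<i> * ?f ?w) / (2 * of_real pi * \<i>) = complex_of_real (1 / (1 - r\<^sup>2))"
    by simp
  finally have "((Re \<circ> (\<lambda>x. complex_of_real (1 / (cmod (1 - circlepath 0 r x))\<^sup>2))) has_integral Re (complex_of_real (1 / (1 - r\<^sup>2)))) {0..1}"
    by (rule has_integral_linear[OF _ bounded_linear_Re])
  then show ?thesis by (simp add: o_def)
qed

text \<open>The contour is the circle of radius 1 - 1 / j, inside the disc. Two powers of 1 / |1 -
  u| are integrated exactly by \<open>circle_kernel\<close>, at the cost of a factor at most j; the
  other \<gamma> - 2 \<ge> 0 powers are bounded by j^(\<gamma>-2) because |1 - u| \<ge> 1 / j
  there.\<close>

lemma coefficient_bound_unit: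
  assumes hol: "H holomorphic_on ball 0 1" and g: "2 \<le> \<gamma>"
    and bound: "\<And>z. cmod z < 1 \<Longrightarrow> cmod (H z) \<le> C * cmod (1 - z) powr (- \<gamma>)" and j: "2 \<le> j"
  shows "cmod ((deriv ^^ j) H 0 / fact j) \<le> C * exp 2 * real j powr (\<gamma> - 1)"
proof -
  define r where "r = 1 - 1 / real j"
  have r: "0 < r" "r < 1" "1 - r = 1 / real j" using j by (auto simp: r_def)
  have C0: "0 \<le> C" using bound[of 0] by (simp add: order_trans[OF norm_ge_zero])
  have "continuous_on (cball 0 r) H" "H holomorphic_on ball 0 r"
    using hol r by (auto intro: holomorphic_on_subset holomorphic_on_imp_continuous_on[OF holomorphic_on_subset])
  then have "((\<lambda>u. H u / (u - 0) ^ Suc j) has_contour_integral (2 * pi * \<i> / fact j * (deriv ^^ j) H 0)) (circlepath 0 r)"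
    using r by (intro Cauchy_has_contour_integral_higher_derivative_circlepath) auto
  then have I: "((\<lambda>x. H (circlepath 0 r x) / circlepath 0 r x ^ Suc j * vector_derivative (circlepath 0 r) (at x within {0..1})) has_integral (2 * pi * \<i> / fact j * (deriv ^^ j) H 0)) {0..1}"
    by (simp add: has_contour_integral_def)
  define B where "B = C * (1 / real j) powr (2 - \<gamma>) * 2 * pi / r ^ j"
  have K: "((\<lambda>x. B * (1 / (cmod (1 - circlepath 0 r x))\<^sup>2)) has_integral B * (1 / (1 - r\<^sup>2))) {0..1}"
    by (intro has_integral_mult_right circle_kernel r)
  have pt: "cmod (H (circlepath 0 r x) / circlepath 0 r x ^ Suc j * vector_derivative (circlepath 0 r) (at x within {0..1})) \<le> B * (1 / (cmod (1 - circlepath 0 r x))\<^sup>2)"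
    if x: "x \<in> {0..1}" for x
  proof -
    let ?u = "circlepath 0 r x"
    have u: "?u = r * exp (2 * of_real pi * \<i> * x)" by (simp add: circlepath)
    have cu: "cmod ?u = r" using r unfolding u by (simp add: norm_mult)
    have cd: "cmod (vector_derivative (circlepath 0 r) (at x within {0..1})) = 2 * pi * r"
      using x r by (simp add: vector_derivative_circlepath01 norm_mult)
    have d: "1 / real j \<le> cmod (1 - ?u)" using cmod_one_minus_ge[of r ?u] r cu by simp
    have d0: "0 < cmod (1 - ?u)" using d j by (auto intro: less_le_trans[of 0 "1 / real j"])
    have "cmod (H ?u) \<le> C * cmod (1 - ?u) powr (- \<gamma>)" using cu r by (intro bound) simp
    also have "\<dots> = C * (cmod (1 - ?u) powr (2 - \<gamma>) * cmod (1 - ?u) powr (- 2))"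
      by (simp flip: powr_add)
    also have "\<dots> = C * (cmod (1 - ?u) powr (2 - \<gamma>) * (1 / (cmod (1 - ?u))\<^sup>2))"
      using d0 by (simp add: powr_minus divide_inverse)
    also have "\<dots> \<le> C * ((1 / real j) powr (2 - \<gamma>) * (1 / (cmod (1 - ?u))\<^sup>2))"
      using d j g by (intro mult_left_mono[OF _ C0] mult_right_mono powr_mono2') auto
    finally have H: "cmod (H ?u) \<le> C * ((1 / real j) powr (2 - \<gamma>) * (1 / (cmod (1 - ?u))\<^sup>2))" .
    have "cmod (H ?u / ?u ^ Suc j * vector_derivative (circlepath 0 r) (at x within {0..1})) = cmod (H ?u) * (2 * pi / r ^ j)"
      using cd cu r by (simp add: norm_mult norm_divide norm_power field_simps)
    also have "\<dots> \<le> C * ((1 / real j) powr (2 - \<gamma>) * (1 / (cmod (1 - ?u))\<^sup>2)) * (2 * pi / r ^ j)"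
      using H r by (intro mult_right_mono) auto
    also have "\<dots> = B * (1 / (cmod (1 - ?u))\<^sup>2)" by (simp add: B_def mult_ac)
    finally show ?thesis .
  qed
  have "cmod (2 * pi * \<i> / fact j * (deriv ^^ j) H 0) \<le> B * (1 / (1 - r\<^sup>2))"
    using integral_norm_bound_integral[OF has_integral_integrable[OF I] has_integral_integrable[OF K] pt]
    by (simp only: integral_unique[OF I] integral_unique[OF K])
  moreover have "cmod (2 * pi * \<i> / fact j * (deriv ^^ j) H 0) = 2 * pi * cmod ((deriv ^^ j) H 0 / fact j)"
    by (simp add: norm_mult norm_divide)
  ultimately have main: "cmod ((deriv ^^ j) H 0 / fact j) \<le> C * (1 / real j) powr (2 - \<gamma>) / r ^ j * (1 / (1 - r\<^sup>2))"
  proof -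
    have "B * (1 / (1 - r\<^sup>2)) = 2 * pi * (C * (1 / real j) powr (2 - \<gamma>) / r ^ j * (1 / (1 - r\<^sup>2)))"
      by (simp add: B_def mult_ac)
    moreover have "0 < 2 * pi" by simp
    ultimately show ?thesis
      using mult_le_cancel_left_pos[of "2 * pi"] \<open>cmod (2 * pi * \<i> / fact j * (deriv ^^ j) H 0) \<le> B * (1 / (1 - r\<^sup>2))\<close>
        \<open>cmod (2 * pi * \<i> / fact j * (deriv ^^ j) H 0) = 2 * pi * cmod ((deriv ^^ j) H 0 / fact j)\<close> by (simp only:)
  qed
  have "1 - r\<^sup>2 = (1 - r) * (1 + r)" by (simp add: power2_eq_square algebra_simps)
  then have "1 / real j * 1 \<le> 1 - r\<^sup>2" using r by (simp only: r(3)) (intro mult_left_mono, auto)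
  then have k1: "1 / (1 - r\<^sup>2) \<le> real j" using j frac_le[of 1 1 "1 / real j" "1 - r\<^sup>2"] by simp
  \<comment> \<open>(1 - 1 / j)^(-j) is bounded through ln (1 - x) \<ge> - x - 2 x^2 at x = 1 / j
    \<le> 1 / 2.\<close>
  have rj: "1 / r ^ j \<le> exp 2"
  proof -
    have "- (1 / real j) - 2 * (1 / real j)\<^sup>2 \<le> ln (1 - 1 / real j)"
      using j by (intro ln_one_minus_pos_lower_bound) (auto simp: field_simps)
    then have "real j * (- (1 / real j) - 2 * (1 / real j)\<^sup>2) \<le> real j * ln r"
      unfolding r_def by (intro mult_left_mono) auto
    moreover have "real j * (- (1 / real j) - 2 * (1 / real j)\<^sup>2) = - 1 - 2 / real j"
      using j by (simp add: power2_eq_square field_simps)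
    moreover have "2 / real j \<le> 1" using j by simp
    ultimately have "- 2 \<le> real j * ln r" by linarith
    then have "exp (- 2) \<le> exp (real j * ln r)" by simp
    also have "\<dots> = r ^ j" using r by (simp add: exp_of_nat_mult)
    finally show ?thesis using r by (simp add: exp_minus field_simps)
  qed
  have pj: "(1 / real j) powr (2 - \<gamma>) * real j = real j powr (\<gamma> - 1)"
  proof -
    have "(1 / real j) powr (2 - \<gamma>) = real j powr (\<gamma> - 2)"
      using j by (simp add: powr_divide powr_minus[symmetric] divide_inverse[symmetric] powr_minus_divide[symmetric])
    moreover have "real j powr ((\<gamma> - 2) + 1) = real j powr (\<gamma> - 2) * real j"
      using j by (simp only: powr_add) simp
    ultimately show ?thesis by simp
  qed
  note main
  also have "C * (1 / real j) powr (2 - \<gamma>) / r ^ j * (1 / (1 - r\<^sup>2)) = C * (1 / real j) powr (2 - \<gamma>) * (1 / r ^ j) * (1 / (1 - r\<^sup>2))" by simp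
  also have "\<dots> \<le> C * (1 / real j) powr (2 - \<gamma>) * exp 2 * real j"
    using rj k1 C0 r by (intro mult_mono) (auto simp: power_le_one)
  also have "\<dots> = C * exp 2 * ((1 / real j) powr (2 - \<gamma>) * real j)" by simp
  finally show ?thesis unfolding pj .
qed

lemma coefficient_bound:
  assumes R: "0 < R" and hol: "H holomorphic_on ball 0 R" and F: "H has_fps_expansion F" and g: "2 \<le> \<gamma>"
    and bound: "\<And>z. cmod z < R \<Longrightarrow> cmod (H z) \<le> C * cmod (1 - z / of_real R) powr (- \<gamma>)" and j: "2 \<le> j"
  shows "cmod (fps_nth F j) * R ^ j \<le> C * exp 2 * real j powr (\<gamma> - 1)"
proof -
  define H' where "H' = (\<lambda>z. H (of_real R * z))"
  have "H' holomorphic_on ball 0 1"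
    unfolding H'_def using R hol
    by (intro holomorphic_on_compose_gen[OF _ hol, unfolded o_def] holomorphic_intros) (auto simp: norm_mult)
  moreover have "cmod (H' z) \<le> C * cmod (1 - z) powr (- \<gamma>)" if "cmod z < 1" for z
    using bound[of "of_real R * z"] R that by (simp add: H'_def norm_mult)
  ultimately have "cmod ((deriv ^^ j) H' 0 / fact j) \<le> C * exp 2 * real j powr (\<gamma> - 1)"
    using g j by (intro coefficient_bound_unit)
  moreover have "(deriv ^^ j) H' 0 = of_real R ^ j * (deriv ^^ j) H (of_real R * 0)"
    unfolding H'_def
  proof (rule higher_deriv_compose_linear[OF hol])
    show "open (ball (0::complex) 1)" "open (ball (0::complex) R)" by auto
    show "of_real R * w \<in> ball 0 R" if "w \<in> ball 0 1" for w :: complex using that R by (simp add: norm_mult)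
  qed auto
  ultimately show ?thesis
    using R by (simp add: fps_nth_fps_expansion[OF F] norm_mult norm_divide norm_power mult.commute)
qed

section \<open>Functions on the indented disc\<close>

lemma Delta0_eq:
  assumes "0 < \<phi>" "\<phi> < pi"
  shows "Delta0 R \<eta> \<phi> = {z. cmod z < R * cmod (1 + of_real \<eta> * exp (\<i> * of_real \<phi>))} \<inter>
    {z. Re (z - of_real R) < cmod (z - of_real R) * cos \<phi>}"
proof -
  have "z \<noteq> of_real R \<and> \<bar>Arg (z - of_real R)\<bar> > \<phi> \<longleftrightarrow> Re (z - of_real R) < cmod (z - of_real R) * cos \<phi>" for z
  proof (cases "z = of_real R")
    case False
    let ?w = "z - of_real R"
    have w: "?w \<noteq> 0" using False by simp
    have "\<bar>Arg ?w\<bar> \<le> pi" using Arg_bounded[of ?w] by (auto simp: abs_le_iff)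
    then have "\<bar>Arg ?w\<bar> > \<phi> \<longleftrightarrow> cos \<bar>Arg ?w\<bar> < cos \<phi>"
      using assms by (subst cos_mono_less_eq) auto
    also have "cos \<bar>Arg ?w\<bar> = Re ?w / cmod ?w" using cos_Arg[OF w] by simp
    also have "Re ?w / cmod ?w < cos \<phi> \<longleftrightarrow> Re ?w < cmod ?w * cos \<phi>"
      using w by (subst pos_divide_less_eq) (auto simp: mult.commute)
    finally show ?thesis using False by simp
  qed simp
  then show ?thesis unfolding Delta0_def by auto
qed

text \<open>\<open>Arg\<close> jumps across the negative axis; in the form \<open>Delta0_eq\<close>
  the domain is cut out by strict inequalities between continuous functions.\<close>

lemma open_Delta0:
  assumes "0 < \<phi>" "\<phi> < pi"
  shows "open (Delta0 R \<eta> \<phi>)"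
  unfolding Delta0_eq[OF assms] by (intro open_Int open_Collect_less continuous_intros)

text \<open>Apart from R the closed disc lies strictly left of the vertical line through R, while
  the excluded sector, of half-angle \<phi> < pi / 2, lies on its right.\<close>

lemma cball_subset_Delta0:
  assumes R: "0 < R" and \<eta>: "0 < \<eta>" and \<phi>: "0 < \<phi>" "\<phi> < pi / 2" and z: "cmod z \<le> R" "z \<noteq> of_real R"
  shows "z \<in> Delta0 R \<eta> \<phi>"
proof -
  have c: "0 < cos \<phi>" using \<phi> by (intro cos_gt_zero) auto
  have "1 + \<eta> * cos \<phi> = Re (1 + of_real \<eta> * exp (\<i> * of_real \<phi>))" by (simp add: cis_conv_exp[symmetric])
  also have "\<dots> \<le> cmod (1 + of_real \<eta> * exp (\<i> * of_real \<phi>))" by (rule complex_Re_le_cmod)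
  finally have "1 < cmod (1 + of_real \<eta> * exp (\<i> * of_real \<phi>))" using \<eta> c by (auto intro: less_le_trans[of 1 "1 + \<eta> * cos \<phi>"])
  then have 1: "cmod z < R * cmod (1 + of_real \<eta> * exp (\<i> * of_real \<phi>))"
    using z R by (intro le_less_trans[OF z(1)]) simp
  have "Re z \<noteq> R"
  proof
    assume re: "Re z = R"
    have "(Re z)\<^sup>2 + (Im z)\<^sup>2 \<le> R\<^sup>2" using z(1) R by (simp add: cmod_def real_sqrt_le_iff' power2_eq_square[symmetric])
    then have "Im z = 0" using re by simp
    then show False using z(2) re by (simp add: complex_eq_iff)
  qed
  then have "Re (z - of_real R) < 0" using complex_Re_le_cmod[of z] z(1) by simp
  also have "0 \<le> cmod (z - of_real R) * cos \<phi>" using c by simp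
  finally show ?thesis using 1 \<phi> by (subst Delta0_eq) auto
qed

lemma norm_powr_of_real: "z \<noteq> 0 \<Longrightarrow> cmod (z powr of_real a) = cmod z powr a"
  by (simp add: powr_def)

lemma bigo_at_Delta0:
  assumes "f \<in> O[at_Delta0 R \<eta> \<phi>](g)"
  obtains c d where "0 < c" "0 < d" "\<And>z. z \<in> Delta0 R \<eta> \<phi> \<Longrightarrow> dist z (of_real R) < d \<Longrightarrow> cmod (f z) \<le> c * cmod (g z)"
proof -
  obtain c where c: "0 < c" "eventually (\<lambda>z. cmod (f z) \<le> c * cmod (g z)) (at_Delta0 R \<eta> \<phi>)"
    using assms by (elim landau_o.bigE) auto
  then obtain d where "0 < d" "\<And>z. z \<in> Delta0 R \<eta> \<phi> \<Longrightarrow> z \<noteq> of_real R \<Longrightarrow> dist z (of_real R) < d \<Longrightarrow> cmod (f z) \<le> c * cmod (g z)"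
    unfolding at_Delta0_def eventually_at by blast
  then show ?thesis using c(1) that[of c d] by (auto simp: Delta0_def)
qed

text \<open>Extends an estimate near R to the whole disc: the rest of the closed disc is a compact
  subset of the domain, where f is bounded, and |1 - z / R| \<le> 2 keeps the right-hand side away
  from 0.\<close>

lemma disc_bound:
  assumes R: "0 < R" and \<eta>: "0 < \<eta>" and \<phi>: "0 < \<phi>" "\<phi> < pi / 2" and g: "0 \<le> \<gamma>"
    and cont: "continuous_on (Delta0 R \<eta> \<phi>) f" and c: "0 \<le> c" and d: "0 < d"
    and near: "\<And>z. z \<in> Delta0 R \<eta> \<phi> \<Longrightarrow> dist z (of_real R) < d \<Longrightarrow> cmod (f z) \<le> c * cmod (1 - z / of_real R) powr (- \<gamma>)"
  shows "\<exists>C. \<forall>z. cmod z < R \<longrightarrow> cmod (f z) \<le> C * cmod (1 - z / of_real R) powr (- \<gamma>)"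
proof -
  let ?K = "cball 0 R - ball (complex_of_real R) d"
  have K: "?K \<subseteq> Delta0 R \<eta> \<phi>"
  proof
    fix z assume "z \<in> ?K"
    then show "z \<in> Delta0 R \<eta> \<phi>" using d by (intro cball_subset_Delta0 R \<eta> \<phi>) auto
  qed
  have "compact ?K" by (intro compact_diff) auto
  then have "bounded (f ` ?K)"
    using cont K by (intro compact_imp_bounded compact_continuous_image) (rule continuous_on_subset)
  then obtain B where "\<forall>y\<in>f ` ?K. cmod y \<le> B" unfolding bounded_iff by blast
  then have B: "cmod (f z) \<le> B" if "z \<in> ?K" for z using that by blast
  have "cmod (f z) \<le> (c + \<bar>B\<bar> * 2 powr \<gamma>) * cmod (1 - z / of_real R) powr (- \<gamma>)" if z: "cmod z < R" for z
  proof -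
    let ?x = "cmod (1 - z / of_real R)"
    have zR: "z \<noteq> of_real R" using z R by auto
    then have x0: "0 < ?x" using R by simp
    have "?x \<le> cmod 1 + cmod (z / of_real R)" by (rule norm_triangle_ineq4)
    also have "\<dots> \<le> 2" using z R by (simp add: norm_divide)
    finally have "2 powr (- \<gamma>) \<le> ?x powr (- \<gamma>)" using x0 g by (intro powr_mono2') auto
    then have "2 powr \<gamma> * 2 powr (- \<gamma>) \<le> 2 powr \<gamma> * ?x powr (- \<gamma>)" by (intro mult_left_mono) auto
    then have one: "1 \<le> 2 powr \<gamma> * ?x powr (- \<gamma>)" by (simp flip: powr_add)
    show ?thesis
    proof (cases "dist z (of_real R) < d")
      case True
      have "cmod (f z) \<le> c * ?x powr (- \<gamma>)"
        using z zR True by (intro near cball_subset_Delta0 R \<eta> \<phi>) auto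
      also have "\<dots> \<le> (c + \<bar>B\<bar> * 2 powr \<gamma>) * ?x powr (- \<gamma>)" by (intro mult_right_mono) auto
      finally show ?thesis .
    next
      case False
      have "cmod (f z) \<le> B" using z False by (intro B) (auto simp: dist_commute)
      also have "\<dots> \<le> \<bar>B\<bar> * 1" by simp
      also have "\<dots> \<le> \<bar>B\<bar> * (2 powr \<gamma> * ?x powr (- \<gamma>))" using one by (intro mult_left_mono) auto
      also have "\<dots> \<le> (c + \<bar>B\<bar> * 2 powr \<gamma>) * ?x powr (- \<gamma>)"
        using c by (simp add: distrib_right)
      finally show ?thesis .
    qed
  qed
  then show ?thesis by blast
qed

section \<open>Size of the coefficients of \<theta> and \<kappa>\<close>

lemma fps_nth_higher_deriv:
  "fps_nth ((fps_deriv ^^ n) F) m = pochhammer (of_nat (Suc m)) n * fps_nth F (m + n)"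
  for F :: "complex fps"
proof (induction n arbitrary: m)
  case (Suc n)
  have "fps_nth ((fps_deriv ^^ Suc n) F) m = of_nat (Suc m) * (pochhammer (of_nat (Suc (Suc m))) n * fps_nth F (Suc m + n))"
    by (simp add: Suc del: of_nat_Suc)
  also have "\<dots> = pochhammer (of_nat (Suc m)) (Suc n) * fps_nth F (m + Suc n)"
    by (simp add: pochhammer_rec add.commute)
  finally show ?case .
qed simp

lemma gbr_has_fps_expansion:
  assumes "G has_fps_expansion F"
  shows "gbr n G has_fps_expansion fps_X ^ n * (fps_deriv ^^ n) F"
proof -
  have "(deriv ^^ n) G has_fps_expansion (fps_deriv ^^ n) F"
    using assms by (induction n) (auto intro: has_fps_expansion_deriv)
  then show ?thesis unfolding gbr_def by (intro has_fps_expansion_mult has_fps_expansion_fps_X_power)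
qed

lemma fps_nth_gbr:
  fixes F :: "complex fps"
  assumes "n \<le> j"
  shows "fps_nth (fps_X ^ n * (fps_deriv ^^ n) F) j = pochhammer (of_nat (Suc (j - n))) n * fps_nth F j"
  using assms by (simp add: fps_X_power_mult_nth fps_nth_higher_deriv del: of_nat_Suc)

definition gfps :: "(nat \<Rightarrow> real) \<Rightarrow> complex fps" where
  "gfps a = Abs_fps (gcoeff a)"

lemma fps_nth_gfps: "1 \<le> j \<Longrightarrow> fps_nth (gfps a) j = of_real (a j / real j)"
  by (simp add: gfps_def gcoeff_def)

lemma gser_has_fps_expansion:
  assumes R: "0 < R" and rad: "conv_radius (gcoeff a) = ereal R" and ext: "\<And>z. cmod z < R \<Longrightarrow> G z = gser a z"
  shows "G has_fps_expansion gfps a"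
  unfolding has_fps_expansion_def
proof
  show "0 < fps_conv_radius (gfps a)"
    using R rad by (simp add: fps_conv_radius_def gfps_def)
  have "eventually (\<lambda>z::complex. z \<in> ball 0 R) (nhds 0)" using R by (intro eventually_nhds_in_open) auto
  then show "eventually (\<lambda>z. eval_fps (gfps a) z = G z) (nhds 0)"
    by eventually_elim (simp add: eval_fps_def gfps_def ext gser_def)
qed

lemma gbr_continuous_on:
  assumes "G holomorphic_on S" "open S"
  shows "continuous_on S (gbr n G)"
  unfolding gbr_def
  by (intro continuous_intros holomorphic_on_imp_continuous_on[OF holomorphic_higher_deriv[OF assms]])

lemma gbr_holomorphic_on:
  assumes "G holomorphic_on S" "open S"
  shows "gbr n G holomorphic_on S"
  unfolding gbr_def by (intro holomorphic_intros assms)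

text \<open>Used to divide out the factor of order j^n that n differentiations put on the j-th
  coefficient.\<close>

lemma pochhammer_lower:
  assumes "n \<le> j" "1 \<le> j"
  shows "(real j / real (Suc n)) ^ n \<le> pochhammer (real (Suc (j - n))) n"
proof -
  have "real j / real (Suc n) \<le> real (Suc (j - n))"
  proof -
    have "real n * real n \<le> real n * real j" using assms(1) by (intro mult_left_mono) auto
    then have "real j \<le> (real j - real n + 1) * real (Suc n)" by (simp add: algebra_simps)
    then have "real j / real (Suc n) \<le> real j - real n + 1" by (subst pos_divide_le_eq) auto
    then show ?thesis using assms(1) by (simp add: of_nat_diff)
  qed
  then have "(\<Prod>i = 0..<n. real j / real (Suc n)) \<le> (\<Prod>i = 0..<n. real (Suc (j - n)) + of_nat i)"
    by (intro prod_mono) auto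
  then show ?thesis by (simp add: pochhammer_prod del: of_nat_Suc)
qed

lemma ball_subset_Delta0:
  assumes "0 < R" "0 < \<eta>" "0 < \<phi>" "\<phi> < pi / 2"
  shows "ball 0 R \<subseteq> Delta0 R \<eta> \<phi>"
proof
  fix z :: complex assume "z \<in> ball 0 R"
  then have "cmod z < R" by simp
  then show "z \<in> Delta0 R \<eta> \<phi>" using assms by (intro cball_subset_Delta0) auto
qed

text \<open>After n \<ge> s + 2 differentiations the singular exponent n - s is at least 2 and
  \<open>coefficient_bound\<close> applies. Division by the factor j^n of the derivative leaves a_j
  R^j = O(j^(-s)), and s > 1 finishes.\<close>

lemma kappa_coefficients:
  assumes R: "0 < R" and \<eta>: "0 < \<eta>" and \<phi>: "0 < \<phi>" "\<phi> < pi / 2"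
    and rad: "conv_radius (gcoeff a) = ereal R" and ext: "\<And>z. cmod z < R \<Longrightarrow> G z = gser a z"
    and hol: "G holomorphic_on Delta0 R \<eta> \<phi>"
    and n: "s + 2 \<le> real n" and \<delta>: "0 < \<delta>" and s: "1 < s"
    and asym: "(\<lambda>z. gbr n G z - of_real b * (1 - z / of_real R) powr of_real (s - real n))
        \<in> O[at_Delta0 R \<eta> \<phi>](\<lambda>z. of_real b * (1 - z / of_real R) powr of_real (s - real n) * (1 - z / of_real R) powr of_real \<delta>)"
  shows "(\<lambda>j. real j * (\<bar>a j\<bar> * R ^ j)) \<longlonglongrightarrow> 0"
proof -
  define \<gamma> where "\<gamma> = real n - s"
  have g: "2 \<le> \<gamma>" using n by (simp add: \<gamma>_def)
  have op: "open (Delta0 R \<eta> \<phi>)" using \<phi> by (intro open_Delta0) auto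
  obtain c d where c: "0 < c" and d: "0 < d" and near: "\<And>z. z \<in> Delta0 R \<eta> \<phi> \<Longrightarrow> dist z (of_real R) < d \<Longrightarrow>
     cmod (gbr n G z - of_real b * (1 - z / of_real R) powr of_real (s - real n)) \<le>
     c * cmod (of_real b * (1 - z / of_real R) powr of_real (s - real n) * (1 - z / of_real R) powr of_real \<delta>)"
    using bigo_at_Delta0[OF asym] by metis
  \<comment> \<open>At distance less than R from the singularity |1 - z / R| \<le> 1, so the extra
    factor with exponent \<delta> in the error term is at most 1.\<close>
  have "cmod (gbr n G z) \<le> (\<bar>b\<bar> * (1 + c)) * cmod (1 - z / of_real R) powr (- \<gamma>)"
    if z: "z \<in> Delta0 R \<eta> \<phi>" and dz: "dist z (of_real R) < min d R" for z
  proof -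
    let ?x = "cmod (1 - z / of_real R)"
    have zR: "z \<noteq> of_real R" using z by (simp add: Delta0_def)
    then have nz: "1 - z / of_real R \<noteq> 0" using R by simp
    have "?x = dist z (of_real R) / R"
    proof -
      have "1 - z / of_real R = (of_real R - z) / of_real R" using R by (simp add: field_simps)
      then show ?thesis using R by (simp add: norm_divide dist_norm norm_minus_commute)
    qed
    then have x1: "?x \<le> 1" using dz R by simp
    have dz': "dist z (of_real R) < d" using dz by simp
    have xd: "?x powr \<delta> \<le> 1" using x1 \<delta> by (intro powr_le1) auto
    have "cmod (gbr n G z) \<le> cmod (of_real b * (1 - z / of_real R) powr of_real (s - real n)) + cmod (gbr n G z - of_real b * (1 - z / of_real R) powr of_real (s - real n))"
      by (rule norm_triangle_sub)
    also have "\<dots> \<le> \<bar>b\<bar> * ?x powr (s - real n) + c * (\<bar>b\<bar> * ?x powr (s - real n) * ?x powr \<delta>)"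
      using near[OF z dz'] unfolding norm_mult norm_powr_of_real[OF nz] norm_of_real by simp
    also have "\<dots> \<le> \<bar>b\<bar> * ?x powr (s - real n) + c * (\<bar>b\<bar> * ?x powr (s - real n) * 1)"
      using xd c by (intro add_left_mono mult_left_mono) auto
    also have "\<dots> = (\<bar>b\<bar> * (1 + c)) * ?x powr (- \<gamma>)" by (simp add: \<gamma>_def algebra_simps)
    finally show ?thesis .
  qed
  then have "\<exists>C. \<forall>z. cmod z < R \<longrightarrow> cmod (gbr n G z) \<le> C * cmod (1 - z / of_real R) powr (- \<gamma>)"
    using c d R g by (intro disc_bound[OF R \<eta> \<phi> _ gbr_continuous_on[OF hol op], where d = "min d R" and c = "\<bar>b\<bar> * (1 + c)"]) auto
  then obtain C where C: "\<And>z. cmod z < R \<Longrightarrow> cmod (gbr n G z) \<le> C * cmod (1 - z / of_real R) powr (- \<gamma>)" by blast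
  have F: "gbr n G has_fps_expansion fps_X ^ n * (fps_deriv ^^ n) (gfps a)"
    by (rule gbr_has_fps_expansion[OF gser_has_fps_expansion[OF R rad ext]])
  have hb: "gbr n G holomorphic_on ball 0 R"
    using gbr_holomorphic_on[OF hol op] ball_subset_Delta0[OF R \<eta> \<phi>] by (rule holomorphic_on_subset)
  define K where "K = C * exp 2 * real (Suc n) ^ n"
  have bnd: "real j * (\<bar>a j\<bar> * R ^ j) \<le> K * real j powr (1 - s)" if j: "max 2 n \<le> j" for j
  proof -
    have j': "n \<le> j" "1 \<le> j" "2 \<le> j" using j by auto
    have "cmod (fps_nth (fps_X ^ n * (fps_deriv ^^ n) (gfps a)) j) * R ^ j \<le> C * exp 2 * real j powr (\<gamma> - 1)"
      by (rule coefficient_bound[OF R hb F g C j'(3)])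
    moreover have "cmod (fps_nth (fps_X ^ n * (fps_deriv ^^ n) (gfps a)) j) = pochhammer (real (Suc (j - n))) n * (\<bar>a j\<bar> / real j)"
    proof -
      have "pochhammer (of_nat (Suc (j - n)) :: complex) n = of_real (pochhammer (real (Suc (j - n))) n)"
        by (simp flip: pochhammer_of_real)
      moreover have "0 \<le> pochhammer (real (Suc (j - n))) n" by (intro less_imp_le pochhammer_pos) auto
      ultimately show ?thesis
        using fps_nth_gbr[OF j'(1), of "gfps a"] fps_nth_gfps[OF j'(2), of a]
        by (simp only: norm_mult norm_of_real abs_divide abs_of_nonneg abs_of_nat)
    qed
    ultimately have 1: "pochhammer (real (Suc (j - n))) n * (\<bar>a j\<bar> / real j) * R ^ j \<le> C * exp 2 * real j powr (\<gamma> - 1)" by simp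
    have "(real j / real (Suc n)) ^ n * (\<bar>a j\<bar> / real j * R ^ j) \<le> pochhammer (real (Suc (j - n))) n * (\<bar>a j\<bar> / real j * R ^ j)"
      using R by (intro mult_right_mono pochhammer_lower j') auto
    then have "(real j / real (Suc n)) ^ n * (\<bar>a j\<bar> / real j * R ^ j) \<le> C * exp 2 * real j powr (\<gamma> - 1)"
      using 1 by (simp add: mult.assoc)
    then have "real (Suc n) ^ n * ((real j / real (Suc n)) ^ n * (\<bar>a j\<bar> / real j * R ^ j)) \<le> real (Suc n) ^ n * (C * exp 2 * real j powr (\<gamma> - 1))"
      by (intro mult_left_mono) auto
    then have "real j ^ n * (\<bar>a j\<bar> / real j * R ^ j) \<le> K * real j powr (\<gamma> - 1)"
      by (simp add: power_divide K_def mult_ac)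
    then have "real j powr (2 - real n) * (real j ^ n * (\<bar>a j\<bar> / real j * R ^ j)) \<le> real j powr (2 - real n) * (K * real j powr (\<gamma> - 1))"
      by (intro mult_left_mono) auto
    moreover have "real j powr (2 - real n) * (real j ^ n * (\<bar>a j\<bar> / real j * R ^ j)) = real j * (\<bar>a j\<bar> * R ^ j)"
    proof -
      have "real j powr (2 - real n) * real j ^ n = real j powr (2 - real n) * real j powr (real n)"
        using j' by (simp add: powr_realpow)
      also have "\<dots> = real j ^ 2" using j' by (simp flip: powr_add)
      finally show ?thesis using j' by (simp add: power2_eq_square flip: mult.assoc)
    qed
    moreover have "real j powr (2 - real n) * (K * real j powr (\<gamma> - 1)) = K * real j powr (1 - s)"
    proof -
      have "real j powr (2 - real n) * real j powr (\<gamma> - 1) = real j powr (1 - s)"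
        by (simp add: \<gamma>_def flip: powr_add)
      then show ?thesis by (simp add: mult.left_commute)
    qed
    ultimately show ?thesis by simp
  qed
  have lim: "(\<lambda>j. K * real j powr (1 - s)) \<longlonglongrightarrow> K * 0"
    using s by (intro tendsto_mult tendsto_const tendsto_neg_powr filterlim_real_sequentially) auto
  show ?thesis
  proof (rule tendsto_sandwich[OF _ _ tendsto_const])
    show "eventually (\<lambda>j. 0 \<le> real j * (\<bar>a j\<bar> * R ^ j)) sequentially" using R by (intro always_eventually) auto
    show "eventually (\<lambda>j. real j * (\<bar>a j\<bar> * R ^ j) \<le> K * real j powr (1 - s)) sequentially"
      using eventually_ge_at_top[of "max 2 n"] by eventually_elim (rule bnd)
    show "(\<lambda>j. K * real j powr (1 - s)) \<longlonglongrightarrow> 0" using lim by simp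
  qed
qed

text \<open>Order 3 is the least for which the remainder after removal of the pole, of exponent 3 -
  \<epsilon> with \<epsilon> \<le> 1, meets the condition \<gamma> \<ge> 2 of
  \<open>coefficient_bound\<close>. Multiplied by R^j, the coefficients of the two parts are
  (j-1)(j-2) a_j R^j and t (j+1)(j+2), which agree up to order j^(2-\<epsilon>).\<close>

lemma theta_coefficients:
  assumes R: "0 < R" and \<eta>: "0 < \<eta>" and \<phi>: "0 < \<phi>" "\<phi> < pi / 2"
    and rad: "conv_radius (gcoeff a) = ereal R" and ext: "\<And>z. cmod z < R \<Longrightarrow> G z = gser a z"
    and hol: "G holomorphic_on Delta0 R \<eta> \<phi>"
    and \<delta>: "0 < \<delta>" and t: "0 < t"
    and asym: "(\<lambda>z. gbr 3 G z - of_real (t * fact (3 - 1)) / (1 - z / of_real R) ^ 3)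
        \<in> O[at_Delta0 R \<eta> \<phi>](\<lambda>z. of_real (t * fact (3 - 1)) / (1 - z / of_real R) ^ 3 * (1 - z / of_real R) powr of_real \<delta>)"
  shows "\<exists>K \<epsilon>. 0 < \<epsilon> \<and> (\<forall>j\<ge>3. \<bar>a j * R ^ j - t\<bar> \<le> K * real j powr (- \<epsilon>))"
proof -
  \<comment> \<open>Capped at 1 to keep \<gamma> = 3 - \<epsilon> at least 2.\<close>
  define \<epsilon> where "\<epsilon> = min \<delta> 1"
  have \<epsilon>: "0 < \<epsilon>" "\<epsilon> \<le> 1" "\<epsilon> \<le> \<delta>" using \<delta> by (auto simp: \<epsilon>_def)
  define \<gamma> where "\<gamma> = 3 - \<epsilon>"
  have g: "2 \<le> \<gamma>" using \<epsilon> by (simp add: \<gamma>_def)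
  have op: "open (Delta0 R \<eta> \<phi>)" using \<phi> by (intro open_Delta0) auto
  have f2: "(fact (3 - 1) :: real) = 2" by (simp add: numeral_2_eq_2)
  define H where "H = (\<lambda>z. gbr 3 G z - of_real (2 * t) * inverse ((1 - of_real (1 / R) * z) ^ 3))"
  have Hz: "H z = gbr 3 G z - of_real (t * fact (3 - 1)) / (1 - z / of_real R) ^ 3" for z
    unfolding H_def f2 by (simp add: divide_inverse mult_ac)
  obtain c d where c: "0 < c" and d: "0 < d" and near: "\<And>z. z \<in> Delta0 R \<eta> \<phi> \<Longrightarrow> dist z (of_real R) < d \<Longrightarrow>
     cmod (H z) \<le> c * cmod (of_real (t * fact (3 - 1)) / (1 - z / of_real R) ^ 3 * (1 - z / of_real R) powr of_real \<delta>)"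
    using bigo_at_Delta0[OF asym] unfolding Hz by metis
  have nzD: "1 - of_real (1 / R) * z \<noteq> 0" if "z \<in> Delta0 R \<eta> \<phi>" for z
    using that R by (auto simp: Delta0_def field_simps)
  have contH: "continuous_on (Delta0 R \<eta> \<phi>) H"
    unfolding H_def using nzD by (intro continuous_intros gbr_continuous_on[OF hol op]) auto
  have "cmod (H z) \<le> (c * (2 * t)) * cmod (1 - z / of_real R) powr (- \<gamma>)"
    if z: "z \<in> Delta0 R \<eta> \<phi>" and dz: "dist z (of_real R) < min d R" for z
  proof -
    let ?x = "cmod (1 - z / of_real R)"
    have zR: "z \<noteq> of_real R" using z by (simp add: Delta0_def)
    then have nz: "1 - z / of_real R \<noteq> 0" using R by simp
    then have x0: "0 < ?x" by simp
    have "?x = dist z (of_real R) / R"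
    proof -
      have "1 - z / of_real R = (of_real R - z) / of_real R" using R by (simp add: field_simps)
      then show ?thesis using R by (simp add: norm_divide dist_norm norm_minus_commute)
    qed
    then have x1: "?x \<le> 1" using dz R by simp
    have "cmod (H z) \<le> c * cmod (of_real (t * fact (3 - 1)) / (1 - z / of_real R) ^ 3 * (1 - z / of_real R) powr of_real \<delta>)"
      using dz by (intro near z) auto
    also have "\<dots> = c * (2 * t / ?x ^ 3 * ?x powr \<delta>)"
      unfolding f2 norm_mult norm_divide norm_power norm_powr_of_real[OF nz] norm_of_real using t by simp
    also have "\<dots> = c * (2 * t * ?x powr (\<delta> - 3))"
    proof -
      have "?x powr (\<delta> - 3) = ?x powr \<delta> / ?x ^ 3" using powr_realpow[OF x0, of 3] by (simp add: powr_diff)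
      then show ?thesis by simp
    qed
    also have "\<dots> \<le> c * (2 * t * ?x powr (- \<gamma>))"
      using c t x0 x1 \<epsilon> by (intro mult_left_mono powr_mono') (auto simp: \<gamma>_def)
    finally show ?thesis by (simp add: mult.assoc)
  qed
  then have "\<exists>C. \<forall>z. cmod z < R \<longrightarrow> cmod (H z) \<le> C * cmod (1 - z / of_real R) powr (- \<gamma>)"
    using c d R g t by (intro disc_bound[OF R \<eta> \<phi> _ contH, where d = "min d R" and c = "c * (2 * t)"]) auto
  then obtain C where C: "\<And>z. cmod z < R \<Longrightarrow> cmod (H z) \<le> C * cmod (1 - z / of_real R) powr (- \<gamma>)" by blast
  define F where "F = fps_X ^ 3 * (fps_deriv ^^ 3) (gfps a) - fps_const (of_real (2 * t)) * inverse ((1 - fps_const (of_real (1 / R)) * fps_X) ^ 3)"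
  have F: "H has_fps_expansion F"
    unfolding H_def F_def
    by (intro has_fps_expansion_diff has_fps_expansion_mult has_fps_expansion_const has_fps_expansion_inverse
          has_fps_expansion_power has_fps_expansion_1 has_fps_expansion_fps_X gbr_has_fps_expansion gser_has_fps_expansion[OF R rad ext]) auto
  have hb: "H holomorphic_on ball 0 R"
    unfolding H_def using nzD ball_subset_Delta0[OF R \<eta> \<phi>]
    by (intro holomorphic_intros holomorphic_on_subset[OF gbr_holomorphic_on[OF hol op]]) auto
  have Fj: "fps_nth F j * of_real R ^ j = of_real ((real j - 1) * (real j - 2) * (a j * R ^ j) - t * ((real j + 1) * (real j + 2)))" if j: "3 \<le> j" for j
  proof -
    have p: "pochhammer (of_nat (Suc (j - 3)) :: complex) 3 = of_real ((real j - 2) * (real j - 1) * real j)"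
      using j by (simp add: numeral_3_eq_3 pochhammer_Suc of_nat_diff algebra_simps)
    have ch: "of_nat (Suc (Suc j) choose j) = (of_real ((real j + 1) * (real j + 2) / 2) :: complex)"
    proof -
      have "Suc (Suc j) choose j = (j + 2) choose 2"
        using binomial_symmetric[of j "j + 2"] by (simp add: add.commute)
      moreover have "2 * ((j + 2) choose 2) = (j + 2) * (j + 1)" by (simp add: choose_two)
      ultimately have "2 * (Suc (Suc j) choose j) = (j + 2) * (j + 1)" by (simp only:)
      moreover have "real X = (real j + 1) * (real j + 2) / 2" if "2 * X = (j + 2) * (j + 1)" for X
        using arg_cong[OF that, of real] by (simp add: algebra_simps)
      ultimately have r: "real (Suc (Suc j) choose j) = (real j + 1) * (real j + 2) / 2" by blast
      have "(of_nat (Suc (Suc j) choose j) :: complex) = of_real (real (Suc (Suc j) choose j))" by (rule of_real_of_nat_eq[symmetric])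
      then show ?thesis unfolding r .
    qed
    have "fps_nth F j = of_real ((real j - 2) * (real j - 1) * real j) * of_real (a j / real j) - of_real (2 * t) * (of_real ((real j + 1) * (real j + 2) / 2) * of_real (1 / R) ^ j)"
      unfolding F_def fps_sub_nth fps_mult_left_const_nth fps_nth_gbr[OF j] p
      using j fps_nth_gfps[of j a] by (subst one_minus_const_fps_X_neg_power') (simp_all add: ch del: of_real_mult of_real_divide binomial_Suc_Suc)
    also have "\<dots> * of_real R ^ j = of_real (((real j - 2) * (real j - 1) * real j * (a j / real j) - 2 * t * (((real j + 1) * (real j + 2) / 2) * (1 / R) ^ j)) * R ^ j)"
      by simp
    also have "((real j - 2) * (real j - 1) * real j * (a j / real j) - 2 * t * (((real j + 1) * (real j + 2) / 2) * (1 / R) ^ j)) * R ^ j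
      = (real j - 1) * (real j - 2) * (a j * R ^ j) - t * ((real j + 1) * (real j + 2))"
    proof -
      have gen: "((x - 2) * (x - 1) * x * y - 2 * t * ((z / 2) * p)) * q = (x - 1) * (x - 2) * ((x * y) * q) - t * (z * (p * q))"
        for x y z p q :: real by (simp add: algebra_simps)
      have r1: "real j * (a j / real j) = a j" using j by simp
      have r2: "(1 / R) ^ j * R ^ j = 1" using R by (simp add: power_one_over)
      show ?thesis unfolding gen r1 r2 by simp
    qed
    finally show ?thesis .
  qed
  \<comment> \<open>9 / 2 inverts the lower bound 2/9 j^2 of (j-1)(j-2) for j \<ge> 3, and 6 t comes
    from (j+1)(j+2) - (j-1)(j-2) = 6 j.\<close>
  define K where "K = 9 / 2 * (\<bar>C\<bar> * exp 2 + 6 * t)"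
  have "\<bar>a j * R ^ j - t\<bar> \<le> K * real j powr (- \<epsilon>)" if j: "3 \<le> j" for j
  proof -
    have "cmod (fps_nth F j) * R ^ j \<le> C * exp 2 * real j powr (\<gamma> - 1)"
      using j by (intro coefficient_bound[OF R hb F g C]) auto
    also have "\<dots> \<le> \<bar>C\<bar> * exp 2 * real j powr (\<gamma> - 1)" by (intro mult_right_mono) auto
    also have "cmod (fps_nth F j) * R ^ j = cmod (fps_nth F j * of_real R ^ j)" using R by (simp add: norm_mult norm_power)
    finally have 1: "\<bar>(real j - 1) * (real j - 2) * (a j * R ^ j) - t * ((real j + 1) * (real j + 2))\<bar> \<le> \<bar>C\<bar> * exp 2 * real j powr (\<gamma> - 1)"
      unfolding Fj[OF j] norm_of_real .
    have pa: "real j powr (2 - \<epsilon>) = real j ^ 2 * real j powr (- \<epsilon>)" using powr_add[of "real j" 2 "- \<epsilon>"] j by simp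
    then have g1: "real j powr (\<gamma> - 1) = real j ^ 2 * real j powr (- \<epsilon>)" by (simp add: \<gamma>_def)
    have g2: "real j \<le> real j ^ 2 * real j powr (- \<epsilon>)"
      using powr_mono[of 1 "2 - \<epsilon>" "real j"] j \<epsilon> by (simp add: pa)
    have "(real j - 1) * (real j - 2) * (a j * R ^ j - t) = ((real j - 1) * (real j - 2) * (a j * R ^ j) - t * ((real j + 1) * (real j + 2))) + 6 * t * real j"
      by (simp add: algebra_simps)
    also have "\<bar>\<dots>\<bar> \<le> \<bar>C\<bar> * exp 2 * (real j ^ 2 * real j powr (- \<epsilon>)) + 6 * t * (real j ^ 2 * real j powr (- \<epsilon>))"
    proof (intro order_trans[OF abs_triangle_ineq add_mono])
      show "\<bar>6 * t * real j\<bar> \<le> 6 * t * (real j ^ 2 * real j powr (- \<epsilon>))" using t g2 by simp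
    qed (use 1 g1 in simp)
    finally have 2: "\<bar>(real j - 1) * (real j - 2) * (a j * R ^ j - t)\<bar> \<le> (\<bar>C\<bar> * exp 2 + 6 * t) * (real j ^ 2 * real j powr (- \<epsilon>))"
      by (simp add: distrib_right)
    have lo: "2 / 9 * real j ^ 2 \<le> (real j - 1) * (real j - 2)"
    proof -
      have "2 / 3 * real j * (1 / 3 * real j) \<le> (real j - 1) * (real j - 2)"
        using j by (intro mult_mono) auto
      then show ?thesis by (simp add: power2_eq_square)
    qed
    have "2 / 9 * real j ^ 2 * \<bar>a j * R ^ j - t\<bar> \<le> (real j - 1) * (real j - 2) * \<bar>a j * R ^ j - t\<bar>"
      using lo by (intro mult_right_mono) auto
    also have "\<dots> = \<bar>(real j - 1) * (real j - 2) * (a j * R ^ j - t)\<bar>" using j by (simp add: abs_mult)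
    also note 2
    finally have fin: "2 / 9 * real j ^ 2 * \<bar>a j * R ^ j - t\<bar> \<le> (\<bar>C\<bar> * exp 2 + 6 * t) * (real j ^ 2 * real j powr (- \<epsilon>))" .
    have scale: "x * y \<le> x * (9 / 2 * z * p)" if "2 / 9 * x * y \<le> z * (x * p)" for x y z p :: real
    proof -
      have "x * (9 / 2 * z * p) = 9 / 2 * (z * (x * p))" by simp
      then show ?thesis using that by linarith
    qed
    have "real j ^ 2 * \<bar>a j * R ^ j - t\<bar> \<le> real j ^ 2 * (K * real j powr (- \<epsilon>))"
      unfolding K_def by (rule scale[OF fin])
    then show ?thesis using j by simp
  qed
  then show ?thesis using \<epsilon>(1) by blast
qed

text \<open>Only the radial limit of z G'(z) is given. Nonnegative coefficients turn it into a bound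
  for the partial sums, and once summability is known, Abel's theorem identifies the sum.\<close>

lemma kappa_sums:
  assumes R: "0 < R" and rad: "conv_radius (gcoeff a) = ereal R" and ext: "\<And>z. cmod z < R \<Longrightarrow> G z = gser a z"
    and nonneg: "\<And>j. 1 \<le> j \<Longrightarrow> 0 \<le> a j"
    and lim: "((\<lambda>r. gbr 1 G (of_real r)) \<longlongrightarrow> of_real \<mu>) (at_left R)"
  shows "(\<lambda>j. if j = 0 then 0 else a j * R ^ j) sums \<mu>"
proof -
  define w where "w = (\<lambda>j. if j = 0 then 0 else a j * R ^ j)"
  have w0: "0 \<le> w j" for j using nonneg[of j] R by (auto simp: w_def)
  have sm: "summable (\<lambda>n. gcoeff a n * z ^ n)" if "cmod z < R" for z
    using that rad by (intro summable_in_conv_radius) simp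
  have gbr: "(\<lambda>j. w j * x ^ j) sums Re (gbr 1 G (of_real (R * x)))" if x: "0 < x" "x < 1" for x
  proof -
    let ?z = "complex_of_real (R * x)"
    have z: "cmod ?z < R" using x R by (simp add: norm_mult)
    obtain K where K: "cmod ?z < K" "K < R" using dense[OF z] by auto
    have K0: "0 \<le> K" using K(1) norm_ge_zero[of ?z] by linarith
    have "((\<lambda>z. \<Sum>n. gcoeff a n * z ^ n) has_field_derivative (\<Sum>n. diffs (gcoeff a) n * ?z ^ n)) (at ?z)"
      by (rule termdiffs_strong[of _ "of_real K"]) (use sm[of "of_real K"] K K0 in auto)
    then have "(G has_field_derivative (\<Sum>n. diffs (gcoeff a) n * ?z ^ n)) (at ?z)"
      by (rule has_field_derivative_transform_within_open[where S = "ball 0 R"]) (use z in \<open>auto simp: ext gser_def\<close>)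
    then have "gbr 1 G ?z = ?z * (\<Sum>n. diffs (gcoeff a) n * ?z ^ n)" by (simp add: gbr_def DERIV_imp_deriv)
    moreover have "summable (\<lambda>n. diffs (gcoeff a) n * ?z ^ n)"
      using z sm by (rule termdiff_converges)
    ultimately have "(\<lambda>n. ?z * (diffs (gcoeff a) n * ?z ^ n)) sums gbr 1 G ?z"
      by (simp add: sums_mult summable_sums)
    then have "(\<lambda>n. Re (?z * (diffs (gcoeff a) n * ?z ^ n))) sums Re (gbr 1 G ?z)" by (rule sums_Re)
    moreover have "?z * (diffs (gcoeff a) n * ?z ^ n) = of_real (w (Suc n) * x ^ Suc n)" for n
    proof -
      have "diffs (gcoeff a) n = of_real (a (Suc n))"
        by (simp add: diffs_def gcoeff_def del: of_nat_Suc)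
      then show ?thesis by (simp add: w_def power_mult_distrib mult_ac)
    qed
    ultimately have "(\<lambda>n. w (Suc n) * x ^ Suc n) sums Re (gbr 1 G ?z)" by (simp only: Re_complex_of_real)
    then show ?thesis using sums_Suc[of "\<lambda>n. w n * x ^ n"] by (simp add: w_def)
  qed
  have "filterlim (\<lambda>x. R * x) (at_left R) (at_left 1)"
  proof (rule filterlim_at_withinI)
    have "((\<lambda>x. R * x) \<longlongrightarrow> R * 1) (at_left 1)" by (intro tendsto_intros)
    then show "((\<lambda>x. R * x) \<longlongrightarrow> R) (at_left 1)" by simp
    show "eventually (\<lambda>x. R * x \<in> {..<R} - {R}) (at_left 1)"
      using R by (intro eventually_at_leftI[of 0]) auto
  qed
  from tendsto_Re[OF filterlim_compose[OF lim this]]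
  have L1: "((\<lambda>x. Re (gbr 1 G (of_real (R * x)))) \<longlongrightarrow> \<mu>) (at_left 1)" by simp
  have ev: "eventually (\<lambda>x. Re (gbr 1 G (of_real (R * x))) = (\<Sum>j. w j * x ^ j)) (at_left 1)"
    using gbr by (intro eventually_at_leftI[of 0]) (auto simp: sums_iff)
  have L: "((\<lambda>x. \<Sum>j. w j * x ^ j) \<longlongrightarrow> \<mu>) (at_left 1)"
    by (rule Lim_transform_eventually[OF L1 ev])
  have "summable w"
  proof (rule bounded_imp_summable)
    fix n
    have "((\<lambda>x. \<Sum>j\<le>n. w j * x ^ j) \<longlongrightarrow> (\<Sum>j\<le>n. w j * 1 ^ j)) (at_left 1)" by (intro tendsto_intros)
    moreover have "eventually (\<lambda>x. (\<Sum>j\<le>n. w j * x ^ j) \<le> (\<Sum>j. w j * x ^ j)) (at_left 1)"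
    proof (rule eventually_at_leftI[of 0])
      fix x :: real assume x: "x \<in> {0<..<1}"
      then show "(\<Sum>j\<le>n. w j * x ^ j) \<le> (\<Sum>j. w j * x ^ j)"
        using gbr[of x] w0 by (intro sum_le_suminf) (auto simp: sums_iff)
    qed simp
    ultimately have "(\<Sum>j\<le>n. w j * 1 ^ j) \<le> \<mu>"
      using tendsto_le[OF trivial_limit_at_left_real L] by blast
    then show "(\<Sum>j\<le>n. w j) \<le> \<mu>" by simp
  qed (rule w0)
  moreover from this have "((\<lambda>x. \<Sum>j. w j * x ^ j) \<longlongrightarrow> (\<Sum>j. w j)) (at_left 1)"
    using w0 by (intro powser_tendsto_at_left_1) simp
  then have "suminf w = \<mu>" using L by (rule tendsto_unique[OF trivial_limit_at_left_real])
  ultimately show ?thesis unfolding w_def by (simp add: sums_iff)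
qed

section \<open>From hypothesis (P) to the limit law\<close>

theorem theorem5p9:
  fixes \<theta> \<kappa> :: "nat \<Rightarrow> real"
    and R \<eta> \<phi> \<theta>s \<delta> gkR gk1R s a_s :: real
    and G\<theta> G\<kappa> :: "complex \<Rightarrow> complex"
  assumes \<theta>_nonneg: "\<And>j. j \<ge> 1 \<Longrightarrow> \<theta> j \<ge> 0"
    and \<kappa>_nonneg: "\<And>j. j \<ge> 1 \<Longrightarrow> \<kappa> j \<ge> 0"
    and non_arith: "\<not> (\<exists>j0::nat. j0 > 1 \<and> (\<forall>j\<ge>1. \<kappa> j \<noteq> 0 \<longrightarrow> j0 dvd j))"
    and \<kappa>_pos: "\<exists>j\<ge>2. \<kappa> j > 0"
    and R_pos: "R > 0"
    and rad\<theta>: "conv_radius (gcoeff \<theta>) = ereal R"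
    and rad\<kappa>: "conv_radius (gcoeff \<kappa>) = ereal R"
    and \<eta>_pos: "\<eta> > 0" and \<phi>_pos: "0 < \<phi>" and \<phi>_lt: "\<phi> < pi / 2"
    and hol\<theta>: "G\<theta> holomorphic_on Delta0 R \<eta> \<phi>"
    and hol\<kappa>: "G\<kappa> holomorphic_on Delta0 R \<eta> \<phi>"
    and ext\<theta>: "\<And>z. cmod z < R \<Longrightarrow> G\<theta> z = gser \<theta> z"
    and ext\<kappa>: "\<And>z. cmod z < R \<Longrightarrow> G\<kappa> z = gser \<kappa> z"
    and gk1R_lim: "((\<lambda>r. gbr 1 G\<kappa> (complex_of_real r)) \<longlongrightarrow> complex_of_real gk1R) (at_left R)"
    and gk1R_lt: "gk1R < 1"
    and \<theta>s_pos: "\<theta>s > 0" and \<delta>_pos: "\<delta> > 0"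
    and asym\<theta>: "(\<lambda>z. G\<theta> z + complex_of_real \<theta>s * Ln (1 - z / complex_of_real R))
                 \<in> O[at_Delta0 R \<eta> \<phi>](\<lambda>z. (1 - z / complex_of_real R) powr complex_of_real \<delta>)"
    and asym\<kappa>: "(\<lambda>z. G\<kappa> z - complex_of_real gkR
                      + complex_of_real gk1R * (1 - z / complex_of_real R))
                 \<in> O[at_Delta0 R \<eta> \<phi>](\<lambda>z. (1 - z / complex_of_real R) powr complex_of_real (1 + \<delta>))"
    and s_gt: "s > 1" and s_nonint: "s \<notin> \<int>" and a_s_pos: "a_s > 0"
    and below_s: "\<forall>n::nat. 1 \<le> n \<and> real n < s \<longrightarrow>
        (\<exists>c \<delta>n::real. \<delta>n > 0
           \<and> ((\<lambda>r. gbr n G\<kappa> (complex_of_real r)) \<longlongrightarrow> complex_of_real c) (at_left R)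
           \<and> (\<lambda>z. gbr n G\<kappa> z - complex_of_real c)
               \<in> O[at_Delta0 R \<eta> \<phi>](\<lambda>z. complex_of_real c * (1 - z / complex_of_real R) powr complex_of_real \<delta>n))"
    and above_s: "\<forall>n::nat. real n > s \<longrightarrow>
        (\<exists>\<delta>n::real. \<delta>n > 0
           \<and> filterlim (\<lambda>r. Re (gbr n G\<kappa> (complex_of_real r))) at_top (at_left R)
           \<and> (\<lambda>z. gbr n G\<kappa> z
                  - complex_of_real (Gamma (real n - s) * a_s / Gamma (- s))
                    * (1 - z / complex_of_real R) powr complex_of_real (s - real n))
               \<in> O[at_Delta0 R \<eta> \<phi>](\<lambda>z. complex_of_real (Gamma (real n - s) * a_s / Gamma (- s))
                    * (1 - z / complex_of_real R) powr complex_of_real (s - real n)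
                    * (1 - z / complex_of_real R) powr complex_of_real \<delta>n))"
    and all_n\<theta>: "\<forall>n::nat. 1 \<le> n \<longrightarrow>
        (\<exists>\<delta>n::real. \<delta>n > 0
           \<and> (\<lambda>z. gbr n G\<theta> z - complex_of_real (\<theta>s * fact (n - 1)) / (1 - z / complex_of_real R) ^ n)
               \<in> O[at_Delta0 R \<eta> \<phi>](\<lambda>z. complex_of_real (\<theta>s * fact (n - 1)) / (1 - z / complex_of_real R) ^ n
                    * (1 - z / complex_of_real R) powr complex_of_real \<delta>n))"
  shows "\<forall>(k::nat) (g::(nat \<Rightarrow> real) \<Rightarrow> real).
           continuous_on UNIV g \<longrightarrow> bounded (range g) \<longrightarrow>
           (\<lambda>N. \<Sum>\<sigma>\<in>{\<sigma>. \<sigma> permutes {1..N}}.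
                  ens_prob \<theta> \<kappa> N \<sigma>
                  * g (fdd_trunc k (\<lambda>i. real (ord_cycle_lengths N \<sigma> i) / (real N * (1 - gk1R)))))
           \<longlonglongrightarrow> (\<integral>y. g (fdd_trunc k y) \<partial>PD \<theta>s)"
proof (intro allI impI)
  fix k :: nat and g :: "(nat \<Rightarrow> real) \<Rightarrow> real"
  assume g: "continuous_on UNIV g" and bdd: "bounded (range g)"
  \<comment> \<open>\<open>\<theta> 0\<close> and \<open>\<kappa> 0\<close> are unconstrained, so
    index 0 is reset to 0; the factor R^j puts the singularity at 1.\<close>
  define v where "v = (\<lambda>j. if j = 0 then 0 else \<theta> j * R ^ j)"
  define w where "w = (\<lambda>j. if j = 0 then 0 else \<kappa> j * R ^ j)"
  define c where "c = (\<lambda>j. if j = 0 then 0 else v j - \<theta>s)"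
  have v0: "0 \<le> v j" for j using \<theta>_nonneg[of j] R_pos by (simp add: v_def)
  have w0: "0 \<le> w j" for j using \<kappa>_nonneg[of j] R_pos by (simp add: w_def)
  have w_sums: "w sums gk1R"
    unfolding w_def using \<kappa>_nonneg by (intro kappa_sums[OF R_pos rad\<kappa> ext\<kappa> _ gk1R_lim]) auto
  have w_null: "(\<lambda>j. real j * w j) \<longlonglongrightarrow> 0"
  proof -
    \<comment> \<open>An order large enough for \<open>kappa_coefficients\<close>, which asks for n
      \<ge> s + 2.\<close>
    define n where "n = nat \<lceil>s\<rceil> + 2"
    have n: "s + 2 \<le> real n" using s_gt unfolding n_def by linarith
    then have "real n > s" by simp
    then obtain \<delta>n where \<delta>n: "\<delta>n > 0" and asym: "(\<lambda>z. gbr n G\<kappa> z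
                  - complex_of_real (Gamma (real n - s) * a_s / Gamma (- s))
                    * (1 - z / complex_of_real R) powr complex_of_real (s - real n))
               \<in> O[at_Delta0 R \<eta> \<phi>](\<lambda>z. complex_of_real (Gamma (real n - s) * a_s / Gamma (- s))
                    * (1 - z / complex_of_real R) powr complex_of_real (s - real n)
                    * (1 - z / complex_of_real R) powr complex_of_real \<delta>n)"
      using above_s by blast
    have "(\<lambda>j. real j * (\<bar>\<kappa> j\<bar> * R ^ j)) \<longlonglongrightarrow> 0"
      by (rule kappa_coefficients[OF R_pos \<eta>_pos \<phi>_pos \<phi>_lt rad\<kappa> ext\<kappa> hol\<kappa> n \<delta>n s_gt asym])
    moreover have "real j * (\<bar>\<kappa> j\<bar> * R ^ j) = real j * w j" for j
      using \<kappa>_nonneg[of j] by (cases "j = 0") (simp_all add: w_def)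
    ultimately show ?thesis by simp
  qed
  then obtain C where C: "\<And>j. \<bar>real j * w j\<bar> \<le> C"
    using convergent_imp_Bseq[of "\<lambda>j. real j * w j"] by (auto simp: convergent_def Bseq_def)
  obtain \<delta>3 where \<delta>3: "\<delta>3 > 0" and asym3: "(\<lambda>z. gbr 3 G\<theta> z - complex_of_real (\<theta>s * fact (3 - 1)) / (1 - z / complex_of_real R) ^ 3)
       \<in> O[at_Delta0 R \<eta> \<phi>](\<lambda>z. complex_of_real (\<theta>s * fact (3 - 1)) / (1 - z / complex_of_real R) ^ 3
            * (1 - z / complex_of_real R) powr complex_of_real \<delta>3)"
    using all_n\<theta>[rule_format, of 3] by auto
  obtain K \<epsilon> where \<epsilon>: "0 < \<epsilon>" and K: "\<And>j. 3 \<le> j \<Longrightarrow> \<bar>\<theta> j * R ^ j - \<theta>s\<bar> \<le> K * real j powr (- \<epsilon>)"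
    using theta_coefficients[OF R_pos \<eta>_pos \<phi>_pos \<phi>_lt rad\<theta> ext\<theta> hol\<theta> \<delta>3 \<theta>s_pos asym3] by blast
  have cK: "\<bar>c j\<bar> \<le> K * real j powr (- \<epsilon>)" if "3 \<le> j" for j
    using K[OF that] that by (simp add: c_def v_def)
  have K_lim: "(\<lambda>j. K * real j powr (- \<epsilon>)) \<longlonglongrightarrow> K * 0"
    using \<epsilon> by (intro tendsto_mult tendsto_const tendsto_neg_powr filterlim_real_sequentially) auto
  have c_null: "c \<longlonglongrightarrow> 0"
  proof (rule Lim_null_comparison)
    show "eventually (\<lambda>j. norm (c j) \<le> K * real j powr (- \<epsilon>)) sequentially"
      using eventually_ge_at_top[of 3] by eventually_elim (use cK in simp)
    show "(\<lambda>j. K * real j powr (- \<epsilon>)) \<longlonglongrightarrow> 0" using K_lim by simp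
  qed
  \<comment> \<open>Here the polynomial rate matters: mere convergence of \<theta>_j R^j to
    \<theta>* would not make this series converge.\<close>
  have c_sum: "summable (\<lambda>j. \<bar>c j\<bar> / real j)"
  proof (rule summable_comparison_test_ev)
    show "summable (\<lambda>j. K * real j powr (- \<epsilon> - 1))"
      using \<epsilon> by (intro summable_mult) (simp add: summable_real_powr_iff)
    show "eventually (\<lambda>j. norm (\<bar>c j\<bar> / real j) \<le> K * real j powr (- \<epsilon> - 1)) sequentially"
      using eventually_ge_at_top[of 3]
    proof eventually_elim
      case (elim j)
      have "\<bar>c j\<bar> / real j \<le> K * real j powr (- \<epsilon>) / real j" using cK[OF elim] by (rule divide_right_mono) simp
      then show ?case using elim by (simp add: powr_diff)
    qed
  qed
  have v_lim: "v \<longlonglongrightarrow> \<theta>s"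
  proof -
    have "(\<lambda>j. c j + \<theta>s) \<longlonglongrightarrow> 0 + \<theta>s" by (intro tendsto_add c_null tendsto_const)
    then have "(\<lambda>j. c j + \<theta>s) \<longlonglongrightarrow> \<theta>s" by simp
    then show ?thesis
      by (rule Lim_transform_eventually) (use eventually_gt_at_top[of 0] in eventually_elim, simp add: c_def)
  qed
  define A where "A = exp (\<Sum>j. c j / real j) / Gamma \<theta>s"
  have A: "0 < A" using Gamma_real_pos[OF \<theta>s_pos] by (simp add: A_def)
  have q: "(\<lambda>n. cyc_total v n / real n powr (\<theta>s - 1)) \<longlonglongrightarrow> A"
    unfolding A_def by (rule cyc_total_asymp[OF \<theta>s_pos _ c_null _ c_sum]) (auto simp: c_def)
  interpret condensation w C gk1R v \<theta>s A
  proof unfold_locales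
    show "real j * w j \<le> C" for j using abs_le_D1[OF C] .
  qed (use v0 w0 w_sums w_null v_lim \<theta>s_pos A q gk1R_lt in \<open>auto simp: w_def\<close>)
  have lim: "(\<lambda>N. cyc_sum (mixed N) N (\<lambda>xs. g (fdd_trunc k (dec_rearr (rescaled N xs)))) / cyc_total (mixed N) N)
      \<longlonglongrightarrow> (\<integral>y. g (fdd_trunc k y) \<partial>PD \<theta>s)"
    by (rule continuous_limit[OF g bdd])
  show "(\<lambda>N. \<Sum>\<sigma>\<in>{\<sigma>. \<sigma> permutes {1..N}}.
                  ens_prob \<theta> \<kappa> N \<sigma>
                  * g (fdd_trunc k (\<lambda>i. real (ord_cycle_lengths N \<sigma> i) / (real N * (1 - gk1R)))))
           \<longlonglongrightarrow> (\<integral>y. g (fdd_trunc k y) \<partial>PD \<theta>s)"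
  proof (rule Lim_transform_eventually[OF lim])
    show "eventually (\<lambda>N. cyc_sum (mixed N) N (\<lambda>xs. g (fdd_trunc k (dec_rearr (rescaled N xs)))) / cyc_total (mixed N) N
      = (\<Sum>\<sigma>\<in>{\<sigma>. \<sigma> permutes {1..N}}. ens_prob \<theta> \<kappa> N \<sigma>
                  * g (fdd_trunc k (\<lambda>i. real (ord_cycle_lengths N \<sigma> i) / (real N * (1 - gk1R)))))) sequentially"
      using eventually_gt_at_top[of 0]
    proof eventually_elim
      case (elim N)
      define \<Psi> where "\<Psi> = (\<lambda>X. g (fdd_trunc k (dec_rearr (rescaled N (sorted_list_of_multiset X)))))"
      have \<Psi>_mset: "\<Psi> (mset xs) = g (fdd_trunc k (dec_rearr (rescaled N xs)))" for xs
      proof -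
        have "mset (map (\<lambda>x. real x / (real N * (1 - gk1R))) (sorted_list_of_multiset (mset xs))) = mset (map (\<lambda>x. real x / (real N * (1 - gk1R))) xs)"
          by (simp only: mset_map mset_sorted_list_of_multiset)
        from dec_rearr_pad_cong[OF this] show ?thesis unfolding \<Psi>_def rescaled_def by (rule arg_cong)
      qed
      have ord: "g (fdd_trunc k (\<lambda>i. real (ord_cycle_lengths N \<sigma> i) / (real N * (1 - gk1R)))) = \<Psi> (cyc_type {1..N} \<sigma>)" for \<sigma>
      proof -
        have "0 < real N * (1 - gk1R)" using elim gk1R_lt by simp
        from ord_cycle_lengths_eq_dec_rearr[OF this mset_sorted_list_of_multiset]
        show ?thesis unfolding \<Psi>_def rescaled_def by simp
      qed
      \<comment> \<open>The factor R^N is common to numerator and normalisation and cancels.\<close>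
      have scale: "cyc_sum (mixed N) N F = R ^ N * cyc_sum (\<lambda>j. \<theta> j + real N * \<kappa> j) N F" for F
      proof -
        have "cyc_sum (mixed N) N F = cyc_sum (\<lambda>j. (\<theta> j + real N * \<kappa> j) * R ^ j) N F"
          by (rule cyc_sum_cong) (auto simp: v_def w_def algebra_simps)
        then show ?thesis by (simp only: cyc_sum_scale)
      qed
      have "(\<Sum>\<sigma>\<in>{\<sigma>. \<sigma> permutes {1..N}}. ens_prob \<theta> \<kappa> N \<sigma> * \<Psi> (cyc_type {1..N} \<sigma>)) =
        cyc_sum (\<lambda>j. \<theta> j + real N * \<kappa> j) N (\<lambda>xs. \<Psi> (mset xs)) / cyc_total (\<lambda>j. \<theta> j + real N * \<kappa> j) N"
        by (rule ens_prob_expectation)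
      also have "\<dots> = cyc_sum (mixed N) N (\<lambda>xs. \<Psi> (mset xs)) / cyc_total (mixed N) N"
        using R_pos unfolding scale by simp
      finally show ?case unfolding ord \<Psi>_mset by simp
    qed
  qed
qed

end
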